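(* Let $\Phi_k$ denote the set of graphs in $\Phi$ with exactly $k$ vertices. Then the sequence $\eta(\Phi_0),\eta(\Phi_1),\eta(\Phi_2),\eta(\Phi_3),\dots$ is non-increasing, and $\xi_k=\eta(\Phi_k)$ for every $k=0,1,2,\dots$.
   Context: All graphs are finite and undirected, possibly with loops and parallel edges; the degree $d(x)$ of a vertex counts each loop at $x$ twice. The flow polynomial $F(G,\lambda)$ is determined by: $F(G,\lambda)=1$ if $E(G)=\emptyset$; $F(G,\lambda)=0$ if $G$ has a bridge; $F(G_1\cup G_2,\lambda)=F(G_1,\lambda)F(G_2,\lambda)$ for a disjoint union; $F(G,\lambda)=(\lambda-1)F(G-e,\lambda)$ if $e$ is a loop; otherwise $F(G,\lambda)=F(G/e,\lambda)-F(G-e,\lambda)$, where $G/e$ is obtained by contracting $e$. Its roots are the flow roots of $G$. For vertices $u_1,u_2$, $G/u_1u_2$ denotes the graph obtained by identifying $u_1$ and $u_2$ (edges joining them become loops). A graph is non-separable if it is connected, has no cut-vertex, and either has no loops or has exactly one vertex and one edge; a block is a maximal non-separable subgraph, and $b(G)$ is the number of blocks of $G$ having at least one edge. Let $W(G)$ be the set of vertices of degree larger than $3$, and $\Psi_k$ the set of bridgeless connected graphs $G$ with $|W(G)|\le k$. Let $\xi_k$ be the supremum of the numbers $\beta\in(1,2]$ such that no graph in $\Psi_k$ has a flow root in $(1,\beta)$. For a bridgeless graph $G$, $\eta(G)$ is the smallest flow root of $G$ in $(1,2]$ if one exists and $\eta(G)=2$ otherwise; for a set $\mathcal S$ of bridgeless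 graphs, $\eta(\mathcal S)=\inf\{\eta(G):G\in\mathcal S\}$ if $\mathcal S\neq\emptyset$ and $\eta(\emptyset)=2$. $\Phi$ is the set of non-separable graphs $G$ with $|V(G)|\ge 2$ such that: (a') $G-e$ is non-separable for every edge $e$; (b') $b(G/e)$ is even for every edge $e$; (c') whenever $G_1,G_2$ are subgraphs of $G$ with $|E(G_1)|\ge2$, $|E(G_2)|\ge 2$, $V(G_1)\cap V(G_2)=\{u_1,u_2\}$ (two distinct vertices), $V(G_1)\cup V(G_2)=V(G)$, $E(G_1)\cap E(G_2)=\emptyset$ and $E(G_1)\cup E(G_2)=E(G)$, the three integers $b(G_1/u_1u_2)$, $b(G_1)-1$ and $b(G_2)$ all have the same parity. *)

theory Defs
  imports Complex_Main
begin

text \<open>Finite multigraphs (loops and parallel edges allowed). Every finite graph is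
isomorphic to one whose vertices and edges are natural numbers, so we fix that encoding.
An edge e joins the two (possibly equal) vertices fst (ends G e) and snd (ends G e);
the orientation is irrelevant.\<close>

record graph =
  verts :: "nat set"
  edges :: "nat set"
  ends  :: "nat \<Rightarrow> nat \<times> nat"

definition wf_graph :: "graph \<Rightarrow> bool" where
  "wf_graph G \<longleftrightarrow> finite (verts G) \<and> finite (edges G) \<and>
     (\<forall>e\<in>edges G. fst (ends G e) \<in> verts G \<and> snd (ends G e) \<in> verts G)"

definition is_loop :: "graph \<Rightarrow> nat \<Rightarrow> bool" where
  "is_loop G e \<longleftrightarrow> fst (ends G e) = snd (ends G e)"

definition degree :: "graph \<Rightarrow> nat \<Rightarrow> nat" where
  "degree G x = card {e\<in>edges G. fst (ends G e) = x} + card {e\<in>edges G. snd (ends G e) = x}"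

definition adj_rel :: "graph \<Rightarrow> (nat \<times> nat) set" where
  "adj_rel G = {(x, y). \<exists>e\<in>edges G. ends G e = (x, y) \<or> ends G e = (y, x)}"

definition reachable :: "graph \<Rightarrow> nat \<Rightarrow> nat \<Rightarrow> bool" where
  "reachable G x y \<longleftrightarrow> x \<in> verts G \<and> y \<in> verts G \<and> (x, y) \<in> (adj_rel G)\<^sup>*"

definition connected :: "graph \<Rightarrow> bool" where
  "connected G \<longleftrightarrow> verts G \<noteq> {} \<and> (\<forall>x\<in>verts G. \<forall>y\<in>verts G. reachable G x y)"

definition ncomp :: "graph \<Rightarrow> nat" where
  "ncomp G = card ((\<lambda>x. {y. reachable G x y}) ` verts G)"

definition del_edge :: "graph \<Rightarrow> nat \<Rightarrow> graph" where
  "del_edge G e = G\<lparr>edges := edges G - {e}\<rparr>"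

definition del_vertex :: "graph \<Rightarrow> nat \<Rightarrow> graph" where
  "del_vertex G v = \<lparr>verts = verts G - {v},
      edges = {e\<in>edges G. fst (ends G e) \<noteq> v \<and> snd (ends G e) \<noteq> v},
      ends = ends G\<rparr>"

definition identify :: "graph \<Rightarrow> nat \<Rightarrow> nat \<Rightarrow> graph" where
  "identify G u v = (let r = (\<lambda>w. if w = v then u else w) in
     \<lparr>verts = (if u = v then verts G else verts G - {v}),
      edges = edges G,
      ends = (\<lambda>e. (r (fst (ends G e)), r (snd (ends G e))))\<rparr>)"

text \<open>G/e: contraction of edge e (for a loop this is just deletion).\<close>
definition contract :: "graph \<Rightarrow> nat \<Rightarrow> graph" where
  "contract G e = identify (del_edge G e) (fst (ends G e)) (snd (ends G e))"

definition is_bridge :: "graph \<Rightarrow> nat \<Rightarrow> bool" where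
  "is_bridge G e \<longleftrightarrow> e \<in> edges G \<and>
     \<not> reachable (del_edge G e) (fst (ends G e)) (snd (ends G e))"

definition bridgeless :: "graph \<Rightarrow> bool" where
  "bridgeless G \<longleftrightarrow> (\<forall>e\<in>edges G. \<not> is_bridge G e)"

definition cut_vertex :: "graph \<Rightarrow> nat \<Rightarrow> bool" where
  "cut_vertex G v \<longleftrightarrow> v \<in> verts G \<and> ncomp (del_vertex G v) > ncomp G"

definition nonsep :: "graph \<Rightarrow> bool" where
  "nonsep G \<longleftrightarrow> connected G \<and> (\<forall>v\<in>verts G. \<not> cut_vertex G v) \<and>
     ((\<forall>e\<in>edges G. \<not> is_loop G e) \<or> (card (verts G) = 1 \<and> card (edges G) = 1))"

definition is_sub :: "nat set \<Rightarrow> nat set \<Rightarrow> graph \<Rightarrow> bool" where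
  "is_sub V' E' G \<longleftrightarrow> V' \<subseteq> verts G \<and> E' \<subseteq> edges G \<and>
     (\<forall>e\<in>E'. fst (ends G e) \<in> V' \<and> snd (ends G e) \<in> V')"

definition sub :: "graph \<Rightarrow> nat set \<Rightarrow> nat set \<Rightarrow> graph" where
  "sub G V' E' = \<lparr>verts = V', edges = E', ends = ends G\<rparr>"

definition is_block :: "graph \<Rightarrow> nat set \<Rightarrow> nat set \<Rightarrow> bool" where
  "is_block G V' E' \<longleftrightarrow> is_sub V' E' G \<and> nonsep (sub G V' E') \<and>
     (\<forall>V'' E''. is_sub V'' E'' G \<and> nonsep (sub G V'' E'') \<and> V' \<subseteq> V'' \<and> E' \<subseteq> E''
        \<longrightarrow> V'' = V' \<and> E'' = E')"

definition nblocks :: "graph \<Rightarrow> nat" where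
  "nblocks G = card {(V', E'). is_block G V' E' \<and> E' \<noteq> {}}"

definition flow_rules :: "(graph \<Rightarrow> real \<Rightarrow> real) \<Rightarrow> bool" where
  "flow_rules f \<longleftrightarrow> (\<forall>G. wf_graph G \<longrightarrow>
     (edges G = {} \<longrightarrow> f G = (\<lambda>_. 1)) \<and>
     (\<not> bridgeless G \<longrightarrow> f G = (\<lambda>_. 0)) \<and>
     (\<forall>V1 V2. V1 \<inter> V2 = {} \<and> V1 \<union> V2 = verts G \<and>
        (\<forall>e\<in>edges G. (fst (ends G e) \<in> V1 \<and> snd (ends G e) \<in> V1) \<or>
                      (fst (ends G e) \<in> V2 \<and> snd (ends G e) \<in> V2)) \<longrightarrow>
        f G = (\<lambda>x. f (sub G V1 {e\<in>edges G. fst (ends G e) \<in> V1}) x *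
                   f (sub G V2 {e\<in>edges G. fst (ends G e) \<in> V2}) x)) \<and>
     (\<forall>e\<in>edges G. is_loop G e \<longrightarrow> f G = (\<lambda>x. (x - 1) * f (del_edge G e) x)) \<and>
     (\<forall>e\<in>edges G. bridgeless G \<and> \<not> is_loop G e \<longrightarrow>
        f G = (\<lambda>x. f (contract G e) x - f (del_edge G e) x)))"

definition flow_poly :: "graph \<Rightarrow> real \<Rightarrow> real" where
  "flow_poly G = (THE p. \<exists>f. flow_rules f \<and> f G = p)"

definition W :: "graph \<Rightarrow> nat set" where
  "W G = {x\<in>verts G. degree G x > 3}"

definition Psi :: "nat \<Rightarrow> graph set" where
  "Psi k = {G. wf_graph G \<and> bridgeless G \<and> connected G \<and> card (W G) \<le> k}"

definition xi :: "nat \<Rightarrow> real" where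
  "xi k = Sup {\<beta>. 1 < \<beta> \<and> \<beta> \<le> 2 \<and>
     (\<forall>G\<in>Psi k. \<forall>r. 1 < r \<and> r < \<beta> \<longrightarrow> flow_poly G r \<noteq> 0)}"

definition eta :: "graph \<Rightarrow> real" where
  "eta G = (if \<exists>r. 1 < r \<and> r \<le> 2 \<and> flow_poly G r = 0
            then Min {r. 1 < r \<and> r \<le> 2 \<and> flow_poly G r = 0} else 2)"

definition eta_set :: "graph set \<Rightarrow> real" where
  "eta_set S = (if S = {} then 2 else Inf (eta ` S))"

definition Phi :: "graph set" where
  "Phi = {G. wf_graph G \<and> nonsep G \<and> card (verts G) \<ge> 2 \<and>
     (\<forall>e\<in>edges G. nonsep (del_edge G e)) \<and>
     (\<forall>e\<in>edges G. even (nblocks (contract G e))) \<and>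
     (\<forall>V1 E1 V2 E2 u1 u2. is_sub V1 E1 G \<and> is_sub V2 E2 G \<and>
        card E1 \<ge> 2 \<and> card E2 \<ge> 2 \<and> u1 \<noteq> u2 \<and> V1 \<inter> V2 = {u1, u2} \<and>
        V1 \<union> V2 = verts G \<and> E1 \<inter> E2 = {} \<and> E1 \<union> E2 = edges G \<longrightarrow>
        (even (int (nblocks (identify (sub G V1 E1) u1 u2))) \<longleftrightarrow> even (int (nblocks (sub G V1 E1)) - 1)) \<and>
        (even (int (nblocks (sub G V1 E1)) - 1) \<longleftrightarrow> even (int (nblocks (sub G V2 E2)))))}"

definition Phi_k :: "nat \<Rightarrow> graph set" where
  "Phi_k k = {G\<in>Phi. card (verts G) = k}"

end

theory Submission
  imports Defs "HOL-Library.FuncSet"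
begin

text \<open>
  For a connected graph put \<open>p(G) = |E| + |V| + 1 + b(G)\<close> and consider the signed flow polynomial
  \<open>Q(G) = (-1)^p(G) F(G)\<close>, which is multiplicative over blocks and positive immediately to the right
  of 1 if \<open>G\<close> is bridgeless. Fix \<open>x\<close> in \<open>(1,2)\<close> and let \<open>G\<close> have the fewest edges among the graphs
  in \<open>Psi k\<close> with \<open>Q(G,x) \<le> 0\<close>. Multiplicativity makes \<open>G\<close> non-separable, and then
  \<open>Q(G) = - (-1)^b(G/e) Q(G/e) - (-1)^b(G-e) Q(G-e)\<close> together with the 2-sum formula
  \<open>F(G) = F(G1) F(G2) + F(G1+f) F(G2+f) / (x-1)\<close>, where \<open>f\<close> joins the two common vertices,
  excludes vertices of degree at most 3 and forces conditions (a'), (b') and (c').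
  So \<open>G\<close> is in \<open>Phi\<close> and has at most \<open>k\<close> vertices; as \<open>Q(G)\<close> is positive near 1,
  \<open>F(G)\<close> has a root in \<open>(1,x]\<close>.

  By (c') the multiplicities of edges in \<open>Phi\<close> are bounded, so only finitely many polynomials belong to
  graphs in \<open>Phi\<close> with at most \<open>k\<close> vertices, and a least root \<open>r < 2\<close> is attained. If \<open>G\<close> is minimal
  at \<open>r\<close>, so that \<open>F(G,r) = 0\<close>, replace an edge \<open>e\<close> of \<open>G\<close> by a path of two double edges. The
  resulting graph \<open>H\<close> has one vertex more and \<open>Q(H,r) = - Q(G-e,r) (r-1)^2 < 0\<close>. Hence some graph in
  \<open>Phi\<close> with \<open>k+1\<close> vertices has a root below \<open>r\<close>, and the least root is always attained by a graph with
  exactly \<open>k\<close> vertices.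
\<close>

section \<open>Connectivity by edges and the flow polynomial\<close>

text \<open>Fixing \<open>x\<close> and asking for the sign of \<open>Q\<close>, not for roots,
  turns every step into the same contradiction: an identity that would write \<open>Q(G)\<close> as
  a sum of positive terms of smaller graphs. The obstacle is that these graphs must stay in the
  class. Contracting an edge at a vertex of degree 3 whose other end is large creates no additional
  large vertex; if no vertex is large, one may appear, so the argument runs with
  \<open>k \<ge> 1\<close>. The case \<open>k = 0\<close> reduces to it, as graphs in
  \<open>Phi\<close> have at least two vertices. Once all degrees are at least 4, every vertex
  counts as large, and a bound on the number of vertices is enough to stay in the class. The
  delicate part of (c') is the parity of \<open>b(G1/u1u2)\<close> for odd \<open>b(G1)\<close>:
  there the 2-sum formula alone is too weak, and \<open>G2\<close> with two added edges has to be
  compared with \<open>G2\<close> and \<open>G2+f\<close>. The double path is made for the 2-sum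
  formula at a root: the product that contains \<open>F(G)\<close> drops out, the path contributes
  the nonzero factor \<open>(r-1)^2\<close>, and its one additional vertex reverses the
  sign.\<close>

definition adj :: "(nat \<Rightarrow> nat \<times> nat) \<Rightarrow> nat set \<Rightarrow> (nat \<times> nat) set" where
  "adj s A = {(x, y). \<exists>e\<in>A. s e = (x, y) \<or> s e = (y, x)}"

text \<open>Without a vertex set, a vertex that meets no edge is linked to itself only. Rank,
  nullity and flow polynomial can so be functions of the edges alone.\<close>

definition linked :: "(nat \<Rightarrow> nat \<times> nat) \<Rightarrow> nat set \<Rightarrow> nat \<Rightarrow> nat \<Rightarrow> bool" where
  "linked s A x y \<longleftrightarrow> (x, y) \<in> (adj s A)\<^sup>*"

lemma adj_rel_eq: "adj_rel G = adj (ends G) (edges G)"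
  by (simp add: adj_rel_def adj_def)

lemma linked_refl [simp]: "linked s A x x"
  by (simp add: linked_def)

lemma linked_trans: "linked s A x y \<Longrightarrow> linked s A y z \<Longrightarrow> linked s A x z"
  by (simp add: linked_def)

lemma linked_sym: "linked s A x y \<Longrightarrow> linked s A y x"
proof -
  have "sym (adj s A)" by (auto simp: adj_def sym_def)
  then show "linked s A x y \<Longrightarrow> linked s A y x"
    unfolding linked_def by (meson symD sym_rtrancl)
qed

lemma linked_edge: "e \<in> A \<Longrightarrow> linked s A (fst (s e)) (snd (s e))"
  unfolding linked_def by (rule r_into_rtrancl) (auto simp: adj_def intro!: bexI[of _ e])

text \<open>The common tool for deletion, contraction and rerouting: it suffices to say where each
  single edge goes. With \<open>h\<close> the identity an edge is replaced by a detour; with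
  \<open>h\<close> moving one vertex to another the two are merged.\<close>

lemma linked_map:
  assumes "linked s A x y"
    and "\<And>e. e \<in> A \<Longrightarrow> linked s' B (h (fst (s e))) (h (snd (s e)))"
  shows "linked s' B (h x) (h y)"
  using assms(1) unfolding linked_def[of s]
proof (induction rule: rtrancl_induct)
  case (step y z)
  then obtain e where "e \<in> A" "s e = (y, z) \<or> s e = (z, y)" by (auto simp: adj_def)
  then have "linked s' B (h y) (h z)" using assms(2)[of e] linked_sym by auto
  with step.IH show ?case by (rule linked_trans)
qed simp

lemma linked_mono: "linked s A x y \<Longrightarrow> A \<subseteq> B \<Longrightarrow> linked s B x y"
  using linked_map[of s A x y s B "\<lambda>x. x"] linked_edge[of _ B s] by blast

lemma linked_cong: "(\<And>e. e \<in> A \<Longrightarrow> s e = s' e) \<Longrightarrow> linked s A x y \<longleftrightarrow> linked s' A x y"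
  using linked_map[of s A x y s' A "\<lambda>x. x"] linked_map[of s' A x y s A "\<lambda>x. x"]
    linked_edge[of _ A s] linked_edge[of _ A s'] by metis

lemma linked_closed:
  assumes "linked s A x y" "x \<in> D"
    and "\<And>e. e \<in> A \<Longrightarrow> fst (s e) \<in> D \<longleftrightarrow> snd (s e) \<in> D"
  shows "y \<in> D"
  using assms(1,2) unfolding linked_def
proof (induction rule: rtrancl_induct)
  case (step y z)
  then obtain e where "e \<in> A" "s e = (y, z) \<or> s e = (z, y)" by (auto simp: adj_def)
  then show ?case using assms(3)[of e] step by auto
qed

lemma linked_empty [simp]: "linked s {} x y \<longleftrightarrow> x = y"
  using linked_closed[of s "{}" x y "{x}"] by auto

lemma linked_isolated:
  assumes "linked s A x y" "\<And>e. e \<in> A \<Longrightarrow> fst (s e) \<noteq> x \<and> snd (s e) \<noteq> x"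
  shows "y = x"
  using linked_closed[OF assms(1), of "{x}"] assms(2) by auto

lemma linked_ends:
  assumes "linked s A x y" "x \<noteq> y"
  shows "\<exists>e\<in>A. fst (s e) = x \<or> snd (s e) = x"
  using linked_isolated[OF assms(1)] assms(2) by metis

text \<open>A path with ends in \<open>V2\<close> is cut at its visits to \<open>V1 \<inter> V2\<close>; every piece inside \<open>V1\<close> is replaced
  by a connection in \<open>B'\<close>.\<close>
lemma linked_glue:
  assumes A: "\<And>e. e \<in> A \<Longrightarrow> fst (s e) \<in> V1 \<and> snd (s e) \<in> V1"
    and B: "\<And>e. e \<in> B \<Longrightarrow> fst (s e) \<in> V2 \<and> snd (s e) \<in> V2"
    and S: "\<And>x y. x \<in> V1 \<inter> V2 \<Longrightarrow> y \<in> V1 \<inter> V2 \<Longrightarrow> linked s A x y \<Longrightarrow> linked s' B' x y"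
    and B': "\<And>e. e \<in> B \<Longrightarrow> linked s' B' (fst (s e)) (snd (s e))"
    and L: "linked s (A \<union> B) x y" and x: "x \<in> V2" and y: "y \<in> V2"
  shows "linked s' B' x y"
proof -
  let ?I = "\<lambda>z. (z \<in> V2 \<and> linked s' B' x z) \<or> (\<exists>t\<in>V1 \<inter> V2. linked s' B' x t \<and> linked s A t z)"
  have stay: "z \<in> V1" if "linked s A t z" "t \<in> V1" for t z
    using linked_closed[OF that] A by blast
  have I: "?I z" if "linked s (A \<union> B) x z" for z
    using that unfolding linked_def[of s "A \<union> B"]
  proof (induction rule: rtrancl_induct)
    case base
    then show ?case using x by simp
  next
    case (step z z')
    then obtain e where e: "e \<in> A \<union> B" "s e = (z, z') \<or> s e = (z', z)" by (auto simp: adj_def)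
    show ?case
    proof (cases "e \<in> A")
      case True
      then have "linked s A z z'" "z \<in> V1" using e A[of e] linked_edge[of e A s] linked_sym by auto
      then show ?thesis using step.IH by (meson IntI linked_refl linked_trans)
    next
      case False
      then have *: "linked s' B' z z'" "z \<in> V2" "z' \<in> V2" using e B[of e] B'[of e] linked_sym by auto
      have "linked s' B' x z"
        using step.IH
      proof
        assume "\<exists>t\<in>V1 \<inter> V2. linked s' B' x t \<and> linked s A t z"
        then obtain t where t: "t \<in> V1 \<inter> V2" "linked s' B' x t" "linked s A t z" by blast
        then show ?thesis using S[of t z] stay * by (meson IntD1 IntI linked_trans)
      qed simp
      then show ?thesis using * linked_trans by blast
    qed
  qed
  from I[OF L] show ?thesis
  proof
    assume "\<exists>t\<in>V1 \<inter> V2. linked s' B' x t \<and> linked s A t y"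
    then obtain t where t: "t \<in> V1 \<inter> V2" "linked s' B' x t" "linked s A t y" by blast
    then show ?thesis using S[of t y] stay y by (meson IntD1 IntI linked_trans)
  qed simp
qed

lemma linked_insert_same:
  assumes "linked s A (fst (s e)) (snd (s e))"
  shows "linked s (insert e A) x y \<longleftrightarrow> linked s A x y"
  using linked_map[of s "insert e A" x y s A "\<lambda>x. x"] assms linked_edge[of _ A s]
    linked_mono[of s A x y "insert e A"] by blast

lemma linked_insert:
  "linked s (insert e A) x y \<longleftrightarrow> linked s A x y \<or>
    (linked s A x (fst (s e)) \<and> linked s A (snd (s e)) y) \<or>
    (linked s A x (snd (s e)) \<and> linked s A (fst (s e)) y)" (is "?l \<longleftrightarrow> ?r y")
proof
  assume ?l
  then show "?r y" unfolding linked_def[of s "insert e A"]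
  proof (induction rule: rtrancl_induct)
    case (step y z)
    then obtain e' where e': "e' \<in> insert e A" "s e' = (y, z) \<or> s e' = (z, y)" by (auto simp: adj_def)
    show ?case
    proof (cases "e' \<in> A")
      case True
      then have "linked s A y z" using linked_edge[OF True, of s] e' linked_sym by auto
      then show ?thesis using step.IH linked_trans by blast
    next
      case False
      then have "e' = e" using e' by auto
      then have "(y = fst (s e) \<and> z = snd (s e)) \<or> (z = fst (s e) \<and> y = snd (s e))"
        using e' by auto
      then show ?thesis using step.IH linked_trans linked_sym linked_refl by metis
    qed
  qed simp
next
  assume "?r y"
  then show ?l
    using linked_mono[of s A _ _ "insert e A"] linked_edge[of e "insert e A" s] 
    by (meson insertI1 linked_sym linked_trans subset_insertI)
qed

text \<open>Counts the vertices that are not least in their component. This is the rank of the edge set,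
  and it needs no reference to the vertex set of the graph.\<close>
definition edge_rank :: "(nat \<Rightarrow> nat \<times> nat) \<Rightarrow> nat set \<Rightarrow> nat" where
  "edge_rank s A = card {x. \<exists>y<x. linked s A x y}"

text \<open>The cyclomatic number. By \<open>edge_rank_le\<close> the truncated subtraction is exact
  for finite \<open>A\<close>.\<close>

definition nullity :: "(nat \<Rightarrow> nat \<times> nat) \<Rightarrow> nat set \<Rightarrow> nat" where
  "nullity s A = card A - edge_rank s A"

lemma finite_edge_rank:
  assumes "finite A"
  shows "finite {x. \<exists>y<x. linked s A x y}"
proof (rule finite_subset)
  show "{x. \<exists>y<x. linked s A x y} \<subseteq> fst ` s ` A \<union> snd ` s ` A"
  proof
    fix x assume "x \<in> {x. \<exists>y<x. linked s A x y}"
    then obtain y where "linked s A x y" "x \<noteq> y" by auto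
    then obtain e where "e \<in> A" "fst (s e) = x \<or> snd (s e) = x" using linked_ends by blast
    then show "x \<in> fst ` s ` A \<union> snd ` s ` A" by (metis UnCI image_eqI)
  qed
qed (use assms in auto)

lemma edge_rank_insert_same:
  assumes "linked s A (fst (s e)) (snd (s e))"
  shows "edge_rank s (insert e A) = edge_rank s A"
  unfolding edge_rank_def by (simp add: linked_insert_same[OF assms])

text \<open>With \<open>a\<close> and \<open>b\<close> the least vertices of the two components that
  \<open>e\<close> merges, exactly one vertex stops being least in its component, namely
  \<open>max a b\<close>.\<close>

lemma edge_rank_insert_new:
  assumes "\<not> linked s A (fst (s e)) (snd (s e))" "finite A"
  shows "edge_rank s (insert e A) = Suc (edge_rank s A)"
proof -
  let ?u = "fst (s e)" and ?v = "snd (s e)"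
  define a where "a = (LEAST y. linked s A ?u y)"
  define b where "b = (LEAST y. linked s A ?v y)"
  have a: "linked s A ?u a" unfolding a_def by (rule LeastI[of _ ?u]) simp
  have b: "linked s A ?v b" unfolding b_def by (rule LeastI[of _ ?v]) simp
  have la: "a \<le> y" if "linked s A ?u y" for y unfolding a_def using that by (rule Least_le)
  have lb: "b \<le> y" if "linked s A ?v y" for y unfolding b_def using that by (rule Least_le)
  have ab: "a \<noteq> b" using a b assms(1) linked_trans linked_sym by metis
  let ?N = "{x. \<exists>y<x. linked s A x y}"
  have notin: "max a b \<notin> ?N"
  proof
    assume "max a b \<in> ?N"
    then obtain y where y: "y < max a b" "linked s A (max a b) y" by blast
    show False
    proof (cases "a < b")
      case True
      then have "y < b" "linked s A b y" using y by auto
      then show ?thesis using lb[of y] linked_trans[OF b] by fastforce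
    next
      case False
      then have "y < a" "linked s A a y" using y by (auto simp: max_def split: if_splits)
      then show ?thesis using la[of y] linked_trans[OF a] by fastforce
    qed
  qed
  have "{x. \<exists>y<x. linked s (insert e A) x y} = insert (max a b) ?N"
  proof (intro equalityI subsetI)
    fix x assume "x \<in> {x. \<exists>y<x. linked s (insert e A) x y}"
    then obtain y where y: "y < x" "linked s (insert e A) x y" by blast
    show "x \<in> insert (max a b) ?N"
    proof (cases "x \<in> ?N")
      case False
      then have nl: "\<not> linked s A x z" if "z < x" for z using that by blast
      have "(linked s A x ?u \<and> linked s A ?v y) \<or> (linked s A x ?v \<and> linked s A ?u y)"
        using y nl linked_insert by blast
      then show ?thesis
      proof
        assume *: "linked s A x ?u \<and> linked s A ?v y"
        have "a \<le> x" using la * linked_sym by blast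
        moreover have "linked s A x a" using * a linked_trans by blast
        ultimately have "a = x" using nl le_neq_implies_less by blast
        moreover have "b \<le> y" using lb * by blast
        ultimately show ?thesis using y by simp
      next
        assume *: "linked s A x ?v \<and> linked s A ?u y"
        have "b \<le> x" using lb * linked_sym by blast
        moreover have "linked s A x b" using * b linked_trans by blast
        ultimately have "b = x" using nl le_neq_implies_less by blast
        moreover have "a \<le> y" using la * by blast
        ultimately show ?thesis using y by simp
      qed
    qed simp
  next
    fix x assume "x \<in> insert (max a b) ?N"
    then show "x \<in> {x. \<exists>y<x. linked s (insert e A) x y}"
    proof
      assume x: "x = max a b"
      have ab': "linked s (insert e A) a b"
        using a b linked_insert[of s e A a b] linked_sym by blast
      show ?thesis
      proof (cases "a < b")
        case True
        then have "x = b" using x by (simp add: max_def)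
        then have "a < x" "linked s (insert e A) x a" using True linked_sym[OF ab'] by simp_all
        then show ?thesis unfolding mem_Collect_eq by (intro exI conjI)
      next
        case False
        then have ba: "b < a" using ab by simp
        then have "x = a" using x by (simp add: max_def)
        then have "b < x" "linked s (insert e A) x b" using ba ab' by simp_all
        then show ?thesis unfolding mem_Collect_eq by (intro exI conjI)
      qed
    next
      assume "x \<in> ?N"
      then show ?thesis using linked_mono[of s A _ _ "insert e A"] by blast
    qed
  qed
  then show ?thesis unfolding edge_rank_def using notin finite_edge_rank[OF assms(2)] by simp
qed

lemma edge_rank_empty [simp]: "edge_rank s {} = 0"
  by (simp add: edge_rank_def)

lemma edge_rank_le: "finite A \<Longrightarrow> edge_rank s A \<le> card A"
proof (induction rule: finite_induct)
  case (insert e A)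
  then show ?case
    using edge_rank_insert_same[of s A e] edge_rank_insert_new[of s A e]
        by (cases "linked s A (fst (s e)) (snd (s e))") auto
qed simp

lemma nullity_empty [simp]: "nullity s {} = 0"
  by (simp add: nullity_def)

lemma nullity_insert:
  assumes "finite A" "e \<notin> A"
  shows "nullity s (insert e A) = nullity s A + (if linked s A (fst (s e)) (snd (s e)) then 1 else 0)"
  using assms edge_rank_insert_same[of s A e] edge_rank_insert_new[of s A e] edge_rank_le[of A s]
  by (auto simp: nullity_def)

lemma nullity_cong: "(\<And>e. e \<in> A \<Longrightarrow> s e = s' e) \<Longrightarrow> nullity s A = nullity s' A"
  using linked_cong[of A s s'] by (simp add: nullity_def edge_rank_def)

text \<open>If \<open>A\<close> joins no two common vertices, an excursion into the first side
  returns to the vertex where it began, so \<open>A\<close> changes no connection within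
  \<open>V2\<close>. Adding the edges of \<open>B\<close> one by one then raises both nullities at
  the same moments.\<close>

lemma nullity_glue_disconnected:
  assumes fin: "finite A" "finite B" and disj: "A \<inter> B = {}"
    and A: "\<And>e. e \<in> A \<Longrightarrow> fst (s e) \<in> V1 \<and> snd (s e) \<in> V1"
    and B: "\<And>e. e \<in> B \<Longrightarrow> fst (s e) \<in> V2 \<and> snd (s e) \<in> V2"
    and S: "\<And>x y. x \<in> V1 \<inter> V2 \<Longrightarrow> y \<in> V1 \<inter> V2 \<Longrightarrow> linked s A x y \<Longrightarrow> x = y"
  shows "nullity s (A \<union> B) = nullity s A + nullity s B"
  using fin(2) disj B
proof (induction B rule: finite_induct)
  case (insert e B)
  have "linked s (A \<union> B) (fst (s e)) (snd (s e)) \<longleftrightarrow> linked s B (fst (s e)) (snd (s e))"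
  proof
    assume l: "linked s (A \<union> B) (fst (s e)) (snd (s e))"
    have S': "linked s B x y" if "x \<in> V1 \<inter> V2" "y \<in> V1 \<inter> V2" "linked s A x y" for x y
      using S[OF that] by simp
    show "linked s B (fst (s e)) (snd (s e))"
      by (rule linked_glue[where ?V1.0 = V1 and ?V2.0 = V2 and A = A and B' = B
          and s' = s, OF _ _ S' _ l])
        (use A insert.prems linked_edge[of _ B s] in auto)
  qed (use linked_mono in blast)
  then show ?case
    using insert nullity_insert[of "A \<union> B" e s] nullity_insert[of B e s] fin(1) by auto
qed simp

text \<open>A set \<open>A\<close> that joins \<open>u\<close> and \<open>v\<close> acts on the
  other side exactly like the single edge \<open>f\<close>. Alone, \<open>f\<close> has nullity 0,
  which starts the induction on \<open>B\<close>.\<close>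

lemma nullity_glue_connected:
  assumes fin: "finite A" "finite B" and disj: "A \<inter> B = {}"
    and A: "\<And>e. e \<in> A \<Longrightarrow> fst (s e) \<in> V1 \<and> snd (s e) \<in> V1"
    and B: "\<And>e. e \<in> B \<Longrightarrow> fst (s e) \<in> V2 \<and> snd (s e) \<in> V2"
    and f: "f \<notin> B" "s f = (u, v)" "u \<noteq> v" and S: "V1 \<inter> V2 = {u, v}"
    and L: "linked s A u v"
  shows "nullity s (A \<union> B) = nullity s A + nullity s (insert f B)"
  using fin(2) disj B f(1)
proof (induction B rule: finite_induct)
  case empty
  then show ?case using nullity_insert[of "{}" f s] f by simp
next
  case (insert e B)
  have "linked s (A \<union> B) (fst (s e)) (snd (s e)) \<longleftrightarrow> linked s (insert f B) (fst (s e)) (snd (s e))"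
  proof
    assume l: "linked s (A \<union> B) (fst (s e)) (snd (s e))"
    have uv: "linked s (insert f B) u v" using linked_edge[of f "insert f B" s] f by simp
    show "linked s (insert f B) (fst (s e)) (snd (s e))"
      by (rule linked_glue[where ?V1.0 = V1 and ?V2.0 = V2 and A = A, OF _ _ _ _ l])
        (use A S uv linked_sym[OF uv] insert.prems linked_edge[of _ "insert f B" s] in auto)
  next
    assume "linked s (insert f B) (fst (s e)) (snd (s e))"
    then show "linked s (A \<union> B) (fst (s e)) (snd (s e))"
      by (rule linked_map[where h = "\<lambda>x. x"])
        (use f linked_mono[OF L] linked_edge[of _ "A \<union> B" s] in auto)
  qed
  moreover have "nullity s (insert f (insert e B)) = nullity s (insert e (insert f B))"
    by (simp add: insert_commute)
  ultimately show ?case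
    using insert nullity_insert[of "A \<union> B" e s] nullity_insert[of "insert f B" e s] fin(1) by auto
qed

lemma linked_identify:
  assumes "s e = (u, v)" and r: "r = (\<lambda>w. if w = v then u else w)"
    and s': "\<And>e. s' e = (r (fst (s e)), r (snd (s e)))"
  shows "linked s' A (r x) (r y) \<longleftrightarrow> linked s (insert e A) x y"
proof
  assume l: "linked s' A (r x) (r y)"
  have *: "linked s (insert e A) z (r z)" for z
    using linked_edge[of e "insert e A" s] assms(1) linked_sym by (auto simp: r)
  have "linked s (insert e A) (r x) (r y)"
  proof (rule linked_map[OF l, where h = "\<lambda>x. x"])
    fix e' assume "e' \<in> A"
    then have "linked s (insert e A) (fst (s e')) (snd (s e'))" using linked_edge by blast
    then show "linked s (insert e A) (fst (s' e')) (snd (s' e'))"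
      using * s' by (metis fst_conv linked_sym linked_trans snd_conv)
  qed
  then show "linked s (insert e A) x y" using * linked_sym linked_trans by blast
next
  assume l: "linked s (insert e A) x y"
  show "linked s' A (r x) (r y)"
  proof (rule linked_map[OF l])
    fix e' assume "e' \<in> insert e A"
    then show "linked s' A (r (fst (s e'))) (r (snd (s e')))"
      using linked_edge[of e' A s'] s'[of e'] assms(1) by (cases "e' = e") (simp_all add: r)
  qed
qed

text \<open>Identifying \<open>u\<close> and \<open>v\<close> amounts to adding an edge
  \<open>e\<close> between them and contracting it, and contracting a non-loop lowers size and rank
  by one each.\<close>

lemma nullity_identify:
  assumes "finite A" "e \<notin> A" "s e = (u, v)" "u \<noteq> v" and r: "r = (\<lambda>w. if w = v then u else w)"
    and s': "\<And>e. s' e = (r (fst (s e)), r (snd (s e)))"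
  shows "nullity s' A = nullity s (insert e A)"
  using assms(1,2)
proof (induction A rule: finite_induct)
  case empty
  then show ?case using nullity_insert[of "{}" e s] assms by simp
next
  case (insert a A)
  have "nullity s (insert e (insert a A)) = nullity s (insert a (insert e A))"
    by (simp add: insert_commute)
  moreover have "linked s' A (fst (s' a)) (snd (s' a)) \<longleftrightarrow> linked s (insert e A) (fst (s a)) (snd (s a))"
    using linked_identify[of s e u v r s' A, OF assms(3) r s'] by (simp add: s')
  ultimately show ?case
    using insert nullity_insert[of A a s'] nullity_insert[of "insert e A" a s] by auto
qed

section \<open>The flow polynomial as a signed sum over edge sets\<close>

text \<open>For a positive integer \<open>x\<close>, the power of \<open>x\<close> counts the flows
  with values in an abelian group of order \<open>x\<close> that vanish outside \<open>A\<close>;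
  inclusion-exclusion extracts those that vanish nowhere on \<open>E\<close>. In this form gluing
  graphs is a matter of how nullities add.\<close>

definition flow :: "nat set \<Rightarrow> (nat \<Rightarrow> nat \<times> nat) \<Rightarrow> real \<Rightarrow> real" where
  "flow E s x = (\<Sum>A\<in>Pow E. (- 1) ^ card (E - A) * x ^ nullity s A)"

text \<open>Times \<open>x - 1\<close> this is the flow polynomial of the graph with an additional
  edge between \<open>u\<close> and \<open>v\<close>, see \<open>flow_insert\<close>.\<close>

definition conn_flow :: "nat set \<Rightarrow> (nat \<Rightarrow> nat \<times> nat) \<Rightarrow> nat \<Rightarrow> nat \<Rightarrow> real \<Rightarrow> real" where
  "conn_flow E s u v x = (\<Sum>A\<in>Pow E. if linked s A u v then (- 1) ^ card (E - A) * x ^ nullity s A else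
      0)"

lemma flow_cong:
  assumes "\<And>e. e \<in> E \<Longrightarrow> s e = s' e"
  shows "flow E s x = flow E s' x"
  unfolding flow_def using assms by (intro sum.cong) (auto intro!: arg_cong[of _ _ "(^) x"] nullity_cong)

lemma flow_empty [simp]: "flow {} s x = 1"
  by (simp add: flow_def)

lemma sum_Pow_insert:
  fixes g :: "'a set \<Rightarrow> real"
  assumes "finite E" "e \<notin> E"
  shows "(\<Sum>A\<in>Pow (insert e E). g A) = (\<Sum>A\<in>Pow E. g (insert e A) + g A)"
proof -
  have inj: "inj_on (insert e) (Pow E)" using assms(2) by (auto simp: inj_on_def)
  have "(\<Sum>A\<in>Pow (insert e E). g A) = (\<Sum>A\<in>Pow E. g A) + (\<Sum>A\<in>insert e ` Pow E. g A)"
    unfolding Pow_insert by (rule sum.union_disjoint) (use assms in auto)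
  also have "(\<Sum>A\<in>insert e ` Pow E. g A) = (\<Sum>A\<in>Pow E. g (insert e A))"
    using sum.reindex[OF inj] by simp
  finally show ?thesis by (simp add: sum.distrib)
qed

lemma flow_insert_aux:
  assumes "finite E" "e \<notin> E"
  shows "flow (insert e E) s x = (\<Sum>A\<in>Pow E. (- 1) ^ card (E - A) * x ^ nullity s (insert e A)) -
    flow E s x"
proof -
  have "flow (insert e E) s x = (\<Sum>A\<in>Pow E. (- 1) ^ card (E - A) * x ^ nullity s (insert e A) -
      (- 1) ^ card (E - A) * x ^ nullity s A)"
    unfolding flow_def sum_Pow_insert[OF assms]
  proof (rule sum.cong)
    fix A assume A: "A \<in> Pow E"
    have "insert e E - insert e A = E - A" using A assms by auto
    moreover have "insert e E - A = insert e (E - A)" using A assms by auto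
    then have "card (insert e E - A) = Suc (card (E - A))" using assms by simp
    ultimately show "(- 1) ^ card (insert e E - insert e A) * x ^ nullity s (insert e A) +
        (- 1) ^ card (insert e E - A) * x ^ nullity s A =
        (- 1) ^ card (E - A) * x ^ nullity s (insert e A) - (- 1) ^ card
            (E - A) * x ^ nullity s A" by simp
  qed simp
  then show ?thesis by (simp add: sum_subtractf flow_def)
qed

text \<open>The terms of \<open>A\<close> and \<open>insert e A\<close> cancel unless
  \<open>A\<close> already joins the ends of \<open>e\<close>; then the nullity grows by one and the
  pair contributes \<open>x - 1\<close> times the old term. Loops and bridges are the two extreme
  cases.\<close>

lemma flow_insert:
  assumes "finite E" "e \<notin> E"
  shows "flow (insert e E) s x = (x - 1) * conn_flow E s (fst (s e)) (snd (s e)) x"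
proof -
  have "(\<Sum>A\<in>Pow E. (- 1) ^ card (E - A) * x ^ nullity s (insert e A)) =
      (\<Sum>A\<in>Pow E. (- 1) ^ card (E - A) * x ^ nullity s A +
        (x - 1) * (if linked s A (fst (s e)) (snd (s e)) then (- 1) ^ card
            (E - A) * x ^ nullity s A else 0))"
  proof (rule sum.cong)
    fix A assume "A \<in> Pow E"
    then have "nullity s (insert e A) = nullity s A +
        (if linked s A (fst (s e)) (snd (s e)) then 1 else 0)"
      using nullity_insert assms by (meson PowD finite_subset subsetD)
    then show "(- 1) ^ card (E - A) * x ^ nullity s (insert e A) =
        (- 1) ^ card (E - A) * x ^ nullity s A +
        (x - 1) * (if linked s A (fst (s e)) (snd (s e)) then (- 1) ^ card
            (E - A) * x ^ nullity s A else 0)"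
      by (simp add: algebra_simps)
  qed simp
  also have "\<dots> = flow E s x + (x - 1) * conn_flow E s (fst (s e)) (snd (s e)) x"
    by (simp add: sum.distrib flow_def conn_flow_def sum_distrib_left)
  finally show ?thesis using flow_insert_aux[OF assms] by simp
qed

lemma flow_loop:
  assumes "finite E" "e \<notin> E" "fst (s e) = snd (s e)"
  shows "flow (insert e E) s x = (x - 1) * flow E s x"
  using flow_insert[OF assms(1,2)] assms(3) by (simp add: conn_flow_def flow_def)

lemma flow_bridge:
  assumes "finite E" "e \<notin> E" "\<not> linked s E (fst (s e)) (snd (s e))"
  shows "flow (insert e E) s x = 0"
proof -
  have "\<not> linked s A (fst (s e)) (snd (s e))" if "A \<in> Pow E" for A
    using that assms(3) linked_mono by blast
  then have "conn_flow E s (fst (s e)) (snd (s e)) x = 0" by (simp add: conn_flow_def)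
  then show ?thesis using flow_insert[OF assms(1,2)] by simp
qed

lemma flow_identify:
  assumes "finite E" "e \<notin> E" "s e = (u, v)" "u \<noteq> v"
    and "\<And>e. s' e = (if fst (s e) = v then u else fst (s e), if snd (s e) = v then u else snd (s e))"
  shows "flow E s' x = flow (insert e E) s x + flow E s x"
proof -
  have "nullity s' A = nullity s (insert e A)" if "A \<in> Pow E" for A
    by (rule nullity_identify[of A e s u v "\<lambda>w. if w = v then u else w" s'])
      (use that assms finite_subset in auto)
  then have "flow E s' x = (\<Sum>A\<in>Pow E. (- 1) ^ card (E - A) * x ^ nullity s (insert e A))"
    by (simp add: flow_def)
  then show ?thesis using flow_insert_aux[OF assms(1,2)] by simp
qed

lemma sum_Pow_Un:
  fixes g :: "'a set \<Rightarrow> real"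
  assumes "E1 \<inter> E2 = {}"
  shows "(\<Sum>A\<in>Pow (E1 \<union> E2). g A) = (\<Sum>A\<in>Pow E1. \<Sum>B\<in>Pow E2. g (A \<union> B))"
proof -
  have "(\<Sum>A\<in>Pow (E1 \<union> E2). g A) = (\<Sum>(A, B)\<in>Pow E1 \<times> Pow E2. g (A \<union> B))"
    by (rule sum.reindex_bij_witness[of _ "\<lambda>(A, B). A \<union> B" "\<lambda>A. (A \<inter> E1, A \<inter> E2)"])
      (use assms in \<open>auto simp: Int_Un_distrib intro!: arg_cong[of _ _ g]\<close>)
  then show ?thesis by (simp add: sum.cartesian_product)
qed

lemma sign_Un:
  assumes "finite E1" "finite E2" "E1 \<inter> E2 = {}" "A \<in> Pow E1" "B \<in> Pow E2"
  shows "(- 1 :: real) ^ card (E1 \<union> E2 - (A \<union> B)) = (- 1) ^ card (E1 - A) * (- 1) ^ card (E2 - B)"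
proof -
  have "E1 \<union> E2 - (A \<union> B) = (E1 - A) \<union> (E2 - B)" using assms by auto
  moreover have "(E1 - A) \<inter> (E2 - B) = {}" using assms by auto
  ultimately have "card (E1 \<union> E2 - (A \<union> B)) = card (E1 - A) + card (E2 - B)"
    using assms card_Un_disjoint[of "E1 - A" "E2 - B"] by simp
  then show ?thesis by (simp add: power_add)
qed

lemma flow_one_sum:
  assumes fin: "finite E1" "finite E2" and disj: "E1 \<inter> E2 = {}"
    and E1: "\<And>e. e \<in> E1 \<Longrightarrow> fst (s e) \<in> V1 \<and> snd (s e) \<in> V1"
    and E2: "\<And>e. e \<in> E2 \<Longrightarrow> fst (s e) \<in> V2 \<and> snd (s e) \<in> V2"
    and S: "V1 \<inter> V2 \<subseteq> {w}"
  shows "flow (E1 \<union> E2) s x = flow E1 s x * flow E2 s x"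
proof -
  have "flow (E1 \<union> E2) s x = (\<Sum>A\<in>Pow E1. \<Sum>B\<in>Pow E2.
      ((- 1) ^ card (E1 - A) * x ^ nullity s A) * ((- 1) ^ card (E2 - B) * x ^ nullity s B))"
    unfolding flow_def sum_Pow_Un[OF disj]
  proof (intro sum.cong refl)
    fix A B assume AB: "A \<in> Pow E1" "B \<in> Pow E2"
    have "nullity s (A \<union> B) = nullity s A + nullity s B"
    proof (rule nullity_glue_disconnected[of A B s V1 V2])
      show "finite A" "finite B" using AB fin finite_subset by auto
      show "A \<inter> B = {}" using AB disj by auto
      show "x = y" if "x \<in> V1 \<inter> V2" "y \<in> V1 \<inter> V2" for x y using S that by blast
    qed (use AB E1 E2 in auto)
    then show "(- 1) ^ card (E1 \<union> E2 - (A \<union> B)) * x ^ nullity s (A \<union> B) =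
      ((- 1) ^ card (E1 - A) * x ^ nullity s A) * ((- 1) ^ card (E2 - B) * x ^ nullity s B)"
      by (simp add: sign_Un[OF fin disj AB] power_add)
  qed
  then show ?thesis by (simp add: flow_def sum_product)
qed

text \<open>The nullities of the two halves of an edge set add, with one extra unit exactly when
  both halves join \<open>u\<close> and \<open>v\<close>. The extra terms form \<open>x - 1\<close>
  times a product of two values of \<open>conn_flow\<close>, which \<open>flow_insert\<close>
  translates into the graphs with \<open>f\<close> added. The factor \<open>x - 1\<close> avoids a
  division.\<close>

lemma flow_two_sum:
  assumes fin: "finite E1" "finite E2" and disj: "E1 \<inter> E2 = {}"
    and E1: "\<And>e. e \<in> E1 \<Longrightarrow> fst (s e) \<in> V1 \<and> snd (s e) \<in> V1"
    and E2: "\<And>e. e \<in> E2 \<Longrightarrow> fst (s e) \<in> V2 \<and> snd (s e) \<in> V2"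
    and S: "V1 \<inter> V2 = {u, v}" "u \<noteq> v" and f: "f \<notin> E1" "f \<notin> E2" "s f = (u, v)"
  shows "(x - 1) * flow (E1 \<union> E2) s x = (x - 1) * flow E1 s x * flow E2 s x +
    flow (insert f E1) s x * flow (insert f E2) s x"
proof -
  have "flow (E1 \<union> E2) s x = (\<Sum>A\<in>Pow E1. \<Sum>B\<in>Pow E2.
      ((- 1) ^ card (E1 - A) * x ^ nullity s A) * ((- 1) ^ card (E2 - B) * x ^ nullity s B) + (x - 1) *
      ((if linked s A u v then (- 1) ^ card (E1 - A) * x ^ nullity s A else 0) *
       (if linked s B u v then (- 1) ^ card (E2 - B) * x ^ nullity s B else 0)))"
    unfolding flow_def sum_Pow_Un[OF disj]
  proof (intro sum.cong refl)
    fix A B assume AB: "A \<in> Pow E1" "B \<in> Pow E2"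
    have fAB: "finite A" "finite B" using AB fin finite_subset by auto
    have "nullity s (A \<union> B) = nullity s A + nullity s B + (if linked s A u v \<and>
        linked s B u v then 1 else 0)"
    proof (cases "linked s A u v")
      case True
      have "nullity s (A \<union> B) = nullity s A + nullity s (insert f B)"
        by (rule nullity_glue_connected[where ?V1.0 = V1 and ?V2.0 = V2 and u = u and v = v])
          (use fAB AB disj E1 E2 S f True in auto)
      moreover have "f \<notin> B" using AB f by auto
      ultimately show ?thesis using nullity_insert[of B f s] fAB f True by auto
    next
      case False
      have "nullity s (A \<union> B) = nullity s A + nullity s B"
        by (rule nullity_glue_disconnected[of A B s V1 V2])
          (use fAB AB disj E1 E2 S False linked_sym in auto)
      then show ?thesis using False by simp
    qed
    then show "(- 1) ^ card (E1 \<union> E2 - (A \<union> B)) * x ^ nullity s (A \<union> B) =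
      ((- 1) ^ card (E1 - A) * x ^ nullity s A) * ((- 1) ^ card (E2 - B) * x ^ nullity s B) + (x - 1) *
      ((if linked s A u v then (- 1) ^ card (E1 - A) * x ^ nullity s A else 0) *
       (if linked s B u v then (- 1) ^ card (E2 - B) * x ^ nullity s B else 0))"
      by (simp add: sign_Un[OF fin disj AB] power_add algebra_simps)
  qed
  also have "\<dots> = flow E1 s x * flow E2 s x + (x - 1) * (conn_flow E1 s u v x * conn_flow E2 s u v x)"
    unfolding flow_def conn_flow_def sum_product by (simp only: sum.distrib sum_distrib_left)
  finally have 1: "flow (E1 \<union> E2) s x = flow E1 s x * flow E2 s x +
      (x - 1) * (conn_flow E1 s u v x * conn_flow E2 s u v x)" .
  have 2: "flow (insert f E1) s x = (x - 1) * conn_flow E1 s u v x"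
    "flow (insert f E2) s x = (x - 1) * conn_flow E2 s u v x"
    using flow_insert fin f by simp_all
  show ?thesis unfolding 1 2 by (simp add: algebra_simps)
qed

section \<open>Blocks\<close>

abbreviation gr :: "nat set \<Rightarrow> nat set \<Rightarrow> (nat \<Rightarrow> nat \<times> nat) \<Rightarrow> graph" where
  "gr V E s \<equiv> \<lparr>verts = V, edges = E, ends = s\<rparr>"

definition graph_on :: "nat set \<Rightarrow> nat set \<Rightarrow> (nat \<Rightarrow> nat \<times> nat) \<Rightarrow> bool" where
  "graph_on V E s \<longleftrightarrow> finite V \<and> finite E \<and> (\<forall>e\<in>E. fst (s e) \<in> V \<and> snd (s e) \<in> V)"

definition loopless :: "nat set \<Rightarrow> (nat \<Rightarrow> nat \<times> nat) \<Rightarrow> bool" where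
  "loopless E s \<longleftrightarrow> (\<forall>e\<in>E. fst (s e) \<noteq> snd (s e))"

definition conn_on :: "nat set \<Rightarrow> nat set \<Rightarrow> (nat \<Rightarrow> nat \<times> nat) \<Rightarrow> bool" where
  "conn_on V E s \<longleftrightarrow> V \<noteq> {} \<and> (\<forall>x\<in>V. \<forall>y\<in>V. linked s E x y)"

definition bridgeless_on :: "nat set \<Rightarrow> (nat \<Rightarrow> nat \<times> nat) \<Rightarrow> bool" where
  "bridgeless_on E s \<longleftrightarrow> (\<forall>e\<in>E. linked s (E - {e}) (fst (s e)) (snd (s e)))"

definition avoid :: "nat set \<Rightarrow> (nat \<Rightarrow> nat \<times> nat) \<Rightarrow> nat \<Rightarrow> nat set" where
  "avoid E s v = {e\<in>E. fst (s e) \<noteq> v \<and> snd (s e) \<noteq> v}"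

definition nonsep_on :: "nat set \<Rightarrow> nat set \<Rightarrow> (nat \<Rightarrow> nat \<times> nat) \<Rightarrow> bool" where
  "nonsep_on V E s \<longleftrightarrow> conn_on V E s \<and>
    (\<forall>v\<in>V. \<forall>x\<in>V - {v}. \<forall>y\<in>V - {v}. linked s (avoid E s v) x y) \<and>
    (loopless E s \<or> card V = 1 \<and> card E = 1)"

definition ident_ends :: "(nat \<Rightarrow> nat \<times> nat) \<Rightarrow> nat \<Rightarrow> nat \<Rightarrow> nat \<Rightarrow> nat \<times> nat" where
  "ident_ends s u v = (\<lambda>e. (if fst (s e) = v then u else fst (s e), if snd (s e) =
      v then u else snd (s e)))"

definition subgraph_on :: "nat set \<Rightarrow> nat set \<Rightarrow> nat set \<Rightarrow> nat set \<Rightarrow> (nat \<Rightarrow> nat \<times> nat) \<Rightarrow> bool" where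
  "subgraph_on V' E' V E s \<longleftrightarrow> V' \<subseteq> V \<and> E' \<subseteq> E \<and> (\<forall>e\<in>E'. fst (s e) \<in> V' \<and> snd (s e) \<in> V')"

abbreviation nblocks_on :: "nat set \<Rightarrow> nat set \<Rightarrow> (nat \<Rightarrow> nat \<times> nat) \<Rightarrow> nat" where
  "nblocks_on V E s \<equiv> nblocks (gr V E s)"

lemma wf_graph_iff: "wf_graph (gr V E s) \<longleftrightarrow> graph_on V E s"
  by (simp add: wf_graph_def graph_on_def)

lemma connected_iff: "connected (gr V E s) \<longleftrightarrow> conn_on V E s"
  by (simp add: connected_def conn_on_def reachable_def adj_rel_eq linked_def)

lemma bridgeless_iff: "graph_on V E s \<Longrightarrow> bridgeless (gr V E s) \<longleftrightarrow> bridgeless_on E s"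
  by (auto simp: bridgeless_def bridgeless_on_def is_bridge_def reachable_def adj_rel_eq linked_def
      del_edge_def graph_on_def)

lemma del_edge_gr: "del_edge (gr V E s) e = gr V (E - {e}) s"
  by (simp add: del_edge_def)

lemma identify_gr: "identify (gr V E s) u v = gr (if u = v then V else V - {v}) E (ident_ends s u v)"
  by (simp add: identify_def Let_def ident_ends_def)

lemma contract_gr: "s e = (u, v) \<Longrightarrow>
  contract (gr V E s) e = gr (if u = v then V else V - {v}) (E - {e}) (ident_ends s u v)"
  by (simp add: contract_def del_edge_gr identify_gr)

lemma sub_gr: "sub (gr V E s) V' E' = gr V' E' s"
  by (simp add: sub_def)

lemma is_sub_gr: "is_sub V' E' (gr V E s) \<longleftrightarrow> subgraph_on V' E' V E s"
  by (simp add: is_sub_def subgraph_on_def)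

text \<open>In a connected graph, a cut-vertex is one whose deletion leaves two vertices that are no
  longer linked. This replaces the counting of components from here on.\<close>

lemma nonsep_iff:
  assumes "finite V"
  shows "nonsep (gr V E s) \<longleftrightarrow> nonsep_on V E s"
proof (cases "conn_on V E s")
  case True
  have 1: "ncomp (gr V E s) = 1"
  proof -
    have "{y. reachable (gr V E s) x y} = V" if "x \<in> V" for x
      using that True by (auto simp: reachable_def conn_on_def adj_rel_eq linked_def)
    then have "(\<lambda>x. {y. reachable (gr V E s) x y}) ` V = {V}" using True by (auto simp: conn_on_def)
    then show ?thesis by (simp add: ncomp_def)
  qed
  have "cut_vertex (gr V E s) v \<longleftrightarrow> \<not> (\<forall>x\<in>V - {v}. \<forall>y\<in>V - {v}. linked s (avoid E s v) x y)"
    if v: "v \<in> V" for v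
  proof -
    let ?G = "del_vertex (gr V E s) v"
    have G: "?G = gr (V - {v}) (avoid E s v) s" by (simp add: del_vertex_def avoid_def)
    have r: "reachable ?G x y \<longleftrightarrow> x \<in> V - {v} \<and> y \<in> V - {v} \<and> linked s (avoid E s v) x y" for x y
      by (simp add: G reachable_def adj_rel_eq linked_def)
    let ?C = "(\<lambda>x. {y. reachable ?G x y}) ` (V - {v})"
    have nc: "ncomp ?G = card ?C" by (simp add: ncomp_def G)
    \<comment> \<open>Only an inequality: if \<open>v\<close> is the sole vertex, no component
      remains.\<close>
    have "card ?C \<le> 1" if a: "\<forall>x\<in>V - {v}. \<forall>y\<in>V - {v}. linked s (avoid E s v) x y"
    proof -
      have "?C \<subseteq> {V - {v}}" using a r by auto
      then show ?thesis using card_mono[of "{V - {v}}" ?C] by simp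
    qed
    moreover have "card ?C > 1" if a: "\<not> (\<forall>x\<in>V - {v}. \<forall>y\<in>V - {v}. linked s (avoid E s v) x y)"
    proof -
      obtain x y where xy: "x \<in> V - {v}" "y \<in> V - {v}" "\<not> linked s (avoid E s v) x y" using a by blast
      let ?c = "\<lambda>x. {y. reachable ?G x y}"
      have "?c x \<noteq> ?c y" using xy r by (metis linked_refl mem_Collect_eq)
      moreover have "{?c x, ?c y} \<subseteq> ?C" using xy by blast
      then have "card {?c x, ?c y} \<le> card ?C" using assms by (intro card_mono) auto
      ultimately show ?thesis by simp
    qed
    ultimately have "card ?C > 1 \<longleftrightarrow> \<not> (\<forall>x\<in>V - {v}. \<forall>y\<in>V - {v}. linked s (avoid E s v) x y)"
      by (metis not_less)
    then show ?thesis unfolding cut_vertex_def 1 nc using v by simp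
  qed
  then show ?thesis using True
    by (auto simp: nonsep_def nonsep_on_def connected_iff loopless_def is_loop_def)
qed (simp add: nonsep_def nonsep_on_def connected_iff)

lemma subgraph_graph: "graph_on V E s \<Longrightarrow> subgraph_on V' E' V E s \<Longrightarrow> graph_on V' E' s"
  by (auto simp: graph_on_def subgraph_on_def intro: finite_subset)

lemma graph_subgraph_refl: "graph_on V E s \<Longrightarrow> subgraph_on V E V E s"
  by (auto simp: graph_on_def subgraph_on_def)

definition blocks :: "nat set \<Rightarrow> nat set \<Rightarrow> (nat \<Rightarrow> nat \<times> nat) \<Rightarrow> (nat set \<times> nat set) set" where
  "blocks V E s = {(V', E'). E' \<noteq> {} \<and> subgraph_on V' E' V E s \<and> nonsep_on V' E' s \<and>
    (\<forall>V'' E''. subgraph_on V'' E'' V E s \<and> nonsep_on V'' E'' s \<and> V' \<subseteq> V'' \<and> E' \<subseteq> E'' \<longrightarrow> V'' = V' \<and>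
        E'' = E')}"

lemma nblocks_gr:
  assumes "graph_on V E s"
  shows "nblocks_on V E s = card (blocks V E s)"
proof -
  have "subgraph_on V' E' V E s \<Longrightarrow> nonsep (gr V' E' s) \<longleftrightarrow> nonsep_on V' E' s" for V' E'
    using subgraph_graph[OF assms] nonsep_iff by (auto simp: graph_on_def)
  then have "{(V', E'). is_block (gr V E s) V' E' \<and> E' \<noteq> {}} = blocks V E s"
    unfolding is_block_def blocks_def is_sub_gr sub_gr by (intro Collect_cong) (auto; blast)
  then show ?thesis by (simp add: nblocks_def)
qed

lemma finite_blocks:
  assumes "graph_on V E s"
  shows "finite (blocks V E s)"
proof (rule finite_subset)
  show "blocks V E s \<subseteq> Pow V \<times> Pow E" by (auto simp: blocks_def subgraph_on_def)
qed (use assms in \<open>simp add: graph_on_def\<close>)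

lemma nblocks_nonsep:
  assumes "graph_on V E s" "nonsep_on V E s" "E \<noteq> {}"
  shows "nblocks_on V E s = 1"
proof -
  have "blocks V E s = {(V, E)}"
    using assms graph_subgraph_refl[OF assms(1)] by (auto simp: blocks_def subgraph_on_def) 
  then show ?thesis by (simp add: nblocks_gr assms)
qed

lemma nblocks_empty: "finite V \<Longrightarrow> nblocks_on V {} s = 0"
proof -
  assume "finite V"
  moreover have "blocks V {} s = {}" by (auto simp: blocks_def subgraph_on_def)
  ultimately show ?thesis by (simp add: nblocks_gr graph_on_def)
qed

text \<open>Edges on both sides would have ends on both sides other than \<open>w\<close>, and a
  path between these ends that avoids \<open>w\<close> cannot cross from \<open>V1\<close> to
  \<open>V2\<close>.\<close>

lemma nonsep_subgraph_part:
  assumes 1: "graph_on V1 E1 s" and 2: "graph_on V2 E2 s" and S: "V1 \<inter> V2 \<subseteq> {w}"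
    and sub: "E' \<subseteq> E1 \<union> E2" "\<forall>e\<in>E'. fst (s e) \<in> V' \<and> snd (s e) \<in> V'"
    and nonsep_on: "nonsep_on V' E' s" and ne: "E' \<noteq> {}"
  shows "subgraph_on V' E' V1 E1 s \<or> subgraph_on V' E' V2 E2 s"
proof -
  have part: "subgraph_on V' E' V E s" if "E' \<subseteq> E" "graph_on V E s" for V E
  proof -
    obtain e where e: "e \<in> E'" using ne by blast
    have "z \<in> V" if "z \<in> V'" for z
    proof (rule linked_closed)
      show "linked s E' (fst (s e)) z" using nonsep_on e that sub
          by (auto simp: nonsep_on_def conn_on_def)
    qed (use e \<open>E' \<subseteq> E\<close> \<open>graph_on V E s\<close> in \<open>auto simp: graph_on_def\<close>)
    then show ?thesis using that sub by (auto simp: subgraph_on_def)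
  qed
  have "E' \<subseteq> E1 \<or> E' \<subseteq> E2"
  proof (rule ccontr)
    assume "\<not> (E' \<subseteq> E1 \<or> E' \<subseteq> E2)"
    then obtain e1 e2 where e: "e1 \<in> E'" "e1 \<in> E1" "e1 \<notin> E2" "e2 \<in> E'" "e2 \<in> E2" "e2 \<notin> E1"
      using sub by blast
    then have "card E' \<noteq> 1" by (auto simp: card_1_singleton_iff)
    then have loopless: "loopless E' s" using nonsep_on by (auto simp: nonsep_on_def)
    \<comment> \<open>Each of the two edges has an end other than \<open>w\<close> because it is no
      loop; the exceptional single loop is excluded by the count of edges.\<close>
    have "\<exists>a. a \<noteq> w \<and> a \<in> V1 \<and> a \<in> V'" "\<exists>b. b \<noteq> w \<and> b \<in> V2 \<and> b \<in> V'"
      using loopless e 1 2 sub unfolding loopless_def graph_on_def by metis+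
    then obtain a b where ab: "a \<noteq> w" "a \<in> V1" "a \<in> V'" "b \<noteq> w" "b \<in> V2" "b \<in> V'" by blast
    have "linked s (avoid E' s w) a b"
    proof (cases "w \<in> V'")
      case True
      then show ?thesis using nonsep_on ab by (auto simp: nonsep_on_def)
    next
      case False
      then have "avoid E' s w = E'" using sub by (auto simp: avoid_def)
      then show ?thesis using nonsep_on ab by (auto simp: nonsep_on_def conn_on_def)
    qed
    then have "b \<in> V1 - {w}"
    proof (rule linked_closed)
      fix e assume "e \<in> avoid E' s w"
      then have "fst (s e) \<noteq> w" "snd (s e) \<noteq> w" "e \<in> E1 \<or> e \<in> E2" using sub by (auto simp: avoid_def)
      then show "fst (s e) \<in> V1 - {w} \<longleftrightarrow> snd (s e) \<in> V1 - {w}"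
        using 1 2 S by (auto simp: graph_on_def)
    qed (use ab in auto)
    then show False using ab S by auto
  qed
  then show ?thesis using part 1 2 by blast
qed

text \<open>A non-separable subgraph with an edge lies on one side, and every non-separable subgraph
  containing it lies on the same side. So maximality in the union and in the part agree.\<close>

lemma nblocks_union:
  assumes 1: "graph_on V1 E1 s" and 2: "graph_on V2 E2 s" and S: "V1 \<inter> V2 \<subseteq> {w}" and disj: "E1 \<inter> E2 = {}"
  shows "nblocks_on (V1 \<union> V2) (E1 \<union> E2) s = nblocks_on V1 E1 s + nblocks_on V2 E2 s"
proof -
  have wf: "graph_on (V1 \<union> V2) (E1 \<union> E2) s" using 1 2 by (auto simp: graph_on_def)
  have part: "subgraph_on V' E' V1 E1 s \<or> subgraph_on V' E' V2 E2 s"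
    if "subgraph_on V' E' (V1 \<union> V2) (E1 \<union> E2) s" "nonsep_on V' E' s" "E' \<noteq> {}" for V' E'
    using nonsep_subgraph_part[OF 1 2 S] that by (auto simp: subgraph_on_def)
  have up: "subgraph_on V' E' (V1 \<union> V2) (E1 \<union> E2) s"
      if "subgraph_on V' E' V1 E1 s \<or> subgraph_on V' E' V2 E2 s" for V' E'
    using that by (auto simp: subgraph_on_def)
  have no: False if "subgraph_on V' E' V1 E1 s" "subgraph_on V'' E'' V2 E2 s" "E' \<noteq> {}" "E' \<subseteq> E''"
      for V' E' V'' E''
    using that disj unfolding subgraph_on_def by blast
  have no': False if "subgraph_on V' E' V2 E2 s" "subgraph_on V'' E'' V1 E1 s" "E' \<noteq> {}" "E' \<subseteq> E''"
      for V' E' V'' E''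
    using that disj unfolding subgraph_on_def by blast
  have "blocks (V1 \<union> V2) (E1 \<union> E2) s = blocks V1 E1 s \<union> blocks V2 E2 s"
  proof (intro equalityI subsetI)
    fix p assume p: "p \<in> blocks (V1 \<union> V2) (E1 \<union> E2) s"
    obtain V' E' where [simp]: "p = (V', E')" by fastforce
    have b: "E' \<noteq> {}" "subgraph_on V' E' (V1 \<union> V2) (E1 \<union> E2) s" "nonsep_on V' E' s"
      "\<And>V'' E''. subgraph_on V'' E'' (V1 \<union> V2) (E1 \<union> E2) s \<Longrightarrow> nonsep_on V'' E'' s \<Longrightarrow> V' \<subseteq> V'' \<Longrightarrow>
          E' \<subseteq> E'' \<Longrightarrow> V'' = V' \<and> E'' = E'"
      using p by (simp_all add: blocks_def)
    from part[OF b(2,3,1)] show "p \<in> blocks V1 E1 s \<union> blocks V2 E2 s"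
      using b up by (auto simp: blocks_def)
  next
    fix p assume p: "p \<in> blocks V1 E1 s \<union> blocks V2 E2 s"
    obtain V' E' where [simp]: "p = (V', E')" by fastforce
    show "p \<in> blocks (V1 \<union> V2) (E1 \<union> E2) s"
      using p
    proof
      assume "p \<in> blocks V1 E1 s"
      then have b: "E' \<noteq> {}" "subgraph_on V' E' V1 E1 s" "nonsep_on V' E' s"
        "\<And>V'' E''. subgraph_on V'' E'' V1 E1 s \<Longrightarrow> nonsep_on V'' E'' s \<Longrightarrow> V' \<subseteq> V'' \<Longrightarrow> E' \<subseteq> E'' \<Longrightarrow>
            V'' = V' \<and> E'' = E'"
        by (simp_all add: blocks_def)
      have "V'' = V' \<and> E'' = E'" if "subgraph_on V'' E'' (V1 \<union> V2) (E1 \<union> E2) s" "nonsep_on V'' E'' s"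
          "V' \<subseteq> V''" "E' \<subseteq> E''" for V'' E''
        using part[OF that(1,2)] b(1) b(4)[OF _ that(2-4)] no[OF b(2) _ b(1) that(4)] that(4) by blast
      then have "\<forall>V'' E''. subgraph_on V'' E'' (V1 \<union> V2) (E1 \<union> E2) s \<and> nonsep_on V'' E'' s \<and>
          V' \<subseteq> V'' \<and> E' \<subseteq> E'' \<longrightarrow> V'' = V' \<and> E'' = E'"
        by blast
      then show ?thesis using b(1-3) up by (simp add: blocks_def)
    next
      assume "p \<in> blocks V2 E2 s"
      then have b: "E' \<noteq> {}" "subgraph_on V' E' V2 E2 s" "nonsep_on V' E' s"
        "\<And>V'' E''. subgraph_on V'' E'' V2 E2 s \<Longrightarrow> nonsep_on V'' E'' s \<Longrightarrow> V' \<subseteq> V'' \<Longrightarrow> E' \<subseteq> E'' \<Longrightarrow>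
            V'' = V' \<and> E'' = E'"
        by (simp_all add: blocks_def)
      have "V'' = V' \<and> E'' = E'" if "subgraph_on V'' E'' (V1 \<union> V2) (E1 \<union> E2) s" "nonsep_on V'' E'' s"
          "V' \<subseteq> V''" "E' \<subseteq> E''" for V'' E''
        using part[OF that(1,2)] b(1) b(4)[OF _ that(2-4)] no'[OF b(2) _ b(1) that(4)] that(4) by blast
      then have "\<forall>V'' E''. subgraph_on V'' E'' (V1 \<union> V2) (E1 \<union> E2) s \<and> nonsep_on V'' E'' s \<and>
          V' \<subseteq> V'' \<and> E' \<subseteq> E'' \<longrightarrow> V'' = V' \<and> E'' = E'"
        by blast
      then show ?thesis using b(1-3) up by (simp add: blocks_def)
    qed
  qed
  moreover have "blocks V1 E1 s \<inter> blocks V2 E2 s = {}"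
    using disj by (auto simp: blocks_def subgraph_on_def)
  ultimately show ?thesis
    using finite_blocks[OF 1] finite_blocks[OF 2] nblocks_gr[OF wf] nblocks_gr[OF 1] nblocks_gr[OF 2]
    by (simp add: card_Un_disjoint)
qed

lemma nonsep_single: "card V = 1 \<Longrightarrow> card E = 1 \<Longrightarrow> nonsep_on V E s"
  by (auto simp: card_1_singleton_iff nonsep_on_def conn_on_def)

lemma nblocks_loops:
  assumes "finite E" "\<And>e. e \<in> E \<Longrightarrow> s e = (v, v)"
  shows "nblocks_on {v} E s = card E"
  using assms
proof (induction E rule: finite_induct)
  case (insert e E)
  have "nblocks_on ({v} \<union> {v}) ({e} \<union> E) s = nblocks_on {v} {e} s + nblocks_on {v} E s"
    by (rule nblocks_union[where w = v]) (use insert in \<open>auto simp: graph_on_def\<close>)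
  moreover have "nblocks_on {v} {e} s = 1"
    by (rule nblocks_nonsep) (use insert in \<open>auto simp: graph_on_def intro!: nonsep_single\<close>)
  ultimately show ?case using insert by simp
qed (simp add: nblocks_empty)

text \<open>An excursion into the other side starts and ends at \<open>w\<close>, so it can be cut
  out of any path.\<close>

lemma conn_part:
  assumes c: "conn_on V E s" and E: "E = E1 \<union> E2" and V: "V2 \<subseteq> V" "V2 \<noteq> {}"
    and E1: "\<And>e. e \<in> E1 \<Longrightarrow> fst (s e) \<in> V1 \<and> snd (s e) \<in> V1"
    and E2: "\<And>e. e \<in> E2 \<Longrightarrow> fst (s e) \<in> V2 \<and> snd (s e) \<in> V2"
    and S: "V1 \<inter> V2 \<subseteq> {w}"
  shows "conn_on V2 E2 s"
proof -
  have "linked s E2 x y" if "x \<in> V2" "y \<in> V2" for x y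
  proof (rule linked_glue[of E1 s V1 E2 V2 s E2])
    show "linked s (E1 \<union> E2) x y" using c that V E by (auto simp: conn_on_def)
    show "linked s E2 a b" if "a \<in> V1 \<inter> V2" "b \<in> V1 \<inter> V2" for a b
      using that S by (metis linked_refl singletonD subsetD)
  qed (use E1 E2 that linked_edge in auto)
  then show ?thesis using V by (simp add: conn_on_def)
qed

lemma bridgeless_part:
  assumes b: "bridgeless_on E s" and E: "E = E1 \<union> E2" "E1 \<inter> E2 = {}"
    and E1: "\<And>e. e \<in> E1 \<Longrightarrow> fst (s e) \<in> V1 \<and> snd (s e) \<in> V1"
    and E2: "\<And>e. e \<in> E2 \<Longrightarrow> fst (s e) \<in> V2 \<and> snd (s e) \<in> V2"
    and S: "V1 \<inter> V2 \<subseteq> {w}"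
  shows "bridgeless_on E2 s"
  unfolding bridgeless_on_def
proof
  fix e assume e: "e \<in> E2"
  show "linked s (E2 - {e}) (fst (s e)) (snd (s e))"
  proof (rule linked_glue[of E1 s V1 "E2 - {e}" V2 s "E2 - {e}"])
    have "E1 \<union> (E2 - {e}) = E - {e}" using E e by auto
    then show "linked s (E1 \<union> (E2 - {e})) (fst (s e)) (snd (s e))" using b e E
        by (auto simp: bridgeless_on_def)
    show "linked s (E2 - {e}) a b" if "a \<in> V1 \<inter> V2" "b \<in> V1 \<inter> V2" for a b
      using that S by (metis linked_refl singletonD subsetD)
  qed (use E1 E2 e linked_edge[of _ "E2 - {e}" s] in auto)
qed

lemma conn_edge_at:
  assumes "conn_on V E s" "x \<in> V" "y \<in> V" "x \<noteq> y"
  shows "\<exists>e\<in>E. fst (s e) = x \<or> snd (s e) = x"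
  using assms linked_ends[of s E x y] by (auto simp: conn_on_def)

text \<open>There are two ways to be separable: a loop in a graph with a further edge, split off
  with its vertex, or a cut-vertex \<open>w\<close>, where one component \<open>D\<close> of the
  rest is split off. Both parts carry an edge, so both have fewer edges than the whole.\<close>

lemma not_nonsep_one_sum:
  assumes wf: "graph_on V E s" and c: "conn_on V E s" and n: "\<not> nonsep_on V E s"
  obtains V1 E1 V2 E2 w where "V1 \<union> V2 = V" "V1 \<inter> V2 = {w}" "E1 \<union> E2 = E" "E1 \<inter> E2 = {}"
    "E1 \<noteq> {}" "E2 \<noteq> {}" "graph_on V1 E1 s" "graph_on V2 E2 s"
proof (cases "loopless E s")
  case False
  then obtain e where e: "e \<in> E" "fst (s e) = snd (s e)" by (auto simp: loopless_def)
  let ?v = "fst (s e)"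
  have v: "?v \<in> V" using wf e by (simp add: graph_on_def)
  have "E - {e} \<noteq> {}"
  proof
    assume "E - {e} = {}"
    then have E: "E = {e}" using e by auto
    have "x = ?v" if "x \<in> V" for x
    proof (rule ccontr)
      assume "x \<noteq> ?v"
      then have "\<exists>e'\<in>E. fst (s e') = x \<or> snd (s e') = x"
        using conn_edge_at[OF c that v] by blast
      then obtain e' where "e' \<in> E" "fst (s e') = x \<or> snd (s e') = x" by blast
      moreover have "e' = e" using \<open>e' \<in> E\<close> \<open>E - {e} = {}\<close> by blast
      ultimately show False using e \<open>x \<noteq> ?v\<close> by metis
    qed
    then have "V = {?v}" using v by blast
    then have "card V = 1" by (metis card_1_singleton_iff One_nat_def)
    moreover have "card E = 1" by (simp add: E)
    ultimately show False using n nonsep_single by blast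
  qed
  moreover have "graph_on {?v} {e} s" using e by (simp add: graph_on_def)
  moreover have "graph_on V (E - {e}) s" using wf by (simp add: graph_on_def)
  ultimately show ?thesis
    using v e(1) by (intro that[of "{?v}" V ?v "{e}" "E - {e}"]) blast+
next
  case True
  then obtain w z y where w: "w \<in> V" "z \<in> V - {w}" "y \<in> V - {w}" "\<not> linked s (avoid E s w) z y"
    using n c by (auto simp: nonsep_on_def)
  define D where "D = {x. linked s (avoid E s w) z x}"
  have wD: "w \<notin> D"
  proof
    assume "w \<in> D"
    then have "linked s (avoid E s w) w z" using linked_sym by (simp add: D_def)
    then have "z = w" by (rule linked_isolated) (simp add: avoid_def)
    then show False using w by simp
  qed
  have zD: "z \<in> D" "y \<notin> D" using w by (auto simp: D_def)
  have cl: "fst (s e) \<in> D \<longleftrightarrow> snd (s e) \<in> D" if "e \<in> E" "fst (s e) \<noteq> w" "snd (s e) \<noteq> w" for e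
  proof -
    have "linked s (avoid E s w) (fst (s e)) (snd (s e))"
      using that by (intro linked_edge) (simp add: avoid_def)
    then show ?thesis unfolding D_def mem_Collect_eq using linked_trans linked_sym by blast
  qed
  have DV: "D \<subseteq> V"
  proof
    fix x assume "x \<in> D"
    then show "x \<in> V" unfolding D_def mem_Collect_eq
      by (rule linked_closed) (use w wf in \<open>auto simp: avoid_def graph_on_def\<close>)
  qed
  define E1 where "E1 = {e\<in>E. fst (s e) \<in> D \<or> snd (s e) \<in> D}"
  have "\<exists>e\<in>E. fst (s e) = z \<or> snd (s e) = z" using conn_edge_at[OF c, of z w] w by auto
  then have "E1 \<noteq> {}" using zD by (auto simp: E1_def)
  moreover have "\<exists>e\<in>E. fst (s e) = y \<or> snd (s e) = y" using conn_edge_at[OF c, of y w] w by auto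
  then obtain e where e: "e \<in> E" "fst (s e) = y \<or> snd (s e) = y" by blast
  have "e \<notin> E1"
  proof
    assume "e \<in> E1"
    then have "(fst (s e) = y \<and> snd (s e) \<in> D) \<or> (snd (s e) = y \<and> fst (s e) \<in> D)"
      using e zD by (auto simp: E1_def)
    then show False using cl[OF e(1)] zD wD w by auto
  qed
  then have "E - E1 \<noteq> {}" using e by blast
  moreover have "fst (s e) \<in> D \<longrightarrow> snd (s e) \<in> D \<or> snd (s e) = w"
    "snd (s e) \<in> D \<longrightarrow> fst (s e) \<in> D \<or> fst (s e) = w" if "e \<in> E" for e
    using cl[OF that] wD by metis+
  then have "graph_on (insert w D) E1 s" "graph_on (V - D) (E - E1) s"
    using wf DV by (auto simp: graph_on_def E1_def intro: finite_subset)
  ultimately show ?thesis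
    using that[of "insert w D" "V - D" w E1 "E - E1"] w wD DV by (auto simp: E1_def)
qed

section \<open>Contraction, deletion and two-vertex sums\<close>

text \<open>All edges of a path from \<open>x\<close> stay in the component of \<open>x\<close>.
  Hence the path survives the removal of a vertex outside this component.\<close>

lemma linked_component:
  assumes "linked s A x y"
  shows "linked s {e\<in>A. linked s A x (fst (s e)) \<and> linked s A x (snd (s e))} x y"
  using assms unfolding linked_def[of s A x y]
proof (induction rule: rtrancl_induct)
  case (step y z)
  let ?B = "{e\<in>A. linked s A x (fst (s e)) \<and> linked s A x (snd (s e))}"
  obtain e where e: "e \<in> A" "s e = (y, z) \<or> s e = (z, y)" using step by (auto simp: adj_def)
  have y: "linked s A x y" using step.hyps(1) by (simp add: linked_def)
  have "linked s A y z" using linked_edge[OF e(1), of s] e(2) linked_sym by auto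
  with y have z: "linked s A x z" by (rule linked_trans)
  have "e \<in> ?B" using e y z by auto
  then have "linked s ?B (fst (s e)) (snd (s e))" by (rule linked_edge)
  then have "linked s ?B y z" using e(2) linked_sym by auto
  then show ?case using step.IH linked_trans by blast
qed simp

lemma linked_ident_ends:
  assumes "s e = (u, v)"
  shows "linked (ident_ends s u v) A (if x = v then u else x) (if y = v then u else y) \<longleftrightarrow>
    linked s (insert e A) x y"
  using linked_identify[of s e u v "\<lambda>w. if w = v then u else w" "ident_ends s u v" A x y] assms
  by (simp add: ident_ends_def)

lemma graph_ident_ends: "graph_on V E s \<Longrightarrow> u \<in> V \<Longrightarrow> u \<noteq> v \<Longrightarrow> E' \<subseteq> E \<Longrightarrow>
    graph_on (V - {v}) E' (ident_ends s u v)"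
  by (auto simp: graph_on_def ident_ends_def intro: finite_subset)

lemma conn_contract:
  assumes "conn_on V E s" "e \<in> E" "s e = (u, v)" "u \<in> V" "u \<noteq> v"
  shows "conn_on (V - {v}) (E - {e}) (ident_ends s u v)"
proof -
  have "linked (ident_ends s u v) (E - {e}) x y" if "x \<in> V - {v}" "y \<in> V - {v}" for x y
    using linked_ident_ends[of s e u v "E - {e}" x y] assms that
        by (auto simp: insert_absorb conn_on_def)
  then show ?thesis using assms by (auto simp: conn_on_def)
qed

lemma conn_identify:
  assumes "conn_on V E s" "u \<in> V" "u \<noteq> v"
  shows "conn_on (V - {v}) E (ident_ends s u v)"
proof -
  have "linked (ident_ends s u v) E x y" if "x \<in> V - {v}" "y \<in> V - {v}" for x y
  proof -
    let ?r = "\<lambda>w. if w = v then u else w"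
    have "linked s E x y" using assms that by (simp add: conn_on_def)
    then have "linked (ident_ends s u v) E (?r x) (?r y)"
    proof (rule linked_map)
      fix e assume "e \<in> E"
      then show "linked (ident_ends s u v) E (?r (fst (s e))) (?r (snd (s e)))"
        using linked_edge[of e E "ident_ends s u v"] by (simp add: ident_ends_def)
    qed
    then show ?thesis using that by simp
  qed
  then show ?thesis using assms by (auto simp: conn_on_def)
qed

lemma bridgeless_contract:
  assumes "bridgeless_on E s" "e \<in> E" "s e = (u, v)"
  shows "bridgeless_on (E - {e}) (ident_ends s u v)"
  unfolding bridgeless_on_def
proof
  fix g assume g: "g \<in> E - {e}"
  have "insert e (E - {e} - {g}) = E - {g}" using assms g by auto
  then have "linked s (insert e (E - {e} - {g})) (fst (s g)) (snd (s g))"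
    using assms(1) g by (simp add: bridgeless_on_def)
  then show "linked (ident_ends s u v) (E - {e} - {g}) (fst (ident_ends s u v g)) (snd (ident_ends s u
      v g))"
    using linked_ident_ends[of s e u v "E - {e} - {g}", OF assms(3)] by (simp add: ident_ends_def)
qed

lemma flow_contract:
  assumes "finite E" "e \<in> E" "s e = (u, v)" "u \<noteq> v"
  shows "flow E s x = flow (E - {e}) (ident_ends s u v) x - flow (E - {e}) s x"
  using flow_identify[of "E - {e}" e s u v "ident_ends s u v" x] assms
      by (simp add: ident_ends_def insert_absorb)

lemma conn_del: "conn_on V E s \<Longrightarrow> bridgeless_on E s \<Longrightarrow> conn_on V (E - {e}) s"
proof -
  assume c: "conn_on V E s" and b: "bridgeless_on E s"
  have "linked s (E - {e}) x y" if "linked s E x y" for x y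
  proof (rule linked_map[OF that, where h = "\<lambda>x. x"])
    fix g assume "g \<in> E"
    then show "linked s (E - {e}) (fst (s g)) (snd (s g))"
      using b linked_edge[of g "E - {e}" s] by (cases "g = e") (auto simp: bridgeless_on_def)
  qed
  then show ?thesis using c by (auto simp: conn_on_def)
qed

text \<open>With a third vertex \<open>c\<close>, go from one end of \<open>e\<close> to
  \<open>c\<close> avoiding the other end, and then on to that end avoiding the first: neither piece
  uses \<open>e\<close>. Without a third vertex any second edge is parallel to
  \<open>e\<close>.\<close>

lemma nonsep_bridgeless:
  assumes wf: "graph_on V E s" and nonsep_on: "nonsep_on V E s" and c: "card E \<ge> 2"
  shows "bridgeless_on E s"
  unfolding bridgeless_on_def
proof
  fix e assume e: "e \<in> E"
  let ?a = "fst (s e)" and ?b = "snd (s e)"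
  have loopless: "loopless E s" using nonsep_on c by (auto simp: nonsep_on_def)
  have ab: "?a \<in> V" "?b \<in> V" "?a \<noteq> ?b" using e wf loopless by (auto simp: graph_on_def loopless_def)
  show "linked s (E - {e}) ?a ?b"
  proof (cases "V \<subseteq> {?a, ?b}")
    case True
    have "E \<noteq> {e}" using c by auto
    then obtain g where g: "g \<in> E" "g \<noteq> e" using e by auto
    then have "fst (s g) \<in> {?a, ?b}" "snd (s g) \<in> {?a, ?b}" "fst (s g) \<noteq> snd (s g)"
      using wf True loopless by (auto simp: graph_on_def loopless_def)
    then have "(fst (s g) = ?a \<and> snd (s g) = ?b) \<or> (fst (s g) = ?b \<and> snd (s g) = ?a)" by fastforce
    then show ?thesis using linked_edge[of g "E - {e}" s] linked_sym g by fastforce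
  next
    case False
    then obtain c where c: "c \<in> V" "c \<noteq> ?a" "c \<noteq> ?b" by auto
    have "linked s (avoid E s ?b) ?a c" "linked s (avoid E s ?a) c ?b" using nonsep_on ab c
        by (auto simp: nonsep_on_def)
    moreover have "avoid E s ?b \<subseteq> E - {e}" "avoid E s ?a \<subseteq> E - {e}" by (auto simp: avoid_def)
    ultimately show ?thesis using linked_mono linked_trans by metis
  qed
qed

text \<open>Two things can go wrong: an edge parallel to \<open>e\<close> becomes a loop, or the
  merged vertex is a cut-vertex because \<open>u\<close> and \<open>v\<close> together separate.
  \<open>par\<close> and \<open>N\<close> exclude these; paths that avoid any other vertex survive
  the merging.\<close>

lemma nonsep_contract:
  assumes wf: "graph_on V E s" and nonsep_on: "nonsep_on V E s" and loopless: "loopless E s"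
    and e: "e \<in> E" "s e = (u, v)"
    and par: "\<And>g. g \<in> E - {e} \<Longrightarrow> {fst (s g), snd (s g)} \<noteq> {u, v}"
    and N: "\<And>a b. a \<in> V - {u, v} \<Longrightarrow> b \<in> V - {u, v} \<Longrightarrow> linked s (avoid (avoid E s u) s v) a b"
  shows "nonsep_on (V - {v}) (E - {e}) (ident_ends s u v)"
proof -
  let ?s = "ident_ends s u v" and ?E = "E - {e}" and ?r = "\<lambda>w. if w = v then u else w"
  have uv: "u \<in> V" "v \<in> V" "u \<noteq> v" using e wf loopless by (auto simp: graph_on_def loopless_def)
  have rs: "fst (?s g) = ?r (fst (s g))" "snd (?s g) = ?r (snd (s g))" for g
      by (simp_all add: ident_ends_def)
  have "loopless ?E ?s"
    unfolding loopless_def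
  proof
    fix g assume g: "g \<in> ?E"
    then have "fst (s g) \<noteq> snd (s g)" using loopless by (auto simp: loopless_def)
    then show "fst (?s g) \<noteq> snd (?s g)" using par[OF g] by (auto simp: ident_ends_def split: if_splits)
  qed
  moreover have "conn_on (V - {v}) ?E ?s" using nonsep_on e uv
      by (intro conn_contract) (auto simp: nonsep_on_def)
  moreover have "linked ?s (avoid ?E ?s z) x y"
      if z: "z \<in> V - {v}" "x \<in> V - {v} - {z}" "y \<in> V - {v} - {z}" for z x y
  proof (cases "z = u")
    case True
    have "linked s (avoid (avoid E s u) s v) x y" using N z True by auto
    then show ?thesis
    proof (rule linked_map[where h = "\<lambda>x. x"])
      fix g assume "g \<in> avoid (avoid E s u) s v"
      then have "g \<in> avoid ?E ?s z" "s g = ?s g"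
        using e True by (auto simp: avoid_def ident_ends_def)
      then show "linked ?s (avoid ?E ?s z) (fst (s g)) (snd (s g))"
        using linked_edge[of g "avoid ?E ?s z" ?s] by simp
    qed
  next
    case False
    have "linked s (avoid E s z) x y" using nonsep_on z by (auto simp: nonsep_on_def)
    then have "linked ?s (avoid ?E ?s z) (?r x) (?r y)"
    proof (rule linked_map)
      fix g assume g: "g \<in> avoid E s z"
      show "linked ?s (avoid ?E ?s z) (?r (fst (s g))) (?r (snd (s g)))"
      proof (cases "g = e")
        case True
        then show ?thesis using e by simp
      next
        assume "g \<noteq> e"
        then have "g \<in> avoid ?E ?s z" using g False by (auto simp: avoid_def ident_ends_def)
        then show ?thesis using linked_edge[of g "avoid ?E ?s z" ?s] by (simp add: rs)
      qed
    qed
    then show ?thesis using z by simp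
  qed
  ultimately show ?thesis by (simp add: nonsep_on_def)
qed

text \<open>Only \<open>e\<close> itself needs a substitute: if its ends stay linked without it,
  also after deletion of any third vertex, then every path through \<open>e\<close> can be
  rerouted.\<close>

lemma nonsep_del_replace:
  assumes nonsep_on: "nonsep_on V E s" and loopless: "loopless E s" and e: "e \<in> E"
    and L: "linked s (E - {e}) (fst (s e)) (snd (s e))"
    and A: "\<And>w. w \<in> V \<Longrightarrow> w \<noteq> fst (s e) \<Longrightarrow> w \<noteq> snd (s e) \<Longrightarrow>
      linked s (avoid (E - {e}) s w) (fst (s e)) (snd (s e))"
  shows "nonsep_on V (E - {e}) s"
proof -
  have "linked s (E - {e}) x y" if "linked s E x y" for x y
  proof (rule linked_map[OF that, where h = "\<lambda>x. x"])
    fix g assume "g \<in> E"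
    then show "linked s (E - {e}) (fst (s g)) (snd (s g))"
      using L linked_edge[of g "E - {e}" s] by (cases "g = e") auto
  qed
  then have "conn_on V (E - {e}) s" using nonsep_on by (auto simp: conn_on_def nonsep_on_def)
  moreover have "linked s (avoid (E - {e}) s w) x y"
    if w: "w \<in> V" "x \<in> V - {w}" "y \<in> V - {w}" for w x y
  proof -
    have "linked s (avoid E s w) x y" using nonsep_on w by (auto simp: nonsep_on_def)
    then show ?thesis
    proof (rule linked_map[where h = "\<lambda>x. x"])
      fix g assume g: "g \<in> avoid E s w"
      show "linked s (avoid (E - {e}) s w) (fst (s g)) (snd (s g))"
      proof (cases "g = e")
        case True
        then show ?thesis using A[OF w(1)] g by (auto simp: avoid_def)
      next
        case False
        then show ?thesis using g by (intro linked_edge) (auto simp: avoid_def)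
      qed
    qed
  qed
  ultimately show ?thesis using loopless by (auto simp: nonsep_on_def loopless_def)
qed

text \<open>If the contraction is separable, either \<open>e\<close> has a parallel edge, which
  replaces it, or \<open>u\<close> and \<open>v\<close> together separate some \<open>x\<close> from
  some \<open>y\<close>. In the second case each further vertex \<open>w\<close> misses the
  component of \<open>x\<close> or that of \<open>y\<close>, and a path from \<open>u\<close> to
  \<open>v\<close> through the missed component avoids \<open>e\<close> and
  \<open>w\<close>.\<close>

lemma nonsep_del_or_contract:
  assumes wf: "graph_on V E s" and nonsep_on: "nonsep_on V E s" and loopless: "loopless E s"
    and e: "e \<in> E" "s e = (u, v)"
    and n: "\<not> nonsep_on (V - {v}) (E - {e}) (ident_ends s u v)"
  shows "nonsep_on V (E - {e}) s"
proof (cases "\<exists>g\<in>E - {e}. {fst (s g), snd (s g)} = {u, v}")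
  case True
  then obtain g where g: "g \<in> E - {e}" "{fst (s g), snd (s g)} = {u, v}" by blast
  then have guv: "(fst (s g) = u \<and> snd (s g) = v) \<or> (fst (s g) = v \<and> snd (s g) = u)"
    by (auto simp: doubleton_eq_iff)
  show ?thesis
  proof (rule nonsep_del_replace[OF nonsep_on loopless e(1)])
    show "linked s (E - {e}) (fst (s e)) (snd (s e))"
      using linked_edge[of g "E - {e}" s] guv g e linked_sym by auto
    show "linked s (avoid (E - {e}) s w) (fst (s e)) (snd (s e))"
      if "w \<noteq> fst (s e)" "w \<noteq> snd (s e)" for w
    proof -
      have "g \<in> avoid (E - {e}) s w" using that guv g e by (auto simp: avoid_def)
      then show ?thesis using linked_edge[of g "avoid (E - {e}) s w" s] guv e linked_sym by auto
    qed
  qed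
next
  case False
  let ?N = "avoid (avoid E s u) s v"
  have uv: "u \<in> V" "v \<in> V" "u \<noteq> v" using e wf loopless by (auto simp: graph_on_def loopless_def)
  obtain x y where xy: "x \<in> V - {u, v}" "y \<in> V - {u, v}" "\<not> linked s ?N x y"
    using nonsep_contract[OF wf nonsep_on loopless e] n False by blast
  \<comment> \<open>The component \<open>D\<close> of \<open>c\<close> can be left towards
    \<open>q\<close> even without \<open>p\<close>, since \<open>p\<close> is no cut-vertex. As
    \<open>w\<close> is not in \<open>D\<close>, this path avoids \<open>w\<close> too.\<close>
  have key: "linked s (avoid (E - {e}) s w) c q"
    if c: "c \<in> V - {u, v}" "\<not> linked s ?N c w" and w: "w \<notin> {u, v}"
      and qp: "(q = u \<and> p = v) \<or> (q = v \<and> p = u)" for c w q p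
  proof (rule ccontr)
    assume not: "\<not> linked s (avoid (E - {e}) s w) c q"
    define D where "D = {d. linked s ?N c d}"
    have cD: "linked s (avoid (E - {e}) s w) c d" if "d \<in> D" for d
    proof -
      have "linked s ?N c d" using that by (simp add: D_def)
      from linked_component[OF this] show ?thesis
      proof (rule linked_mono, safe)
        fix g assume "g \<in> ?N" "linked s ?N c (fst (s g))" "linked s ?N c (snd (s g))"
        then show "g \<in> avoid (E - {e}) s w" using c e by (auto simp: avoid_def)
      qed
    qed
    have qD: "q \<notin> D"
    proof
      assume "q \<in> D"
      then have "linked s ?N q c" using linked_sym by (simp add: D_def)
      then have "c = q" by (rule linked_isolated) (use qp in \<open>auto simp: avoid_def\<close>)
      then show False using c qp by auto
    qed
    have "linked s (avoid E s p) c q" using nonsep_on c qp uv by (auto simp: nonsep_on_def)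
    then have "q \<in> D"
    proof (rule linked_closed)
      show "c \<in> D" by (simp add: D_def)
      fix g assume g: "g \<in> avoid E s p"
      have touch: False if "d \<in> D" "(fst (s g) = q \<and> snd (s g) = d) \<or> (fst (s g) = d \<and> snd (s g) = q)"
          for d
      proof -
        have "d \<noteq> w" using that c by (auto simp: D_def)
        moreover have "g \<noteq> e" using g qp e by (auto simp: avoid_def)
        ultimately have "g \<in> avoid (E - {e}) s w" using g that w qp by (auto simp: avoid_def)
        then have "linked s (avoid (E - {e}) s w) d q"
          using that linked_edge[of g "avoid (E - {e}) s w" s] linked_sym by auto
        then show False using not cD[OF \<open>d \<in> D\<close>] linked_trans by blast
      qed
      show "fst (s g) \<in> D \<longleftrightarrow> snd (s g) \<in> D"
      proof (cases "fst (s g) = q \<or> snd (s g) = q")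
        case True
        then show ?thesis using touch qD by blast
      next
        case False
        then have "g \<in> ?N" using g qp by (auto simp: avoid_def)
        then have "linked s ?N (fst (s g)) (snd (s g))" by (rule linked_edge)
        then show ?thesis unfolding D_def mem_Collect_eq using linked_trans linked_sym by blast
      qed
    qed
    then show False using qD by simp
  qed
  have key2: "linked s (avoid (E - {e}) s w) u v" if w: "w \<notin> {u, v}" for w
  proof -
    have "\<not> linked s ?N x w \<or> \<not> linked s ?N y w" using xy linked_trans linked_sym by blast
    then obtain c where c: "c \<in> V - {u, v}" "\<not> linked s ?N c w" using xy by blast
    show ?thesis using key[OF c w, of u v] key[OF c w, of v u] linked_trans linked_sym by blast
  qed
  show ?thesis
  proof (rule nonsep_del_replace[OF nonsep_on loopless e(1)])
    have "linked s (avoid (E - {e}) s x) u v" using key2 xy by blast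
    moreover have "avoid (E - {e}) s x \<subseteq> E - {e}" by (auto simp: avoid_def)
    ultimately show "linked s (E - {e}) (fst (s e)) (snd (s e))" using e linked_mono by fastforce
  qed (use key2 e in auto)
qed

lemma nonsep_contract_cubic:
  assumes wf: "graph_on V E s" and nonsep_on: "nonsep_on V E s" and loopless: "loopless E s"
    and e: "e \<in> E" "s e = (u, v)" and x: "(x = u \<and> y = v) \<or> (x = v \<and> y = u)"
    and gh: "g \<in> E" "h \<in> E" "g \<noteq> e" "h \<noteq> e"
    and incident: "\<And>d. d \<in> E \<Longrightarrow> fst (s d) = x \<or> snd (s d) = x \<Longrightarrow> d \<in> {e, g, h}"
    and nsg: "nonsep_on V (E - {g}) s" and nsh: "nonsep_on V (E - {h}) s"
    and c: "c \<in> V" "c \<notin> {u, v}"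
  shows "nonsep_on (V - {v}) (E - {e}) (ident_ends s u v)"
proof (rule nonsep_contract[OF wf nonsep_on loopless e])
  have uv: "u \<in> V" "v \<in> V" "u \<noteq> v" using e wf loopless by (auto simp: graph_on_def loopless_def)
  have iso: False if dd: "{d, d'} = {g, h}" "{fst (s d), snd (s d)} = {u, v}"
      "nonsep_on V (E - {d'}) s" for d d'
  proof -
    have "linked s (avoid (E - {d'}) s y) x c" using that c x uv by (auto simp: nonsep_on_def)
    then have "c = x"
    proof (rule linked_isolated)
      fix q assume q: "q \<in> avoid (E - {d'}) s y"
      show "fst (s q) \<noteq> x \<and> snd (s q) \<noteq> x"
      proof (rule ccontr)
        assume "\<not> ?thesis"
        then have "q \<in> {e, g, h}" using incident[of q] q by (auto simp: avoid_def)
        then have "q \<in> {e, d}" using dd(1) q by (auto simp: avoid_def)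
        then show False
        proof
          assume "q = e" then show False using q e x by (auto simp: avoid_def)
        next
          assume "q \<in> {d}" then show False using q dd(2) x by (auto simp: avoid_def doubleton_eq_iff)
        qed
      qed
    qed
    then show False using c x by auto
  qed
  show "{fst (s d), snd (s d)} \<noteq> {u, v}" if d: "d \<in> E - {e}" for d
  proof
    assume *: "{fst (s d), snd (s d)} = {u, v}"
    then have "fst (s d) = x \<or> snd (s d) = x" using x by (auto simp: doubleton_eq_iff)
    then have "d = g \<or> d = h" using incident d by blast
    then show False using iso[of g h] iso[of h g] * nsg nsh by auto
  qed
  show "linked s (avoid (avoid E s u) s v) a b" if ab: "a \<in> V - {u, v}" "b \<in> V - {u, v}" for a b
  proof -
    \<comment> \<open>The other end of \<open>h\<close>; mapping \<open>x\<close> to it collapses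
      the pendant edge.\<close>
    define z where "z = (if fst (s h) = x then snd (s h) else fst (s h))"
    let ?h = "\<lambda>w. if w = x then z else w"
    have "linked s (avoid (E - {g}) s y) a b" using nsg ab x uv by (auto simp: nonsep_on_def)
    then have "linked s (avoid (avoid E s u) s v) (?h a) (?h b)"
    proof (rule linked_map)
      fix d assume d: "d \<in> avoid (E - {g}) s y"
      show "linked s (avoid (avoid E s u) s v) (?h (fst (s d))) (?h (snd (s d)))"
      proof (cases "fst (s d) = x \<or> snd (s d) = x")
        case True
        then have "d \<in> {e, g, h}" using incident d by (auto simp: avoid_def)
        moreover have "d \<noteq> e" using d e x by (auto simp: avoid_def)
        ultimately have "d = h" using d by (auto simp: avoid_def)
        then show ?thesis using True by (auto simp: z_def)
      next
        case False
        then have "d \<in> avoid (avoid E s u) s v" using d x by (auto simp: avoid_def)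
        then show ?thesis using False linked_edge by auto
      qed
    qed
    then show ?thesis using ab x by auto
  qed
qed

lemma graph_cong: "(\<And>e. e \<in> E \<Longrightarrow> s e = s' e) \<Longrightarrow> graph_on V E s \<longleftrightarrow> graph_on V E s'"
  by (simp add: graph_on_def)

lemma nonsep_cong:
  assumes "\<And>e. e \<in> E \<Longrightarrow> s e = s' e"
  shows "nonsep_on V E s \<longleftrightarrow> nonsep_on V E s'"
proof -
  have 1: "avoid E s v = avoid E s' v" for v using assms by (auto simp: avoid_def)
  have 2: "linked s (avoid E s' v) x y \<longleftrightarrow> linked s' (avoid E s' v) x y" for v x y
    by (rule linked_cong) (use assms in \<open>simp add: avoid_def\<close>)
  have 3: "linked s E x y \<longleftrightarrow> linked s' E x y" for x y
    by (rule linked_cong) (use assms in simp)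
  have "loopless E s \<longleftrightarrow> loopless E s'" using assms by (simp add: loopless_def)
  then show ?thesis unfolding nonsep_on_def conn_on_def 1 2 3 by simp
qed

text \<open>A detour through the other side either returns to its starting point or runs between
  \<open>a\<close> and \<open>b\<close>, where \<open>f\<close> can stand in for it. After deletion
  of \<open>a\<close> or \<open>b\<close> only the first kind is left.\<close>

lemma nonsep_two_sum_part:
  assumes nonsep_on: "nonsep_on V E s" and loopless: "loopless E s" and E: "E1 \<union> E2 = E"
    and wf1: "graph_on V1 E1 s" and wf2: "graph_on V2 E2 s" and V: "V1 \<union> V2 = V"
    and S: "V1 \<inter> V2 = {a, b}" "a \<noteq> b" and f: "s f = (a, b)"
  shows "nonsep_on V1 (insert f E1) s"
proof -
  let ?E = "insert f E1"
  have ab: "a \<in> V1" "b \<in> V1" using S by auto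
  have lf: "linked s ?E a b" using linked_edge[of f ?E s] f by simp
  have "linked s ?E x y" if "x \<in> V1" "y \<in> V1" for x y
  proof (rule linked_glue[of E2 s V2 E1 V1 s ?E])
    show "linked s (E2 \<union> E1) x y" using nonsep_on that V E
        by (auto simp: nonsep_on_def conn_on_def Un_commute)
    show "linked s ?E p q" if "p \<in> V2 \<inter> V1" "q \<in> V2 \<inter> V1" for p q
    proof -
      have "p \<in> {a, b}" "q \<in> {a, b}" using that S(1) by auto
      then show ?thesis using lf linked_sym by auto
    qed
    show "linked s ?E (fst (s e)) (snd (s e))" if "e \<in> E1" for e using that by (intro linked_edge) simp
  qed (use that wf1 wf2 in \<open>auto simp: graph_on_def\<close>)
  then have "conn_on V1 ?E s" using ab by (auto simp: conn_on_def)
  moreover have "linked s (avoid ?E s w) x y" if w: "w \<in> V1" "x \<in> V1 - {w}" "y \<in> V1 - {w}" for w x y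
  proof (rule linked_glue[of "avoid E2 s w" s "V2 - {w}" "avoid E1 s w" "V1 - {w}" s "avoid ?E s w"])
    have "avoid E2 s w \<union> avoid E1 s w = avoid E s w" using E by (auto simp: avoid_def)
    then show "linked s (avoid E2 s w \<union> avoid E1 s w) x y" using nonsep_on w V
        by (auto simp: nonsep_on_def)
    show "linked s (avoid ?E s w) p q" if "p \<in> (V2 - {w}) \<inter> (V1 - {w})" "q \<in> (V2 - {w}) \<inter> (V1 - {w})"
        for p q
    proof -
      have pq: "p \<in> {a, b} - {w}" "q \<in> {a, b} - {w}" using that S(1) by auto
      show ?thesis
      proof (cases "w = a \<or> w = b")
        case True
        then have "p = q" using pq by auto
        then show ?thesis by simp
      next
        case False
        then have "linked s (avoid ?E s w) a b"
          using linked_edge[of f "avoid ?E s w" s] f by (simp add: avoid_def)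
        then show ?thesis using pq linked_sym by auto
      qed
    qed
    show "linked s (avoid ?E s w) (fst (s e)) (snd (s e))" if "e \<in> avoid E1 s w" for e
      using that by (intro linked_edge) (simp add: avoid_def)
  qed (use w wf1 wf2 in \<open>auto simp: graph_on_def avoid_def\<close>)
  moreover have "loopless ?E s" using loopless E S f by (auto simp: loopless_def)
  ultimately show ?thesis by (simp add: nonsep_on_def)
qed

text \<open>If \<open>E1\<close> did not join \<open>a\<close> and \<open>b\<close>, then one of
  them, \<open>p\<close>, would have a further vertex in its component of \<open>E1\<close>, and
  \<open>p\<close> would separate this vertex from the other one in the whole graph.\<close>

lemma conn_two_sum_part:
  assumes nonsep_on: "nonsep_on V E s" and loopless: "loopless E s" and E: "E1 \<union> E2 = E" "E1 \<noteq> {}"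
    and wf1: "graph_on V1 E1 s" and wf2: "graph_on V2 E2 s" and V: "V1 \<union> V2 = V"
    and S: "V1 \<inter> V2 = {a, b}" "a \<noteq> b" and f: "s f = (a, b)"
  shows "conn_on V1 E1 s"
proof -
  have c: "conn_on V1 (insert f E1) s" using nonsep_two_sum_part[OF nonsep_on loopless E(1) wf1 wf2 V
      S f] by (simp add: nonsep_on_def)
  have ab: "a \<in> V1" "b \<in> V1" "a \<in> V2" "b \<in> V2" using S by auto
  have no: "linked s E1 a b" if pq: "{p, q} = {a, b}" "linked s E1 p z" "z \<noteq> p" "z \<in> V1" for p q z
  proof (rule ccontr)
    assume n: "\<not> linked s E1 a b"
    then have n: "\<not> linked s E1 p q" using pq(1) linked_sym by (auto simp: doubleton_eq_iff)
    define D where "D = {d. linked s E1 p d}"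
    have DV: "D \<subseteq> V1"
    proof
      fix d assume "d \<in> D"
      then have "linked s E1 p d" by (simp add: D_def)
      then show "d \<in> V1"
        by (rule linked_closed) (use pq(1) ab wf1 in \<open>fastforce simp: graph_on_def doubleton_eq_iff\<close>)+
    qed
    have pqc: "(p = a \<and> q = b) \<or> (p = b \<and> q = a)" using pq(1) by (simp add: doubleton_eq_iff)
    have "p \<noteq> q" using pqc S by metis
    moreover have "z \<noteq> q" using pq(2) n by metis
    moreover have "p \<in> V" "q \<in> V" using pqc ab V by blast+
    ultimately have "z \<noteq> q" "z \<in> V - {p}" "q \<in> V - {p}" "p \<in> V" using pq(3,4) V by blast+
    then have "linked s (avoid E s p) z q" using nonsep_on by (auto simp: nonsep_on_def)
    then have "q \<in> D - {p}"
    proof (rule linked_closed)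
      show "z \<in> D - {p}" using pq by (simp add: D_def)
      fix g assume g: "g \<in> avoid E s p"
      show "fst (s g) \<in> D - {p} \<longleftrightarrow> snd (s g) \<in> D - {p}"
      proof (cases "g \<in> E1")
        case True
        then have "linked s E1 (fst (s g)) (snd (s g))" by (rule linked_edge)
        then have "fst (s g) \<in> D \<longleftrightarrow> snd (s g) \<in> D"
          unfolding D_def mem_Collect_eq using linked_trans linked_sym by blast
        then show ?thesis using g by (auto simp: avoid_def)
      next
        case False
        then have "fst (s g) \<in> V2" "snd (s g) \<in> V2" using g E wf2 by (auto simp: avoid_def graph_on_def)
        moreover have "D \<inter> V2 \<subseteq> {p}"
        proof
          fix d assume d: "d \<in> D \<inter> V2"
          then have "d = p \<or> d = q" using DV S pqc by blast
          then show "d \<in> {p}" using d n D_def by blast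
        qed
        ultimately show ?thesis by auto
      qed
    qed
    then show False using n by (simp add: D_def)
  qed
  have "linked s E1 a b"
  proof -
    \<comment> \<open>Any edge of \<open>E1\<close> provides the further vertex: its ends are linked
      to \<open>a\<close> or to \<open>b\<close> within \<open>E1\<close>, and they are
      distinct.\<close>
    obtain g where g: "g \<in> E1" using E by blast
    define p where "p = fst (s g)"
    define q where "q = snd (s g)"
    have pq: "p \<in> V1" "q \<in> V1" "p \<noteq> q" using g wf1 loopless E
        by (auto simp: graph_on_def loopless_def p_def q_def)
    have lpq: "linked s E1 p q" unfolding p_def q_def using g by (rule linked_edge)
    have "linked s (insert f E1) a p" using c ab pq by (auto simp: conn_on_def)
    then have "linked s E1 a p \<or> linked s E1 b p"
      using linked_insert[of s f E1 a p] f by (metis fst_conv snd_conv)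
    then show ?thesis
    proof
      assume "linked s E1 a p"
      then show ?thesis using no[of a b p] no[of a b q] pq lpq by (cases "p = a") simp_all
    next
      assume "linked s E1 b p"
      then show ?thesis using no[of b a p] no[of b a q] pq lpq insert_commute[of a b "{}"]
        by (cases "p = b") simp_all
    qed
  qed
  then have "linked s (insert f E1) x y \<longleftrightarrow> linked s E1 x y" for x y
    using linked_insert_same[of s E1 f] f by simp
  then show ?thesis using c by (simp add: conn_on_def)
qed

section \<open>Uniqueness of the flow polynomial and its sign near 1\<close>

lemma flow_not_bridgeless:
  assumes "finite E" "\<not> bridgeless_on E s"
  shows "flow E s x = 0"
proof -
  obtain e where "e \<in> E" "\<not> linked s (E - {e}) (fst (s e)) (snd (s e))"
    using assms by (auto simp: bridgeless_on_def)
  then show ?thesis using flow_bridge[of "E - {e}" e s x] assms by (simp add: insert_absorb)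
qed

lemma flow_rules_flow: "flow_rules (\<lambda>G. flow (edges G) (ends G))"
  unfolding flow_rules_def
proof (intro allI impI conjI ballI)
  fix G assume wf: "wf_graph G"
  obtain V E s where G: "G = gr V E s" by (metis graph.cases)
  have wf': "graph_on V E s" using wf G wf_graph_iff by simp
  then have fin: "finite E" by (simp add: graph_on_def)
  show "flow (edges G) (ends G) = (\<lambda>_. 1)" if "edges G = {}"
    using that by auto
  show "flow (edges G) (ends G) = (\<lambda>_. 0)" if "\<not> bridgeless G"
    using that G bridgeless_iff[OF wf'] flow_not_bridgeless[OF fin] by auto
  show "flow (edges G) (ends G) = (\<lambda>x. (x - 1) * flow (edges (del_edge G e)) (ends (del_edge G e)) x)"
    if e: "e \<in> edges G" "is_loop G e" for e
    using e flow_loop[of "E - {e}" e s] fin G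
    by (intro ext) (simp add: del_edge_gr is_loop_def insert_absorb)
  show "flow (edges G) (ends G) = (\<lambda>x. flow (edges (contract G e)) (ends (contract G e)) x -
      flow (edges (del_edge G e)) (ends (del_edge G e)) x)"
    if e: "e \<in> edges G" "bridgeless G \<and> \<not> is_loop G e" for e
  proof
    fix x
    obtain u v where uv: "s e = (u, v)" by fastforce
    then show "flow (edges G) (ends G) x = flow (edges (contract G e)) (ends (contract G e)) x -
      flow (edges (del_edge G e)) (ends (del_edge G e)) x"
      using e flow_contract[of E e s u v x, OF fin _ uv] G
      by (simp add: del_edge_gr contract_gr[where s = s and e = e and u = u
          and v = v, OF uv] is_loop_def)
  qed
  show "flow (edges G) (ends G) = (\<lambda>x.
      flow (edges (sub G V1 {e\<in>edges G. fst (ends G e) \<in> V1})) (ends (sub G V1 {e\<in>edges G. fst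
          (ends G e) \<in> V1})) x *
      flow (edges (sub G V2 {e\<in>edges G. fst (ends G e) \<in> V2})) (ends (sub G V2 {e\<in>edges G. fst
          (ends G e) \<in> V2})) x)"
    if V: "V1 \<inter> V2 = {} \<and> V1 \<union> V2 = verts G \<and>
        (\<forall>e\<in>edges G. (fst (ends G e) \<in> V1 \<and> snd (ends G e) \<in> V1) \<or>
                      (fst (ends G e) \<in> V2 \<and> snd (ends G e) \<in> V2))" for V1 V2
  proof
    fix x
    let ?E1 = "{e\<in>E. fst (s e) \<in> V1}" and ?E2 = "{e\<in>E. fst (s e) \<in> V2}"
    have E: "E = ?E1 \<union> ?E2" using V G by auto
    have "flow (?E1 \<union> ?E2) s x = flow ?E1 s x * flow ?E2 s x"
      \<comment> \<open>The two sides share no vertex, so any value of \<open>w\<close> will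
        do.\<close>
      by (rule flow_one_sum[where ?V1.0 = V1 and ?V2.0 = V2 and w = 0])
        (use V G fin in auto)
    then show "flow (edges G) (ends G) x =
      flow (edges (sub G V1 {e\<in>edges G. fst (ends G e) \<in> V1})) (ends (sub G V1 {e\<in>edges G. fst
          (ends G e) \<in> V1})) x *
      flow (edges (sub G V2 {e\<in>edges G. fst (ends G e) \<in> V2})) (ends (sub G V2 {e\<in>edges G. fst
          (ends G e) \<in> V2})) x"
      using G E by (simp add: sub_gr)
  qed
qed

text \<open>Take any edge: it is a loop, or deletion-contraction applies, or there is a bridge and
  the value is 0. The rules speak of well-formed graphs only, so two solutions may differ
  elsewhere.\<close>

lemma flow_rules_unique:
  assumes f: "flow_rules f"
  shows "wf_graph G \<Longrightarrow> f G = flow (edges G) (ends G)"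
proof (induction "card (edges G)" arbitrary: G rule: less_induct)
  case less
  note r = f[unfolded flow_rules_def, rule_format, OF less.prems]
  note r' = flow_rules_flow[unfolded flow_rules_def, rule_format, OF less.prems]
  have fin: "finite (edges G)" using less.prems by (simp add: wf_graph_def)
  have wfd: "wf_graph (del_edge G e)" for e using less.prems by (simp add: wf_graph_def del_edge_def)
  have wfc: "wf_graph (contract G e)" if "e \<in> edges G" for e
    using less.prems that by (auto simp: wf_graph_def contract_def identify_def Let_def del_edge_def)
  have lt: "card (edges (del_edge G e)) < card (edges G)" "card (edges (contract G e)) < card (edges G)"
    if "e \<in> edges G" for e
    using card_Diff1_less[OF fin that] by (simp_all add: contract_def identify_def Let_def del_edge_def)
  show ?case
  proof (cases "edges G = {}")
    case True
    then show ?thesis using r r' by simp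
  next
    case False
    then obtain e where e: "e \<in> edges G" by blast
    show ?thesis
    proof (cases "is_loop G e")
      case True
      have 1: "f (del_edge G e) = flow (edges (del_edge G e)) (ends (del_edge G e))"
        using less.hyps[OF lt(1)[OF e] wfd] .
      have "f G = (\<lambda>x. (x - 1) * f (del_edge G e) x)" using r e True by simp
      also have "\<dots> = flow (edges G) (ends G)" unfolding 1 using r' e True by simp
      finally show ?thesis .
    next
      case nl: False
      show ?thesis
      proof (cases "bridgeless G")
        case True
        have 1: "f (del_edge G e) = flow (edges (del_edge G e)) (ends (del_edge G e))"
          using less.hyps[OF lt(1)[OF e] wfd] .
        have 2: "f (contract G e) = flow (edges (contract G e)) (ends (contract G e))"
          using less.hyps[OF lt(2)[OF e] wfc[OF e]] .
        have "f G = (\<lambda>x. f (contract G e) x - f (del_edge G e) x)" using r e True nl by simp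
        also have "\<dots> = flow (edges G) (ends G)" unfolding 1 2 using r' e True nl by simp
        finally show ?thesis .
      next
        case False
        then show ?thesis using r r' by simp
      qed
    qed
  qed
qed

lemma flow_poly_gr:
  assumes "graph_on V E s"
  shows "flow_poly (gr V E s) = flow E s"
  unfolding flow_poly_def
proof (rule the_equality)
  show "\<exists>f. flow_rules f \<and> f (gr V E s) = flow E s"
    using flow_rules_flow by (intro exI[of _ "\<lambda>G. flow (edges G) (ends G)"]) simp
  show "p = flow E s" if "\<exists>f. flow_rules f \<and> f (gr V E s) = p" for p
    using that flow_rules_unique assms wf_graph_iff by fastforce
qed

section \<open>Degrees and vertices of degree larger than 3\<close>

definition deg :: "nat set \<Rightarrow> (nat \<Rightarrow> nat \<times> nat) \<Rightarrow> nat \<Rightarrow> nat" where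
  "deg E s x = card {e\<in>E. fst (s e) = x} + card {e\<in>E. snd (s e) = x}"

definition num_big :: "nat set \<Rightarrow> nat set \<Rightarrow> (nat \<Rightarrow> nat \<times> nat) \<Rightarrow> nat" where
  "num_big V E s = card {x\<in>V. 3 < deg E s x}"

lemma card_W: "card (W (gr V E s)) = num_big V E s"
  by (simp add: W_def degree_def num_big_def deg_def)

lemma deg_insert:
  assumes "finite E" "e \<notin> E"
  shows "deg (insert e E) s x = deg E s x + (if fst (s e) = x then 1 else 0) + (if snd (s e) =
      x then 1 else 0)"
proof -
  have "{g\<in>insert e E. P g} = (if P e then insert e {g\<in>E. P g} else {g\<in>E. P g})" for P by auto
  then show ?thesis using assms by (simp add: deg_def)
qed

lemma deg_Un:
  assumes "finite E1" "finite E2" "E1 \<inter> E2 = {}"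
  shows "deg (E1 \<union> E2) s x = deg E1 s x + deg E2 s x"
proof -
  have "card {e\<in>E1 \<union> E2. P e} = card {e\<in>E1. P e} + card {e\<in>E2. P e}" for P
  proof -
    have "{e\<in>E1 \<union> E2. P e} = {e\<in>E1. P e} \<union> {e\<in>E2. P e}" by auto
    then show ?thesis using assms by (simp add: card_Un_disjoint disjoint_iff)
  qed
  then show ?thesis by (simp add: deg_def)
qed

lemma deg_mono:
  assumes "finite E" "E' \<subseteq> E"
  shows "deg E' s x \<le> deg E s x"
  unfolding deg_def using assms by (intro add_mono card_mono) auto

lemma deg_pos:
  assumes "finite E" "e \<in> E" "fst (s e) = x \<or> snd (s e) = x"
  shows "0 < deg E s x"
  using deg_insert[of "E - {e}" e s x] assms by (auto simp: insert_absorb)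

lemma deg_cong: "(\<And>e. e \<in> E \<Longrightarrow> s e = s' e) \<Longrightarrow> deg E s x = deg E s' x"
  unfolding deg_def by (intro arg_cong2[of _ _ _ _ "(+)"] arg_cong[of _ _ card] Collect_cong) auto

lemma deg_loopless:
  assumes "finite E" "loopless E s"
  shows "deg E s x = card {e\<in>E. fst (s e) = x \<or> snd (s e) = x}"
proof -
  have "{e\<in>E. fst (s e) = x \<or> snd (s e) = x} = {e\<in>E. fst (s e) = x} \<union> {e\<in>E. snd (s e) = x}" by auto
  moreover have "{e\<in>E. fst (s e) = x} \<inter> {e\<in>E. snd (s e) = x} = {}"
    using assms by (auto simp: loopless_def)
  ultimately show ?thesis using assms by (simp add: deg_def card_Un_disjoint)
qed

lemma deg_ident_ends:
  assumes "finite E" "u \<noteq> v"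
  shows "deg E (ident_ends s u v) u = deg E s u + deg E s v"
    and "x \<noteq> u \<Longrightarrow> x \<noteq> v \<Longrightarrow> deg E (ident_ends s u v) x = deg E s x"
proof -
  have "card {e\<in>E. (if h e = v then u else h e) = u} = card {e\<in>E. h e = u} + card {e\<in>E. h e = v}" for h
  proof -
    have "{e\<in>E. (if h e = v then u else h e) = u} = {e\<in>E. h e = u} \<union> {e\<in>E. h e = v}" by auto
    moreover have "{e\<in>E. h e = u} \<inter> {e\<in>E. h e = v} = {}" using assms by auto
    ultimately show ?thesis using assms by (simp add: card_Un_disjoint)
  qed
  then show "deg E (ident_ends s u v) u = deg E s u + deg E s v" by (simp add: deg_def ident_ends_def)
  have "{e\<in>E. (if h e = v then u else h e) = x} = {e\<in>E. h e = x}" if "x \<noteq> u" "x \<noteq> v" for h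
    using that by auto
  then show "x \<noteq> u \<Longrightarrow> x \<noteq> v \<Longrightarrow> deg E (ident_ends s u v) x = deg E s x"
      by (simp add: deg_def ident_ends_def)
qed

text \<open>The merged vertex has degree \<open>deg E s u + deg E s v - 2\<close>, which exceeds 3
  exactly when the sum exceeds 5; all other degrees are unchanged. It raises the count only if
  neither end was large before.\<close>

lemma num_big_contract:
  assumes wf: "graph_on V E s" and e: "e \<in> E" "s e = (u, v)" and uv: "u \<noteq> v"
  shows "num_big (V - {v}) (E - {e}) (ident_ends s u v) \<le> num_big V E s + 1"
    and "(5 < deg E s u + deg E s v \<Longrightarrow> 3 < deg E s u \<or> 3 < deg E s v) \<Longrightarrow>
      num_big (V - {v}) (E - {e}) (ident_ends s u v) \<le> num_big V E s"
proof -
  have fin: "finite V" "finite E" and uvV: "u \<in> V" "v \<in> V" using wf e by (auto simp: graph_on_def)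
  have "deg E s x = deg (E - {e}) s x + (if u = x then 1 else 0) + (if v = x then 1 else 0)" for x
    using deg_insert[of "E - {e}" e s x] fin e by (simp add: insert_absorb)
  then have d: "deg (E - {e}) (ident_ends s u v) u + 2 = deg E s u + deg E s v"
    "x \<noteq> u \<Longrightarrow> x \<noteq> v \<Longrightarrow> deg (E - {e}) (ident_ends s u v) x = deg E s x" for x
    using deg_ident_ends[where E = "E - {e}" and u = u and v = v and s = s] fin uv by auto
  let ?W = "{x\<in>V. 3 < deg E s x}" and ?W' = "{x\<in>V - {v}. 3 < deg (E - {e}) (ident_ends s u v) x}"
  have "?W' \<subseteq> insert u (?W - {u, v})" using d(2) uv by auto
  then have 1: "card ?W' \<le> Suc (card (?W - {u, v}))"
    using fin card_mono[of "insert u (?W - {u, v})" ?W'] by (simp add: card_insert_if split: if_splits)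
  moreover have "card (?W - {u, v}) \<le> card ?W" using fin by (intro card_mono) auto
  ultimately show "num_big (V - {v}) (E - {e}) (ident_ends s u v) \<le> num_big V E s + 1"
      by (simp add: num_big_def)
  assume a: "5 < deg E s u + deg E s v \<Longrightarrow> 3 < deg E s u \<or> 3 < deg E s v"
  show "num_big (V - {v}) (E - {e}) (ident_ends s u v) \<le> num_big V E s"
  proof (cases "5 < deg E s u + deg E s v")
    case True
    then have "u \<in> ?W \<or> v \<in> ?W" using a uvV by auto
    then have "card (?W - {u, v}) < card ?W" using fin by (intro psubset_card_mono) auto
    then show ?thesis using 1 by (simp add: num_big_def)
  next
    case False
    have "?W' \<subseteq> ?W"
    proof
      fix z assume z: "z \<in> ?W'"
      then have "z \<noteq> u" using False d(1) by auto
      then show "z \<in> ?W" using z d(2)[of z] by auto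
    qed
    then show ?thesis unfolding num_big_def using fin by (intro card_mono) auto
  qed
qed

lemma num_big_le: "finite V \<Longrightarrow> num_big V E s \<le> card V"
  unfolding num_big_def by (intro card_mono) auto

lemma num_big_part:
  assumes "finite V" "V1 \<subseteq> V" "\<And>x. x \<in> V1 \<Longrightarrow> deg E1 s1 x \<le> deg E s x"
  shows "num_big V1 E1 s1 \<le> num_big V E s"
  unfolding num_big_def using assms by (intro card_mono) (auto intro: less_le_trans)

section \<open>The derivative of the flow polynomial at 1\<close>

text \<open>Up to sign this is Crapo's beta invariant of the dual of the cycle matroid.\<close>

definition flow_deriv :: "nat set \<Rightarrow> (nat \<Rightarrow> nat \<times> nat) \<Rightarrow> real" where
  "flow_deriv E s = (\<Sum>A\<in>Pow E. (- 1) ^ card (E - A) * real (nullity s A))"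

lemma DERIV_flow: "(flow E s has_real_derivative flow_deriv E s) (at 1)"
proof -
  have "((\<lambda>x. \<Sum>A\<in>Pow E. (- 1) ^ card (E - A) * x ^ nullity s A) has_real_derivative
    (\<Sum>A\<in>Pow E. (- 1) ^ card (E - A) * real (nullity s A))) (at (1::real))"
    by (rule DERIV_sum) (auto intro!: derivative_eq_intros)
  moreover have "flow E s = (\<lambda>x. \<Sum>A\<in>Pow E. (- 1) ^ card (E - A) * x ^ nullity s A)"
    by (simp add: flow_def fun_eq_iff)
  ultimately show ?thesis by (simp add: flow_deriv_def)
qed

lemma flow_at_1: "finite E \<Longrightarrow> E \<noteq> {} \<Longrightarrow> flow E s 1 = 0"
proof -
  assume "finite E" "E \<noteq> {}"
  then obtain e where "e \<in> E" by blast
  then show ?thesis using flow_insert[of "E - {e}" e s 1] \<open>finite E\<close> by (simp add: insert_absorb)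
qed

lemma flow_deriv_contract:
  assumes "finite E" "e \<in> E" "s e = (u, v)" "u \<noteq> v"
  shows "flow_deriv E s = flow_deriv (E - {e}) (ident_ends s u v) - flow_deriv (E - {e}) s"
proof (rule DERIV_unique[OF DERIV_flow])
  have "flow E s = (\<lambda>x. flow (E - {e}) (ident_ends s u v) x - flow (E - {e}) s x)"
    using flow_contract[of E e s u v, OF assms] by (simp add: fun_eq_iff)
  then show "(flow E s has_real_derivative flow_deriv (E - {e}) (ident_ends s u v) - flow_deriv (E -
      {e}) s) (at 1)"
    using DERIV_diff[OF DERIV_flow DERIV_flow] by metis
qed

text \<open>Both factors of a one-vertex sum vanish at 1, so the product rule gives 0. The bound on
  \<open>card E\<close>, one edge from each part, supplies the hypothesis of
  \<open>nonsep_bridgeless\<close> later on.\<close>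

lemma flow_deriv_not_nonsep:
  assumes wf: "graph_on V E s" and c: "conn_on V E s" and n: "\<not> nonsep_on V E s"
  shows "flow_deriv E s = 0" and "2 \<le> card E"
proof -
  obtain V1 V2 E1 E2 w where *: "V1 \<union> V2 = V" "V1 \<inter> V2 = {w}" "E1 \<union> E2 = E" "E1 \<inter> E2 = {}"
    "E1 \<noteq> {}" "E2 \<noteq> {}" "graph_on V1 E1 s" "graph_on V2 E2 s"
    using not_nonsep_one_sum[OF wf c n] by metis
  have fin: "finite E1" "finite E2" using * by (auto simp: graph_on_def)
  have "flow E s = (\<lambda>x. flow E1 s x * flow E2 s x)"
  proof
    fix x
    show "flow E s x = flow E1 s x * flow E2 s x"
      unfolding *(3)[symmetric]
      by (rule flow_one_sum[where ?V1.0 = V1 and ?V2.0 = V2 and w = w])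
        (use * in \<open>auto simp: graph_on_def\<close>)
  qed
  then have "(flow E s has_real_derivative flow_deriv E1 s * flow E2 s 1 +
      flow_deriv E2 s * flow E1 s 1) (at 1)"
    using DERIV_mult[OF DERIV_flow[of E1 s] DERIV_flow[of E2 s]] by simp
  then have "(flow E s has_real_derivative 0) (at 1)" using flow_at_1 fin * by simp
  then show "flow_deriv E s = 0" by (rule DERIV_unique[OF DERIV_flow])
  have "1 \<le> card E1" "1 \<le> card E2" using fin * by (simp_all add: Suc_le_eq card_gt_0_iff)
  then show "2 \<le> card E" using card_Un_disjoint[OF fin *(4)] *(3) by simp
qed

lemma flow_deriv_not_bridgeless:
  assumes "finite E" "\<not> bridgeless_on E s"
  shows "flow_deriv E s = 0"
proof (rule DERIV_unique[OF DERIV_flow])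
  have "flow E s = (\<lambda>x. 0)" using flow_not_bridgeless[OF assms] by (simp add: fun_eq_iff)
  then show "(flow E s has_real_derivative 0) (at 1)" by simp
qed

text \<open>A separable graph contributes nothing, since its flow polynomial has a double root at 1.\<close>
lemma flow_deriv_sign:
  assumes "graph_on V E s" "nonsep_on V E s" "bridgeless_on E s" "E \<noteq> {}"
  shows "0 < (- 1) ^ (card E + card V) * flow_deriv E s"
  using assms
proof (induction "card E" arbitrary: V E s rule: less_induct)
  case less
  have fin: "finite E" "finite V" using less.prems by (auto simp: graph_on_def)
  have c0: "card E \<noteq> 0" using fin less.prems by simp
  show ?case
  proof (cases "card E = 1")
    case True
    then obtain e where E: "E = {e}" by (metis card_1_singletonE)
    have l: "fst (s e) = snd (s e)" using less.prems E by (auto simp: bridgeless_on_def)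
    then have "card V = 1" using less.prems E by (auto simp: nonsep_on_def loopless_def)
    moreover have "flow E s = (\<lambda>x. x - 1)" using flow_loop[of "{}" e s] l E by (simp add: fun_eq_iff)
    then have "(flow E s has_real_derivative 1) (at 1)" by (auto intro!: derivative_eq_intros)
    then have "flow_deriv E s = 1" using DERIV_unique[OF DERIV_flow] by blast
    ultimately show ?thesis using True by simp
  next
    case False
    then have c2: "2 \<le> card E" using c0 by simp
    have loopless: "loopless E s" using less.prems(2) False by (simp add: nonsep_on_def)
    have conn_on: "conn_on V E s" using less.prems(2) by (simp add: nonsep_on_def)
    obtain e where e: "e \<in> E" using less.prems by blast
    obtain u v where uv: "s e = (u, v)" by fastforce
    have uvV: "u \<in> V" "v \<in> V" "u \<noteq> v" using e uv loopless less.prems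
        by (auto simp: graph_on_def loopless_def)
    let ?E = "E - {e}" and ?V = "V - {v}" and ?s = "ident_ends s u v"
    have cE: "card E = Suc (card ?E)" using fin e by (metis card.remove)
    have cV: "card V = Suc (card ?V)" using fin uvV by (metis card.remove)
    have ne: "?E \<noteq> {}"
    proof
      assume "?E = {}"
      then have "card ?E = 0" by (simp only: card.empty)
      then show False using cE c2 by simp
    qed
    have wf1: "graph_on ?V ?E ?s" using graph_ident_ends[OF less.prems(1) uvV(1,3)] by auto
    have wf2: "graph_on V ?E s" using less.prems(1) by (auto simp: graph_on_def)
    have con1: "conn_on ?V ?E ?s" using conn_contract[OF conn_on e uv] uvV by blast
    have con2: "conn_on V ?E s" using conn_del conn_on less.prems(3) by blast
    have br1: "bridgeless_on ?E ?s" using bridgeless_contract[OF less.prems(3) e uv] .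
    let ?D1 = "(- 1) ^ (card ?E + card ?V) * flow_deriv ?E ?s"
        and ?D2 = "(- 1) ^ (card ?E + card V) * flow_deriv ?E s"
    \<comment> \<open>Contraction lowers the exponent by two and deletion by one, which absorbs the
      minus sign. Both terms are nonnegative, and by \<open>nonsep_del_or_contract\<close> one of
      them is positive.\<close>
    have sum: "(- 1) ^ (card E + card V) * flow_deriv E s = ?D1 + ?D2"
      unfolding flow_deriv_contract[of E e s u v, OF fin(1) e uv uvV(3)] cE cV
          by (simp add: algebra_simps)
    have D1: "nonsep_on ?V ?E ?s \<Longrightarrow> 0 < ?D1" using less.hyps[of ?E ?V ?s] cE wf1 br1 ne by simp
    have D2: "nonsep_on V ?E s \<Longrightarrow> bridgeless_on ?E s \<Longrightarrow> 0 < ?D2" using less.hyps[of ?E V s] cE wf2 ne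
        by simp
    have D2': "0 \<le> ?D2"
      using D2 flow_deriv_not_nonsep(1)[OF wf2 con2] flow_deriv_not_bridgeless[of ?E s] fin by fastforce
    show ?thesis
    proof (cases "nonsep_on ?V ?E ?s")
      case True
      then show ?thesis using D1 D2' sum by simp
    next
      case False
      have "nonsep_on V ?E s" using nonsep_del_or_contract[OF less.prems(1,2) loopless e uv False] .
      moreover have "bridgeless_on ?E s" using nonsep_bridgeless[OF wf2 \<open>nonsep_on V ?E s\<close>]
          flow_deriv_not_nonsep(2)[OF wf1 con1 False] by simp
      ultimately have "0 < ?D2" using D2 by blast
      moreover have "?D1 = 0" using flow_deriv_not_nonsep(1)[OF wf1 con1 False] by simp
      ultimately show ?thesis using sum by simp
    qed
  qed
qed

section \<open>The signed flow polynomial and one-vertex sums\<close>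

definition signed_flow :: "nat set \<Rightarrow> nat set \<Rightarrow> (nat \<Rightarrow> nat \<times> nat) \<Rightarrow> real \<Rightarrow> real" where
  "signed_flow V E s x = (- 1) ^ (card E + card V + 1 + nblocks_on V E s) * flow E s x"

lemma signed_flow_nonsep:
  assumes "graph_on V E s" "nonsep_on V E s" "E \<noteq> {}"
  shows "signed_flow V E s x = (- 1) ^ (card E + card V) * flow E s x"
  using nblocks_nonsep[OF assms] by (simp add: signed_flow_def)

text \<open>Edges and blocks add, while one vertex is shared. With the summand 1 in each exponent,
  the exponents of the parts add up to that of the whole plus 2.\<close>

lemma signed_flow_one_sum:
  assumes wf: "graph_on V1 E1 s" "graph_on V2 E2 s" and S: "V1 \<inter> V2 = {w}" and d: "E1 \<inter> E2 = {}"
  shows "signed_flow (V1 \<union> V2) (E1 \<union> E2) s x = signed_flow V1 E1 s x * signed_flow V2 E2 s x"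
proof -
  have fin: "finite V1" "finite V2" "finite E1" "finite E2" using wf by (auto simp: graph_on_def)
  let ?n1 = "card E1 + card V1 + 1 + nblocks_on V1 E1 s"
      and ?n2 = "card E2 + card V2 + 1 + nblocks_on V2 E2 s"
  let ?n = "card (E1 \<union> E2) + card (V1 \<union> V2) + 1 + nblocks_on (V1 \<union> V2) (E1 \<union> E2) s"
  have "card (V1 \<union> V2) + 1 = card V1 + card V2" using card_Un_Int[OF fin(1,2)] S by simp
  moreover have "card (E1 \<union> E2) = card E1 + card E2" using card_Un_disjoint fin d by blast
  moreover have "nblocks_on (V1 \<union> V2) (E1 \<union> E2) s = nblocks_on V1 E1 s + nblocks_on V2 E2 s"
    by (rule nblocks_union[OF wf _ d, of w]) (use S in simp)
  ultimately have "?n1 + ?n2 = ?n + 2" by simp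
  then have "(- 1 :: real) ^ (?n1 + ?n2) = (- 1) ^ (?n + 2)" by (rule arg_cong)
  then have 1: "(- 1 :: real) ^ ?n = (- 1) ^ ?n1 * (- 1) ^ ?n2" unfolding power_add[of _ ?n1] by simp
  have 2: "flow (E1 \<union> E2) s x = flow E1 s x * flow E2 s x"
    by (rule flow_one_sum[where ?V1.0 = V1 and ?V2.0 = V2 and w = w])
      (use wf S d in \<open>auto simp: graph_on_def\<close>)
  show ?thesis unfolding signed_flow_def 1 2 by simp
qed

section \<open>Minimal graphs whose signed flow polynomial is not positive\<close>

lemma flow_loops:
  assumes "finite E" "\<And>e. e \<in> E \<Longrightarrow> fst (s e) = snd (s e)"
  shows "flow E s x = (x - 1) ^ card E"
  using assms by (induction E rule: finite_induct) (simp_all add: flow_loop)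

text \<open>Contracting one edge turns all others into loops, each contributing a factor
  \<open>x - 1\<close>.\<close>

lemma flow_parallel:
  assumes fin: "finite E" and e: "e \<in> E" and ab: "a \<noteq> b"
    and par: "\<And>g. g \<in> E \<Longrightarrow> {fst (s g), snd (s g)} = {a, b}"
  shows "flow E s x = (x - 1) ^ card (E - {e}) - flow (E - {e}) s x"
proof -
  obtain u v where uv: "s e = (u, v)" by fastforce
  have uvab: "(u = a \<and> v = b) \<or> (u = b \<and> v = a)" using par[OF e] uv by (auto simp: doubleton_eq_iff)
  have "flow (E - {e}) (ident_ends s u v) x = (x - 1) ^ card (E - {e})"
  proof (rule flow_loops)
    fix g assume "g \<in> E - {e}"
    then have "{fst (s g), snd (s g)} = {a, b}" using par by simp
    then show "fst (ident_ends s u v g) = snd (ident_ends s u v g)"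
      using uvab by (auto simp: ident_ends_def doubleton_eq_iff)
  qed (use fin in simp)
  then show ?thesis using flow_contract[of E e s u v x, OF fin e uv] uvab ab by auto
qed

lemma nonsep_insert:
  assumes nonsep_on: "nonsep_on V E s" and loopless: "loopless E s" and f: "fst (s f) \<noteq> snd (s f)"
  shows "nonsep_on V (insert f E) s"
proof -
  have "avoid E s v \<subseteq> avoid (insert f E) s v" for v by (auto simp: avoid_def)
  moreover have "E \<subseteq> insert f E" by auto
  moreover have "loopless (insert f E) s" using loopless f by (auto simp: loopless_def)
  ultimately show ?thesis using nonsep_on unfolding nonsep_on_def conn_on_def by (meson linked_mono)
qed

text \<open>Contracting \<open>g\<close> makes \<open>f\<close> a loop; without this loop the result
  is also what contracting \<open>f\<close> gives. The coefficient \<open>x - 2\<close> is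
  \<open>x - 1\<close> from the loop minus 1 from deleting \<open>g\<close>.\<close>

lemma flow_insert_two:
  assumes fin: "finite E" and f: "f \<notin> E" "g \<notin> insert f E" "s f = (a, b)" "s g = (a, b)" "a \<noteq> b"
  shows "flow (insert g (insert f E)) s x = (x - 1) * flow E s x + (x - 2) * flow (insert f E) s x"
proof -
  have 1: "flow (insert f E) (ident_ends s a b) x = flow (insert g (insert f E)) s x +
      flow (insert f E) s x"
    by (rule flow_identify) (use assms in \<open>auto simp: ident_ends_def\<close>)
  have 2: "flow E (ident_ends s a b) x = flow (insert f E) s x + flow E s x"
    by (rule flow_identify) (use assms in \<open>auto simp: ident_ends_def\<close>)
  have 3: "flow (insert f E) (ident_ends s a b) x = (x - 1) * flow E (ident_ends s a b) x"
    by (rule flow_loop) (use assms in \<open>auto simp: ident_ends_def\<close>)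
  show ?thesis using 1 unfolding 3 2 by (simp add: algebra_simps)
qed

locale minimal_bad =
  fixes V E :: "nat set" and s :: "nat \<Rightarrow> nat \<times> nat" and x :: real and k :: nat
  assumes wf: "graph_on V E s" and conn_on: "conn_on V E s" and bridgeless_on: "bridgeless_on E s"
      and wck: "num_big V E s \<le> k"
    and k: "1 \<le> k" and x1: "1 < x" and x2: "x < 2"
    and bad: "\<not> 0 < signed_flow V E s x"
    and IH: "\<And>V' E' s'. graph_on V' E' s' \<Longrightarrow> conn_on V' E' s' \<Longrightarrow> bridgeless_on E' s' \<Longrightarrow>
        num_big V' E' s' \<le> k \<Longrightarrow>
      card E' < card E \<Longrightarrow> 0 < signed_flow V' E' s' x"
begin

text \<open>A graph with a bridge has flow polynomial 0, so a weak inequality also covers smaller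
  graphs that may have bridges, such as the sides of a 2-sum.\<close>

lemma smaller_nonneg:
  assumes "graph_on V' E' s'" "conn_on V' E' s'" "num_big V' E' s' \<le> k" "card E' < card E"
  shows "0 \<le> signed_flow V' E' s' x"
  using IH[OF assms(1,2) _ assms(3,4)] flow_not_bridgeless[of E' s' x] assms(1)
  by (cases "bridgeless_on E' s'") (auto simp: signed_flow_def graph_on_def)

lemma fin: "finite V" "finite E"
  using wf by (auto simp: graph_on_def)

lemma nonsep: "nonsep_on V E s"
proof (rule ccontr)
  assume "\<not> nonsep_on V E s"
  then obtain V1 V2 E1 E2 w where *: "V1 \<union> V2 = V" "V1 \<inter> V2 = {w}" "E1 \<union> E2 = E" "E1 \<inter> E2 = {}"
    "E1 \<noteq> {}" "E2 \<noteq> {}" "graph_on V1 E1 s" "graph_on V2 E2 s"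
    using not_nonsep_one_sum[OF wf conn_on] by metis
  have pos: "0 < signed_flow V' E' s x"
    if 1: "V' \<union> V'' = V" "V'' \<inter> V' = {w}" "E'' \<union> E' = E" "E'' \<inter> E' = {}"
      "E'' \<noteq> {}" "graph_on V' E' s" "graph_on V'' E'' s" for V' V'' E' E''
  proof (rule IH)
    show "conn_on V' E' s"
      by (rule conn_part[OF conn_on that(3)[symmetric], of V' V'' w])
          (use that in \<open>auto simp: graph_on_def\<close>)
    show "bridgeless_on E' s"
      by (rule bridgeless_part[OF bridgeless_on that(3)[symmetric] that(4), of V'' V' w])
          (use that in \<open>auto simp: graph_on_def\<close>)
    have "num_big V' E' s \<le> num_big V E s"
      by (rule num_big_part) (use fin 1 deg_mono in auto)
    then show "num_big V' E' s \<le> k" using wck by simp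
    show "card E' < card E"
      by (rule psubset_card_mono) (use 1 fin in auto)
  qed (rule 1)
  have "0 < signed_flow V1 E1 s x" by (rule pos[of V1 V2 E2 E1]) (use * in auto)
  moreover have "0 < signed_flow V2 E2 s x" by (rule pos[of V2 V1 E1 E2]) (use * in auto)
  ultimately show False
    using bad signed_flow_one_sum[OF *(7,8,2,4), of x] * by simp
qed

lemma E_ne: "E \<noteq> {}"
proof
  assume E: "E = {}"
  obtain v where v: "v \<in> V" using conn_on by (auto simp: conn_on_def)
  have "V = {v}"
    using conn_on v unfolding E conn_on_def by auto
  \<comment> \<open>The exponent is \<open>0 + 1 + 1 + 0\<close> and the flow polynomial is
    1.\<close>
  then show False using bad nblocks_empty[OF fin(1), of s] E by (simp add: signed_flow_def)
qed

lemma signed_flow_eq: "signed_flow V E s x = (- 1) ^ (card E + card V) * flow E s x"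
  by (rule signed_flow_nonsep[OF wf nonsep E_ne])

lemma loopless: "loopless E s"
proof (rule ccontr)
  assume n: "\<not> loopless E s"
  then have c: "card V = 1" "card E = 1" using nonsep by (auto simp: nonsep_on_def)
  then obtain e where e: "E = {e}" by (metis card_1_singletonE)
  then have "flow E s x = (x - 1) ^ card E"
    using n fin by (intro flow_loops) (auto simp: loopless_def)
  then show False using bad x1 c by (simp add: signed_flow_eq)
qed

lemma edge_ends:
  assumes "e \<in> E" "s e = (u, v)"
  shows "u \<in> V" "v \<in> V" "u \<noteq> v"
  using assms wf loopless by (auto simp: graph_on_def loopless_def)

lemma card_del:
  assumes "e \<in> E"
  shows "card E = Suc (card (E - {e}))"
  using fin assms by (metis card.remove)

lemma contract_sign:
  assumes e: "e \<in> E" "s e = (u, v)"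
  shows "signed_flow V E s x =
    - ((- 1) ^ nblocks_on (V - {v}) (E - {e}) (ident_ends s u v)) * signed_flow (V - {v}) (E - {e})
        (ident_ends s u v) x
    - (- 1) ^ nblocks_on V (E - {e}) s * signed_flow V (E - {e}) s x"
proof -
  have cV: "card V = Suc (card (V - {v}))" using fin edge_ends[OF e] by (metis card.remove)
  have 1: "flow E s x = flow (E - {e}) (ident_ends s u v) x - flow (E - {e}) s x"
    using flow_contract[of E e s u v x] fin e edge_ends by blast
  show ?thesis unfolding signed_flow_eq 1 unfolding signed_flow_def card_del[OF e(1)] cV
    by (cases "even (nblocks_on (V - {v}) (E - {e}) (ident_ends s u v))";
        cases "even (nblocks_on V (E - {e}) s)")
      (simp_all add: power_add algebra_simps)
qed

lemma contract_pos:
  assumes e: "e \<in> E" "s e = (u, v)" and w: "num_big (V - {v}) (E - {e}) (ident_ends s u v) \<le> k"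
  shows "0 < signed_flow (V - {v}) (E - {e}) (ident_ends s u v) x"
proof (rule IH[OF _ _ _ w])
  show "graph_on (V - {v}) (E - {e}) (ident_ends s u v)" using graph_ident_ends[OF wf] edge_ends[OF e]
      by auto
  show "conn_on (V - {v}) (E - {e}) (ident_ends s u v)"
      using conn_contract[OF conn_on e] edge_ends[OF e] by auto
  show "bridgeless_on (E - {e}) (ident_ends s u v)" using bridgeless_contract[OF bridgeless_on e] .
  show "card (E - {e}) < card E" using card_del[OF e(1)] by simp
qed

lemma not_linked_isolated:
  assumes "p \<noteq> q" "\<And>g. g \<in> A \<Longrightarrow> fst (s g) \<noteq> p \<and> snd (s g) \<noteq> p"
  shows "\<not> linked s A p q" "\<not> linked s A q p"
  using linked_isolated[of s A p q] linked_sym[of s A q p] assms by auto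

definition incident :: "nat \<Rightarrow> nat set" where
  "incident z = {g\<in>E. fst (s g) = z \<or> snd (s g) = z}"

lemma deg_incident: "deg E s z = card (incident z)"
  unfolding incident_def by (rule deg_loopless[OF fin(2) loopless])

lemma incident_ne:
  assumes "z \<in> V"
  shows "incident z \<noteq> {}"
proof -
  obtain e where e: "e \<in> E" using E_ne by blast
  obtain u v where uv: "s e = (u, v)" by fastforce
  have "\<exists>y\<in>V. y \<noteq> z" using edge_ends[OF e uv] by metis
  then show ?thesis using conn_edge_at[OF conn_on assms] by (auto simp: incident_def)
qed

text \<open>Deleting an edge \<open>e\<close> at a vertex of degree 2 turns the second edge there
  into a bridge, and at a vertex of degree 1 the edge is a bridge already. So \<open>G - e\<close>
  contributes 0, while \<open>G/e\<close> must be a single block, and \<open>Q(G)\<close> equals the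
  positive \<open>Q(G/e)\<close>.\<close>

lemma min_degree:
  assumes z: "z \<in> V"
  shows "3 \<le> deg E s z"
proof (rule ccontr)
  assume n: "\<not> 3 \<le> deg E s z"
  then have i2: "card (incident z) \<le> 2" using deg_incident by simp
  obtain e where e: "e \<in> incident z" using incident_ne[OF z] by blast
  obtain u v where uv: "s e = (u, v)" by fastforce
  have eE: "e \<in> E" and zuv: "z = u \<or> z = v" using e uv by (auto simp: incident_def)
  note uvV = edge_ends[OF eE uv]
  have ifin: "finite (incident z)" using fin by (simp add: incident_def)
  have nbr: "\<not> bridgeless_on (E - {e}) s"
  proof (cases "incident z = {e}")
    case True
    have I: "fst (s g) \<noteq> z \<and> snd (s g) \<noteq> z" if "g \<in> E - {e}" for g
      using True that unfolding incident_def by blast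
    have "\<not> linked s (E - {e}) z y" "\<not> linked s (E - {e}) y z" if "y \<noteq> z" for y
      using not_linked_isolated[OF that[symmetric], of "E - {e}"] I by blast+
    then have False using bridgeless_on eE uv uvV zuv by (auto simp: bridgeless_on_def)
    then show ?thesis ..
  next
    case False
    then obtain g where g: "g \<in> incident z" "g \<noteq> e" using e by blast
    then have "card (incident z - {e, g}) = card (incident z) - 2" using ifin e
        by (simp add: card_Diff_subset)
    then have "incident z - {e, g} = {}" using i2 ifin by (metis card_0_eq diff_is_0_eq finite_Diff)
    then have I: "fst (s d) \<noteq> z \<and> snd (s d) \<noteq> z" if "d \<in> E - {e} - {g}" for d
      using that unfolding incident_def by blast
    have "\<not> linked s (E - {e} - {g}) z y" "\<not> linked s (E - {e} - {g}) y z" if "y \<noteq> z" for y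
      using not_linked_isolated[OF that[symmetric], of "E - {e} - {g}"] I by blast+
    then have "\<not> linked s (E - {e} - {g}) (fst (s g)) (snd (s g))"
      using g loopless unfolding incident_def loopless_def by (metis (mono_tags, lifting) mem_Collect_eq)
    then show ?thesis using g unfolding bridgeless_on_def incident_def by blast
  qed
  let ?V = "V - {v}" and ?E = "E - {e}" and ?s = "ident_ends s u v"
  have wf1: "graph_on ?V ?E ?s" using graph_ident_ends[OF wf] uvV by auto
  have con1: "conn_on ?V ?E ?s" using conn_contract[OF conn_on eE uv] uvV by auto
  have ns1: "nonsep_on ?V ?E ?s"
  proof (rule ccontr)
    assume a: "\<not> nonsep_on ?V ?E ?s"
    have "nonsep_on V ?E s" by (rule nonsep_del_or_contract[OF wf nonsep loopless eE uv a])
    moreover have "graph_on V ?E s" using wf by (auto simp: graph_on_def)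
    ultimately show False using nonsep_bridgeless flow_deriv_not_nonsep(2)[OF wf1 con1 a] nbr by blast
  qed
  \<comment> \<open>A merged vertex of degree above 3 needs a degree sum of at least 6, of which
    \<open>z\<close> supplies at most 2, so the other end is large already.\<close>
  have "num_big ?V ?E ?s \<le> num_big V E s"
    by (rule num_big_contract(2)[OF wf eE uv uvV(3)]) (use n zuv in auto)
  then have pos: "0 < signed_flow ?V ?E ?s x" using contract_pos[OF eE uv] wck by simp
  have ne: "?E \<noteq> {}" using nbr by (auto simp: bridgeless_on_def)
  have "flow ?E s x = 0" using flow_not_bridgeless[OF _ nbr] fin by simp
  then have "signed_flow V E s x = - ((- 1) ^ nblocks_on ?V ?E ?s) * signed_flow ?V ?E ?s x"
    using contract_sign[OF eE uv] by (simp add: signed_flow_def)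
  then show False using bad pos nblocks_nonsep[OF wf1 ns1 ne] by simp
qed

text \<open>The parts \<open>G1 + f\<close> and \<open>G2 + f\<close> of the 2-sum are again non-separable, in the same class and smaller
  than \<open>G\<close>, because both sides have at least two edges.\<close>
lemma two_sum_half:
  assumes V: "V1 \<union> V2 = V" "V1 \<inter> V2 = {a, b}" "a \<noteq> b" and E: "E1 \<union> E2 = E" "E1 \<inter> E2 = {}"
    and wf1: "graph_on V1 E1 s" and wf2: "graph_on V2 E2 s" and c: "2 \<le> card E1" "2 \<le> card E2"
    and f: "f \<notin> E" and s': "s' = s(f := (a, b))"
  shows "conn_on V1 E1 s"
    and "0 < (- 1) ^ (card E1 + 1 + card V1) * flow (insert f E1) s' x"
    and "graph_on V1 (insert f E1) s'" "nonsep_on V1 (insert f E1) s'"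
proof -
  have fe: "f \<notin> E1" "f \<notin> E2" using f E by auto
  have cg: "s g = s' g" if "g \<in> E" for g using that f s' by auto
  have cg1: "s g = s' g" if "g \<in> E1" for g using cg E that by auto
  have cg2: "s g = s' g" if "g \<in> E2" for g using cg E that by auto
  have sf: "s' f = (a, b)" using s' by simp
  have ns': "nonsep_on V E s'" using nonsep_cong[of E s s' V] cg nonsep by blast
  have ll': "loopless E s'" using loopless cg by (simp add: loopless_def)
  have wf1': "graph_on V1 E1 s'" using graph_cong[of E1 s s' V1] cg1 wf1 by blast
  have wf2': "graph_on V2 E2 s'" using graph_cong[of E2 s s' V2] cg2 wf2 by blast
  have ne1: "E1 \<noteq> {}" and ne2: "E2 \<noteq> {}" using c by auto
  have finp: "finite E1" "finite E2" using wf1 wf2 by (auto simp: graph_on_def)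
  have con1: "conn_on V1 E1 s'"
    by (rule conn_two_sum_part[OF ns' ll' E(1) ne1 wf1' wf2' V(1) V(2,3) sf])
  then show "conn_on V1 E1 s" using linked_cong[of E1 s s'] cg1 by (simp add: conn_on_def)
  have con2: "conn_on V2 E2 s'"
    by (rule conn_two_sum_part[OF ns' ll' _ ne2 wf2' wf1' _ _ V(3) sf]) (use V E in auto)
  show nsf: "nonsep_on V1 (insert f E1) s'"
    by (rule nonsep_two_sum_part[OF ns' ll' E(1) wf1' wf2' V(1) V(2,3) sf])
  show wff: "graph_on V1 (insert f E1) s'" using wf1' sf V by (auto simp: graph_on_def)
  have cf: "card (insert f E1) = card E1 + 1" using fe finp by simp
  have "num_big V1 (insert f E1) s' \<le> num_big V E s"
  proof (rule num_big_part)
    fix y assume "y \<in> V1"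
    have "deg (insert f E1) s' y = deg E1 s' y + (if a = y then 1 else 0) + (if b = y then 1 else 0)"
      using deg_insert[OF finp(1) fe(1), of s' y] sf by simp
    moreover have "deg E s y = deg E1 s' y + deg E2 s' y"
      using deg_Un[OF finp E(2), of s' y] deg_cong[of E s s' y] cg E by auto
    moreover have "y \<in> {a, b} \<Longrightarrow> 0 < deg E2 s' y"
    proof -
      assume y: "y \<in> {a, b}"
      then obtain q where "q \<in> {a, b}" "q \<noteq> y" using V(3) by auto
      then have "\<exists>e\<in>E2. fst (s' e) = y \<or> snd (s' e) = y"
        using conn_edge_at[OF con2, of y q] V y by auto
      then show ?thesis using deg_pos[OF finp(2)] by blast
    qed
    ultimately show "deg (insert f E1) s' y \<le> deg E s y" using V(3) by auto
  qed (use fin V in auto)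
  moreover have "bridgeless_on (insert f E1) s'" using nonsep_bridgeless[OF wff nsf] cf c by simp
  moreover have "card (insert f E1) < card E"
    using cf c card_Un_disjoint[OF finp E(2)] E by simp
  ultimately have "0 < signed_flow V1 (insert f E1) s' x"
    using IH[OF wff] nsf wck by (simp add: nonsep_on_def)
  then show "0 < (- 1) ^ (card E1 + 1 + card V1) * flow (insert f E1) s' x"
    using signed_flow_nonsep[OF wff nsf, of x] cf by simp
qed

text \<open>The inequality is the 2-sum formula times \<open>x - 1\<close> and the sign of
  \<open>Q(G)\<close>. The sides with \<open>f\<close> added are single blocks, so their signs are
  known; the bare sides may be separable, and their signs are left to
  \<open>two_sum_parity\<close>.\<close>

lemma two_sum:
  assumes V: "V1 \<union> V2 = V" "V1 \<inter> V2 = {a, b}" "a \<noteq> b" and E: "E1 \<union> E2 = E" "E1 \<inter> E2 = {}"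
    and wf1: "graph_on V1 E1 s" and wf2: "graph_on V2 E2 s" and c: "2 \<le> card E1" "2 \<le> card E2"
    and f: "f \<notin> E" and s': "s' = s(f := (a, b))"
  shows "conn_on V1 E1 s"
    and "conn_on V2 E2 s"
    and "0 < (- 1) ^ (card E1 + 1 + card V1) * flow (insert f E1) s' x"
    and "0 < (- 1) ^ (card E2 + 1 + card V2) * flow (insert f E2) s' x"
    and "(x - 1) * ((- 1) ^ (card E + card V) * flow E1 s x * flow E2 s x) +
      ((- 1) ^ (card E1 + 1 + card V1) * flow (insert f E1) s' x) *
      ((- 1) ^ (card E2 + 1 + card V2) * flow (insert f E2) s' x) \<le> 0"
    and "card E = card E1 + card E2" "card V + 2 = card V1 + card V2"
proof -
  let ?Z1 = "(- 1) ^ (card E1 + 1 + card V1) * flow (insert f E1) s' x"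
  let ?Z2 = "(- 1) ^ (card E2 + 1 + card V2) * flow (insert f E2) s' x"
  have V': "V2 \<union> V1 = V" "V2 \<inter> V1 = {a, b}" and E': "E2 \<union> E1 = E" "E2 \<inter> E1 = {}" using V E by auto
  note h1 = two_sum_half[OF V E wf1 wf2 c f s']
  note h2 = two_sum_half[OF V' V(3) E' wf2 wf1 c(2,1) f s']
  have fe: "f \<notin> E1" "f \<notin> E2" using f E by auto
  have finp: "finite E1" "finite E2" "finite V1" "finite V2" using wf1 wf2 by (auto simp: graph_on_def)
  show cE: "card E = card E1 + card E2" using card_Un_disjoint[OF finp(1,2) E(2)] E by simp
  show cV: "card V + 2 = card V1 + card V2" using card_Un_Int[OF finp(3,4)] V by simp
  have "(x - 1) * flow (E1 \<union> E2) s' x = (x - 1) * flow E1 s' x * flow E2 s' x +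
    flow (insert f E1) s' x * flow (insert f E2) s' x"
    by (rule flow_two_sum[where ?V1.0 = V1 and ?V2.0 = V2 and u = a and v = b])
      (use finp E V fe wf1 wf2 s' in \<open>auto simp: graph_on_def\<close>)
  moreover have "flow E s' x = flow E s x" "flow E1 s' x = flow E1 s x" "flow E2 s' x = flow E2 s x"
    using f fe s' by (auto intro!: flow_cong)
  ultimately have fl: "(x - 1) * flow E s x = (x - 1) * flow E1 s x * flow E2 s x +
    flow (insert f E1) s' x * flow (insert f E2) s' x"
    using E by simp
  let ?p = "(- 1 :: real) ^ (card E + card V)"
  have "(card E1 + 1 + card V1) + (card E2 + 1 + card V2) = (card E + card V) + 4"
    using cE cV by simp
  then have "(- 1 :: real) ^ ((card E1 + 1 + card V1) + (card E2 + 1 + card V2)) = (- 1) ^ ((card E +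
      card V) + 4)"
    by (rule arg_cong)
  then have pp: "(- 1 :: real) ^ (card E1 + 1 + card V1) * (- 1) ^ (card E2 + 1 + card V2) = ?p"
    unfolding power_add[of _ "card E1 + 1 + card V1"] by (simp add: power_add[of _ _ 4])
  have "(x - 1) * (?p * flow E s x) = ?p * ((x - 1) * flow E s x)" by simp
  also have "\<dots> = (x - 1) * (?p * flow E1 s x * flow E2 s x) +
      ?p * (flow (insert f E1) s' x * flow (insert f E2) s' x)"
    unfolding fl by (simp add: algebra_simps)
  also have "?p * (flow (insert f E1) s' x * flow (insert f E2) s' x) = ?Z1 * ?Z2"
    unfolding pp[symmetric] by simp
  finally have "(x - 1) * (?p * flow E s x) = (x - 1) * (?p * flow E1 s x * flow E2 s x) + ?Z1 * ?Z2" .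
  moreover have "(x - 1) * (?p * flow E s x) \<le> 0"
    using mult_nonneg_nonpos[of "x - 1" "?p * flow E s x"] bad x1 unfolding signed_flow_eq by simp
  ultimately show "(x - 1) * (?p * flow E1 s x * flow E2 s x) + ?Z1 * ?Z2 \<le> 0" by simp
  show "conn_on V1 E1 s" "conn_on V2 E2 s" "0 < ?Z1" "0 < ?Z2" using h1 h2 by blast+
qed

lemma fresh: obtains f where "f \<notin> E"
  using fin(2) ex_new_if_finite[OF infinite_UNIV_nat] by blast

text \<open>If \<open>w\<close> separates the ends of \<open>e\<close> in \<open>G - e\<close>, then
  \<open>G\<close> is a 2-sum at \<open>u\<close> and \<open>w\<close> in which one side has
  \<open>e\<close> as a bridge, all other edges at \<open>u\<close> being on the opposite side. The
  product of the bare sides vanishes and only a positive product remains.\<close>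

lemma nonsep_del:
  assumes e: "e \<in> E"
  shows "nonsep_on V (E - {e}) s"
proof (rule ccontr)
  assume n: "\<not> nonsep_on V (E - {e}) s"
  obtain u v where uv: "s e = (u, v)" by fastforce
  note uvV = edge_ends[OF e uv]
  have "linked s (E - {e}) (fst (s e)) (snd (s e))" using bridgeless_on e
      by (auto simp: bridgeless_on_def)
  then obtain w where w: "w \<in> V" "w \<noteq> u" "w \<noteq> v" "\<not> linked s (avoid (E - {e}) s w) u v"
    using nonsep_del_replace[OF nonsep loopless e] n uv by auto
  let ?A = "avoid (E - {e}) s w"
  define D where "D = {d. linked s ?A u d}"
  have uD: "u \<in> D" and vD: "v \<notin> D" using w by (auto simp: D_def)
  have wD: "w \<notin> D"
    using not_linked_isolated(2)[of w u ?A] w by (auto simp: D_def avoid_def)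
  have DV: "D \<subseteq> V"
  proof
    fix d assume "d \<in> D"
    then have "linked s ?A u d" by (simp add: D_def)
    then show "d \<in> V"
      by (rule linked_closed) (use uvV wf in \<open>auto simp: graph_on_def avoid_def\<close>)
  qed
  have cl: "fst (s g) \<in> D \<longleftrightarrow> snd (s g) \<in> D" if "g \<in> E" "g \<noteq> e" "fst (s g) \<noteq> w" "snd (s g) \<noteq> w" for g
  proof -
    have "linked s ?A (fst (s g)) (snd (s g))" using that by (intro linked_edge) (simp add: avoid_def)
    then show ?thesis unfolding D_def mem_Collect_eq using linked_trans linked_sym by blast
  qed
  define E1 where "E1 = {g\<in>E - {e}. fst (s g) \<in> D \<or> snd (s g) \<in> D}"
  define V1 where "V1 = insert w D"
  define V2 where "V2 = insert u (V - D)"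
  have finD: "finite D" using DV fin finite_subset by blast
  have wf1: "graph_on V1 E1 s"
    using fin finD cl wD by (auto simp: graph_on_def E1_def V1_def)
  have wf2: "graph_on V2 (E - E1) s"
    using fin wf uv vD uvV by (auto simp: graph_on_def E1_def V2_def)
  have VV: "V1 \<union> V2 = V" "V1 \<inter> V2 = {u, w}"
    using DV w uvV uD wD by (auto simp: V1_def V2_def)
  have iu: "incident u - {e} \<subseteq> E1" using uD by (auto simp: incident_def E1_def)
  \<comment> \<open>Minimum degree 3 at \<open>u\<close> and at \<open>v\<close> provides the two
    edges on each side that the 2-sum requires.\<close>
  have "3 \<le> card (incident u)" using min_degree[OF uvV(1)] deg_incident by simp
  moreover have fi: "finite (incident z)" for z using fin by (simp add: incident_def)
  moreover have "e \<in> incident u" using e uv by (simp add: incident_def)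
  ultimately have "2 \<le> card (incident u - {e})" by simp
  then have c1: "2 \<le> card E1" using card_mono[OF _ iu] fin by (simp add: E1_def)
  have iv: "incident v \<subseteq> E - E1"
  proof
    fix g assume g: "g \<in> incident v"
    have "g \<notin> E1"
    proof
      assume "g \<in> E1"
      then have "g \<in> E" "g \<noteq> e" "(fst (s g) = v \<and> snd (s g) \<in> D) \<or> (snd (s g) = v \<and> fst (s g) \<in> D)"
        using g vD by (auto simp: E1_def incident_def)
      then show False using cl[of g] vD wD w(3) by metis
    qed
    then show "g \<in> E - E1" using g by (simp add: incident_def)
  qed
  have "3 \<le> card (incident v)" using min_degree[OF uvV(2)] deg_incident by simp
  then have c2: "2 \<le> card (E - E1)" using card_mono[OF _ iv] fin by simp
  have "\<not> linked s (E - E1 - {e}) u v"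
    by (rule not_linked_isolated(1)[OF uvV(3)]) (use uD in \<open>auto simp: E1_def\<close>)
  moreover have "e \<in> E - E1" using e by (simp add: E1_def)
  ultimately have "\<not> bridgeless_on (E - E1) s" using uv unfolding bridgeless_on_def
      by (metis fst_conv snd_conv)
  then have 0: "flow (E - E1) s x = 0" using flow_not_bridgeless fin by simp
  obtain f where f: "f \<notin> E" by (rule fresh)
  have EE: "E1 \<union> (E - E1) = E" "E1 \<inter> (E - E1) = {}" by (auto simp: E1_def)
  have uw: "u \<noteq> w" using w by simp
  note ts = two_sum[OF VV uw EE wf1 wf2 c1 c2 f refl]
  show False using ts(5) mult_pos_pos[OF ts(3,4)] unfolding 0 by simp
qed

lemma card_E: "3 \<le> card E"
proof -
  obtain z where z: "z \<in> V" using conn_on by (auto simp: conn_on_def)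
  have "card (incident z) \<le> card E" using fin by (intro card_mono) (auto simp: incident_def)
  then show ?thesis using min_degree[OF z] deg_incident by simp
qed

lemma nblocks_del: "e \<in> E \<Longrightarrow> nblocks_on V (E - {e}) s = 1"
proof (rule nblocks_nonsep[OF _ nonsep_del])
  assume e: "e \<in> E"
  show "graph_on V (E - {e}) s" using wf by (auto simp: graph_on_def)
  show "E - {e} \<noteq> {}"
  proof
    assume "E - {e} = {}"
    then have "card (E - {e}) = 0" by (simp only: card.empty)
    then show False using card_E card_del[OF e] by simp
  qed
qed

lemma del_pos:
  assumes e: "e \<in> E"
  shows "0 < signed_flow V (E - {e}) s x"
proof (rule IH)
  show w: "graph_on V (E - {e}) s" using wf by (auto simp: graph_on_def)
  show "conn_on V (E - {e}) s" using conn_del conn_on bridgeless_on by blast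
  show "bridgeless_on (E - {e}) s" using nonsep_bridgeless[OF w nonsep_del[OF e]] card_E card_del[OF
      e] by simp
  have "num_big V (E - {e}) s \<le> num_big V E s"
    by (rule num_big_part) (use fin deg_mono in auto)
  then show "num_big V (E - {e}) s \<le> k" using wck by simp
  show "card (E - {e}) < card E" using card_del[OF e] by simp
qed

text \<open>\<open>G - e\<close> is one block, so its term is positive, and an odd number of blocks
  of \<open>G/e\<close> would make the other term positive too. The bound on \<open>num_big\<close>
  is a hypothesis because \<open>degree_ge_4\<close> uses this before \<open>card_V\<close> is
  available.\<close>

lemma even_nblocks_contract:
  assumes e: "e \<in> E" "s e = (u, v)" and w: "num_big (V - {v}) (E - {e}) (ident_ends s u v) \<le> k"
  shows "even (nblocks_on (V - {v}) (E - {e}) (ident_ends s u v))"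
proof (rule ccontr)
  assume "\<not> ?thesis"
  then have "0 < signed_flow V E s x"
    unfolding contract_sign[OF e] nblocks_del[OF e(1)] using contract_pos[OF e w] del_pos[OF e(1)]
        by simp
  then show False using bad by simp
qed

text \<open>An edge \<open>e\<close> at a vertex of degree 3 contracts to a single block by
  \<open>nonsep_contract_cubic\<close>, against the even parity. It remains to choose
  \<open>e\<close> such that the contraction stays in the class.\<close>

lemma degree_ge_4:
  assumes z: "z \<in> V"
  shows "4 \<le> deg E s z"
proof (rule ccontr)
  assume n: "\<not> 4 \<le> deg E s z"
  then have n3: "deg E s z \<le> 3" by simp
  \<comment> \<open>Some edge on a path from a large vertex to \<open>z\<close> joins a large to a
    small vertex; contracting it gives no more large vertices. If there is no large vertex, any edge
    at \<open>z\<close> will do, since one new large vertex is allowed.\<close>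
  have "\<exists>e\<in>E. \<exists>p q. {fst (s e), snd (s e)} = {p, q} \<and> deg E s p \<le> 3 \<and> (3 < deg E s q \<or>
      num_big V E s = 0)"
  proof (cases "\<exists>y\<in>V. 3 < deg E s y")
    case True
    then obtain y where y: "y \<in> V" "3 < deg E s y" by blast
    have "\<exists>e\<in>E. \<not> (fst (s e) \<in> {d. 3 < deg E s d} \<longleftrightarrow> snd (s e) \<in> {d. 3 < deg E s d})"
    proof (rule ccontr)
      assume a: "\<not> ?thesis"
      have "linked s E y z" using conn_on y z by (simp add: conn_on_def)
      then have "z \<in> {d. 3 < deg E s d}"
        by (rule linked_closed) (use y a in auto)
      then show False using n by simp
    qed
    then obtain e where e: "e \<in> E" "(3 < deg E s (fst (s e))) \<noteq> (3 < deg E s (snd (s e)))" by auto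
    then show ?thesis by (metis insert_commute not_le)
  next
    case False
    then have "{y\<in>V. 3 < deg E s y} = {}" by blast
    then have "num_big V E s = 0" unfolding num_big_def by (simp only: card.empty)
    moreover obtain e where e: "e \<in> incident z" using incident_ne[OF z] by blast
    moreover have "\<exists>q. {fst (s e), snd (s e)} = {z, q}" "e \<in> E" using e by (auto simp: incident_def)
    ultimately show ?thesis using n3 by blast
  qed
  then obtain e p q where e: "e \<in> E" "{fst (s e), snd (s e)} = {p, q}" "deg E s p \<le> 3"
    "3 < deg E s q \<or> num_big V E s = 0" by blast
  obtain u v where uv: "s e = (u, v)" by fastforce
  note uvV = edge_ends[OF e(1) uv]
  have pq: "(p = u \<and> q = v) \<or> (p = v \<and> q = u)" using e(2) uv by (auto simp: doubleton_eq_iff)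
  have ifin: "finite (incident p)" using fin by (simp add: incident_def)
  have "p \<in> V" using pq uvV by auto
  then have i3: "card (incident p) = 3" using min_degree[of p] e(3) deg_incident[of p] by simp
  have ei: "e \<in> incident p" using e(1) uv pq by (auto simp: incident_def)
  have "card (incident p - {e}) = 2" using i3 ei ifin by simp
  then obtain g h where gh: "incident p - {e} = {g, h}" "g \<noteq> h" by (meson card_2_iff)
  have ipe: "incident p = {e, g, h}" using gh ei by auto
  have ghE: "g \<in> E" "h \<in> E" "g \<noteq> e" "h \<noteq> e" using gh by (auto simp: incident_def)
  show False
  proof (cases "V \<subseteq> {u, v}")
    case False
    then obtain c where c: "c \<in> V" "c \<notin> {u, v}" by blast
    have ns1: "nonsep_on (V - {v}) (E - {e}) (ident_ends s u v)"
      by (rule nonsep_contract_cubic[OF wf nonsep loopless e(1) uv pq ghE _ nonsep_del[OF ghE(1)]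
          nonsep_del[OF ghE(2)] c])
        (use ipe in \<open>auto simp: incident_def\<close>)
    have wf1: "graph_on (V - {v}) (E - {e}) (ident_ends s u v)" using graph_ident_ends[OF wf] uvV by auto
    have "nblocks_on (V - {v}) (E - {e}) (ident_ends s u v) = 1"
      by (rule nblocks_nonsep[OF wf1 ns1]) (use ghE in auto)
    moreover have "num_big (V - {v}) (E - {e}) (ident_ends s u v) \<le> k"
    proof (cases "num_big V E s = 0")
      case True
      then show ?thesis using num_big_contract(1)[OF wf e(1) uv uvV(3)] k by simp
    next
      case False
      have "num_big (V - {v}) (E - {e}) (ident_ends s u v) \<le> num_big V E s"
        by (rule num_big_contract(2)[OF wf e(1) uv uvV(3)]) (use e(4) False pq in auto)
      then show ?thesis using wck by simp
    qed
    ultimately show False using even_nblocks_contract[OF e(1) uv] by simp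
  next
    case True
    \<comment> \<open>Three parallel edges are left: \<open>(x - 1) * (x - 2)\<close> is negative
      below 2 and the exponent \<open>3 + 2\<close> is odd.\<close>
    then have V: "V = {u, v}" using uvV by auto
    have par: "{fst (s d), snd (s d)} = {u, v}" if "d \<in> E" for d
    proof -
      obtain a b where ab: "s d = (a, b)" by fastforce
      show ?thesis using edge_ends[OF that ab] V ab by auto
    qed
    then have "incident p = E" using pq by (auto simp: incident_def doubleton_eq_iff)
    then have E: "E = {e, g, h}" using ipe by simp
    have 3: "flow {h} s x = 0"
      using flow_parallel[of "{h}" h u v s x] par uvV E by simp
    have "{g, h} - {g} = {h}" using gh by auto
    then have 2: "flow {g, h} s x = (x - 1)"
      using flow_parallel[of "{g, h}" g u v s x] par uvV E 3 by simp
    have "{e, g, h} - {e} = {g, h}" using ghE by auto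
    then have "flow E s x = (x - 1)\<^sup>2 - (x - 1)"
      using flow_parallel[of "{e, g, h}" e u v s x] par uvV E 2 gh by (simp add: power2_eq_square)
    also have "\<dots> = (x - 1) * (x - 2)" by (simp add: power2_eq_square algebra_simps)
    finally have "flow E s x < 0" using x1 x2 by (simp add: mult_pos_neg)
    moreover have "card E = 3" "card V = 2" using E V gh ghE uvV by auto
    ultimately show False using bad by (simp add: signed_flow_eq)
  qed
qed

text \<open>Every vertex is large, so the bound on large vertices bounds them all. From here on,
  smaller graphs with at most \<open>card V\<close> vertices belong to the class whatever their
  degrees.\<close>

lemma card_V: "card V \<le> k"
proof -
  have "{y\<in>V. 3 < deg E s y} = V" using degree_ge_4 by fastforce
  then show ?thesis using wck by (simp add: num_big_def)
qed

text \<open>A further vertex of \<open>V1\<close> would have all its edges in \<open>E1\<close>,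
  fewer than the minimum degree.\<close>

lemma part_verts_of_two_edges:
  assumes V: "V1 \<union> V2 = V" "V1 \<inter> V2 = {a, b}" and E: "E1 \<union> E2 = E"
    and wf1: "graph_on V1 E1 s" and wf2: "graph_on V2 E2 s" and c: "card E1 = 2"
  shows "V1 = {a, b}"
proof (rule ccontr)
  assume "V1 \<noteq> {a, b}"
  then obtain z where z: "z \<in> V1" "z \<notin> V2" using V by blast
  then have "incident z \<subseteq> E1" using wf2 E by (auto simp: incident_def graph_on_def)
  then have "card (incident z) \<le> 2" using c wf1 card_mono[of E1 "incident z"] by (simp add: graph_on_def)
  moreover have "z \<in> V" using z V by blast
  ultimately show False using degree_ge_4[of z] deg_incident[of z] by simp
qed

text \<open>Let \<open>S1\<close>, \<open>S2\<close>, \<open>T1\<close>, \<open>Z1\<close>,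
  \<open>Z2\<close> be the signed values of the bare sides, of \<open>G1/ab\<close> and of the sides
  with \<open>f\<close> added. The 2-sum inequality \<open>main\<close> forces different parities of
  \<open>?b1\<close> and \<open>?b2\<close>, and \<open>ZT\<close> settles \<open>?c1\<close> for
  even \<open>?b1\<close>. For odd \<open>?b1\<close>, the bad parity gives
  \<open>Z1 = T1 + S1\<close>, which is refuted by bounding \<open>(x - 1) * S2\<close> strictly by
  \<open>Z2\<close>.\<close>

lemma two_sum_parity:
  assumes V: "V1 \<union> V2 = V" "V1 \<inter> V2 = {a, b}" "a \<noteq> b" and E: "E1 \<union> E2 = E" "E1 \<inter> E2 = {}"
    and wf1: "graph_on V1 E1 s" and wf2: "graph_on V2 E2 s" and c: "2 \<le> card E1" "2 \<le> card E2"
  shows "even (nblocks_on (V1 - {b}) E1 (ident_ends s a b)) \<longleftrightarrow> odd (nblocks_on V1 E1 s)"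
    and "odd (nblocks_on V1 E1 s) \<longleftrightarrow> even (nblocks_on V2 E2 s)"
proof -
  obtain f where f: "f \<notin> E" by (rule fresh)
  define s' where "s' = s(f := (a, b))"
  note ts = two_sum[OF V E wf1 wf2 c f s'_def]
  have finp: "finite E1" "finite E2" "finite V1" "finite V2" using wf1 wf2 by (auto simp: graph_on_def)
  have fe: "f \<notin> E1" "f \<notin> E2" using f E by auto
  have abV: "a \<in> V1" "b \<in> V1" "a \<in> V2" "b \<in> V2" using V by auto
  have cV12: "card V1 \<le> k" "card V2 \<le> k"
    using card_mono[OF fin(1), of V1] card_mono[OF fin(1), of V2] V card_V by auto
  let ?n1 = "card E1 + card V1" and ?n2 = "card E2 + card V2"
  let ?b1 = "nblocks_on V1 E1 s" and ?b2 = "nblocks_on V2 E2 s"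
      and ?c1 = "nblocks_on (V1 - {b}) E1 (ident_ends s a b)"
  define S1 where "S1 = signed_flow V1 E1 s x"
  define S2 where "S2 = signed_flow V2 E2 s x"
  define T1 where "T1 = signed_flow (V1 - {b}) E1 (ident_ends s a b) x"
  define Z1 where "Z1 = (- 1) ^ (card E1 + 1 + card V1) * flow (insert f E1) s' x"
  define Z2 where "Z2 = (- 1) ^ (card E2 + 1 + card V2) * flow (insert f E2) s' x"
  have S1: "0 \<le> S1" unfolding S1_def
    by (rule smaller_nonneg[OF wf1 ts(1)]) (use num_big_le[OF finp(3), of E1 s] cV12 ts(6) c in auto)
  have S2: "0 \<le> S2" unfolding S2_def
    by (rule smaller_nonneg[OF wf2 ts(2)]) (use num_big_le[OF finp(4), of E2 s] cV12 ts(6) c in auto)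
  have wfT: "graph_on (V1 - {b}) E1 (ident_ends s a b)" using graph_ident_ends[OF wf1 abV(1) V(3)]
      by simp
  have cV1: "card V1 = Suc (card (V1 - {b}))" using finp abV by (metis card.remove)
  have T1: "0 \<le> T1" unfolding T1_def
    by (rule smaller_nonneg[OF wfT conn_identify[OF ts(1) abV(1) V(3)]])
      (use num_big_le[of "V1 - {b}" E1 "ident_ends s a b"] finp cV12 cV1 ts(6) c in auto)
  have Z: "0 < Z1" "0 < Z2" using ts(3,4) by (simp_all add: Z1_def Z2_def)
  have sq: "(- 1) ^ n * ((- 1) ^ n * y) = y" for n and y :: real
    by (simp add: power_add[symmetric] mult.assoc[symmetric])
  have F1: "flow E1 s x = (- 1) ^ (?n1 + 1 + ?b1) * S1" unfolding S1_def signed_flow_def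
      by (rule sq[symmetric])
  have F2: "flow E2 s x = (- 1) ^ (?n2 + 1 + ?b2) * S2" unfolding S2_def signed_flow_def
      by (rule sq[symmetric])
  have FZ1: "flow (insert f E1) s' x = (- 1) ^ (?n1 + 1) * Z1" 
  proof -
    have e: "card E1 + 1 + card V1 = ?n1 + 1" by simp
    show ?thesis unfolding Z1_def e by (rule sq[symmetric])
  qed
  have FZ2: "flow (insert f E2) s' x = (- 1) ^ (?n2 + 1) * Z2" 
  proof -
    have e: "card E2 + 1 + card V2 = ?n2 + 1" by simp
    show ?thesis unfolding Z2_def e by (rule sq[symmetric])
  qed
  have FT: "flow E1 (ident_ends s a b) x = (- 1) ^ (?n1 + ?c1) * T1"
  proof -
    have e: "card E1 + card (V1 - {b}) + 1 + ?c1 = ?n1 + ?c1" using cV1 by simp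
    show ?thesis unfolding T1_def signed_flow_def e by (rule sq[symmetric])
  qed
  have s'E: "flow E1 s' x = flow E1 s x" "flow E2 s' x = flow E2 s x"
    using fe by (auto simp: s'_def intro!: flow_cong)
  \<comment> \<open>Identification of \<open>a\<close> and \<open>b\<close> is contraction of
    \<open>f\<close>, which ties \<open>T1\<close> to \<open>Z1\<close> and
    \<open>S1\<close>.\<close>
  have "flow E1 (ident_ends s' a b) x = flow (insert f E1) s' x + flow E1 s' x"
    by (rule flow_identify[OF finp(1) fe(1) _ V(3)]) (simp_all add: s'_def ident_ends_def)
  moreover have "flow E1 (ident_ends s' a b) x = flow E1 (ident_ends s a b) x"
    by (rule flow_cong) (use fe in \<open>auto simp: s'_def ident_ends_def\<close>)
  ultimately have "(- 1) ^ (?n1 + ?c1) * T1 = (- 1) ^ (?n1 + 1) * Z1 + (- 1) ^ (?n1 + 1 + ?b1) * S1"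
    using FT FZ1 F1 s'E by simp
  then have ZT: "Z1 = - ((- 1) ^ ?c1 * T1) - (- 1) ^ ?b1 * S1"
    by (cases "even (card E1)"; cases "even (card V1)"; cases "even ?b1"; cases "even ?c1")
        (simp_all add: power_add)
  have "?n1 + ?n2 = card E + card V + 2" using ts(6,7) by simp
  then have "(- 1 :: real) ^ (?n1 + ?n2) = (- 1) ^ (card E + card V + 2)" by (rule arg_cong)
  then have sg: "(- 1 :: real) ^ (card E + card V) = (- 1) ^ ?n1 * (- 1) ^ ?n2"
    unfolding power_add[of _ ?n1] by simp
  have "(x - 1) * ((- 1) ^ (card E + card V) * flow E1 s x * flow E2 s x) + Z1 * Z2 \<le> 0"
    using ts(5) by (simp add: Z1_def Z2_def)
  then have main: "(x - 1) * ((- 1) ^ (?b1 + ?b2) * (S1 * S2)) + Z1 * Z2 \<le> 0"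
    unfolding sg F1 F2
    by (cases "even (card E1)"; cases "even (card V1)"; cases "even (card E2)";
        cases "even (card V2)"; cases "even ?b1"; cases "even ?b2") (simp_all add: power_add)
  have ZZ: "0 < Z1 * Z2" using Z by simp
  have SS: "0 \<le> (x - 1) * (S1 * S2)" using S1 S2 x1 by simp
  show par: "odd ?b1 \<longleftrightarrow> even ?b2"
  proof (rule ccontr)
    assume "\<not> ?thesis"
    then have "(- 1 :: real) ^ (?b1 + ?b2) = 1" by simp
    then show False using main ZZ SS by simp
  qed
  show "even ?c1 \<longleftrightarrow> odd ?b1"
  proof (cases "odd ?b1")
    case False
    have "odd ?c1"
    proof (rule ccontr)
      assume "\<not> ?thesis"
      then have "Z1 = - T1 - S1" using ZT False by simp
      then show False using Z T1 S1 by simp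
    qed
    then show ?thesis using False by simp
  next
    case b1: True
    have "even ?c1"
    \<comment> \<open>If \<open>G1\<close> has only two edges, then \<open>G2\<close> with two
      copies of \<open>f\<close> has as many edges as \<open>G\<close>, out of reach of minimality.
      But then \<open>G1\<close> consists of two parallel edges, and identification yields two
      loops.\<close>
    proof (cases "card E1 = 2")
      case True
      then have "V1 = {a, b}" using part_verts_of_two_edges[OF V(1,2) E(1) wf1 wf2] by simp
      then have "V1 - {b} = {a}" using V(3) by auto
      moreover have "nblocks_on {a} E1 (ident_ends s a b) = card E1"
        by (rule nblocks_loops) (use wf1 finp \<open>V1 = {a, b}\<close> in \<open>auto simp: graph_on_def ident_ends_def\<close>)
      ultimately show ?thesis using True by simp
    next
      case False
      show ?thesis
      proof (rule ccontr)
        assume c1: "odd ?c1"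
        have b2: "even ?b2" using par b1 by simp
        have "finite (insert f E)" using fin by simp
        then obtain g where g: "g \<notin> insert f E" using ex_new_if_finite[OF infinite_UNIV_nat] by blast
        then have ge: "g \<notin> insert f E2" using E by auto
        \<comment> \<open>Two copies of \<open>f\<close> are added to \<open>G2\<close>. The
          coefficient \<open>x - 2\<close> is negative, so positivity of the signed value bounds
          \<open>(x - 1) * S2\<close> strictly by \<open>(2 - x) * Z2\<close>, which is less than
          \<open>Z2\<close>.\<close>
        define s'' where "s'' = s'(g := (a, b))"
        let ?E = "insert g (insert f E2)"
        have "flow ?E s'' x = (x - 1) * flow E2 s'' x + (x - 2) * flow (insert f E2) s'' x"
          by (rule flow_insert_two[OF finp(2) fe(2) ge _ _ V(3)]) (use ge in \<open>auto simp: s''_def s'_def\<close>)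
        moreover have "flow E2 s'' x = flow E2 s x" "flow (insert f E2) s'' x = flow (insert f E2) s' x"
          using ge fe by (auto simp: s''_def s'_def intro!: flow_cong)
        ultimately have U: "flow ?E s'' x = (x - 1) * flow E2 s x + (x - 2) * flow (insert f E2) s' x"
            by simp
        note h2 = two_sum_half[of V2 V1 a b E2 E1 f s', OF _ _ V(3) _ _ wf2 wf1 c(2,1) f s'_def]
        have wf2': "graph_on V2 (insert f E2) s'" and ns2': "nonsep_on V2 (insert f E2) s'"
          using h2(3,4) V E by auto
        have cong: "s' d = s'' d" if "d \<in> insert f E2" for d using that ge by (auto simp: s''_def)
        have ns2: "nonsep_on V2 (insert f E2) s''"
            using nonsep_cong[of "insert f E2" s' s'' V2] cong ns2' by blast
        have "loopless (insert f E2) s'" using ns2' c finp fe by (auto simp: nonsep_on_def)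
        then have ll2: "loopless (insert f E2) s''" using cong by (simp add: loopless_def)
        have nsE: "nonsep_on V2 ?E s''"
          by (rule nonsep_insert[OF ns2 ll2]) (use V(3) in \<open>simp add: s''_def\<close>)
        have wfE: "graph_on V2 ?E s''" using wf2' cong abV by (auto simp: graph_on_def s''_def)
        have cE: "card ?E = card E2 + 2" using finp fe ge by simp
        have "0 < signed_flow V2 ?E s'' x"
        proof (rule IH[OF wfE])
          show "conn_on V2 ?E s''" using nsE by (simp add: nonsep_on_def)
          show "bridgeless_on ?E s''" using nonsep_bridgeless[OF wfE nsE] cE by simp
          show "num_big V2 ?E s'' \<le> k" using num_big_le[OF finp(4)] cV12 le_trans by blast
          show "card ?E < card E" using cE ts(6) c False by simp
        qed
        then have "0 < (- 1) ^ (?n2 + 2) * flow ?E s'' x"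
          using signed_flow_nonsep[OF wfE nsE, of x] cE by (simp add: power_add)
        then have "0 < (2 - x) * Z2 - (x - 1) * S2"
          unfolding U F2 FZ2 using b2
          by (cases "even (card E2)"; cases "even (card V2)") (simp_all add: power_add algebra_simps)
        moreover have "(2 - x) * Z2 < Z2" using Z x1 by simp
        ultimately have lt: "(x - 1) * S2 < Z2" by linarith
        have Z1: "Z1 = T1 + S1" using ZT b1 c1 by simp
        have le: "Z1 * Z2 \<le> (x - 1) * (S1 * S2)" using main b1 b2 by simp
        have "S1 \<noteq> 0" using le ZZ by auto
        then have "(x - 1) * S2 * S1 < Z2 * S1" using lt S1 by (intro mult_strict_right_mono) simp_all
        also have "\<dots> \<le> Z1 * Z2" using Z1 T1 Z by (simp add: algebra_simps)
        finally show False using le by (simp add: algebra_simps)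
      qed
    qed
    then show ?thesis using b1 by simp
  qed
qed

lemma card_V_ge_2: "2 \<le> card V"
proof -
  obtain e where e: "e \<in> E" using E_ne by blast
  obtain u v where uv: "s e = (u, v)" by fastforce
  have "card {u, v} \<le> card V" using edge_ends[OF e uv] fin by (intro card_mono) auto
  then show ?thesis using edge_ends[OF e uv] by simp
qed

lemma mem_Phi: "gr V E s \<in> Phi"
proof -
  have 1: "nonsep (gr V E s)" using nonsep nonsep_iff fin by blast
  have 2: "nonsep (del_edge (gr V E s) e)" if "e \<in> E" for e
    using nonsep_del[OF that] nonsep_iff fin by (simp add: del_edge_gr)
  have 3: "even (nblocks (contract (gr V E s) e))" if e: "e \<in> E" for e
  proof -
    obtain u v where uv: "s e = (u, v)" by fastforce
    note uvV = edge_ends[OF e uv]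
    have "card (V - {v}) \<le> card V" using fin by (intro card_mono) auto
    then have "num_big (V - {v}) (E - {e}) (ident_ends s u v) \<le> k"
      using num_big_le[of "V - {v}" "E - {e}" "ident_ends s u v"] fin card_V by simp
    then show ?thesis
      using even_nblocks_contract[OF e uv] uvV contract_gr[where s = s and e = e and u = u
          and v = v, OF uv] by simp
  qed
  have 4: "(even (int (nblocks (identify (sub (gr V E s) V1 E1) a b))) \<longleftrightarrow>
      even (int (nblocks (sub (gr V E s) V1 E1)) - 1)) \<and>
        (even (int (nblocks (sub (gr V E s) V1 E1)) - 1) \<longleftrightarrow> even (int (nblocks (sub (gr V E s) V2 E2))))"
    if *: "is_sub V1 E1 (gr V E s)" "is_sub V2 E2 (gr V E s)" "2 \<le> card E1" "2 \<le> card E2"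
      "a \<noteq> b" "V1 \<inter> V2 = {a, b}" "V1 \<union> V2 = V" "E1 \<inter> E2 = {}" "E1 \<union> E2 = E" for V1 E1 V2 E2 a b
  proof -
    have "graph_on V1 E1 s" "graph_on V2 E2 s" using subgraph_graph[OF wf] * by (simp_all add: is_sub_gr)
    then show ?thesis
      using two_sum_parity[of V1 V2 a b E1 E2] * by (simp add: sub_gr identify_gr)
  qed
  show ?thesis
    unfolding Phi_def using wf 1 2 3 4 card_V_ge_2 by (simp add: wf_graph_iff) blast
qed

end

section \<open>Roots of the graphs in Phi\<close>

lemma ex_minimal_bad:
  assumes "graph_on V E s" "conn_on V E s" "bridgeless_on E s" "num_big V E s \<le> k" "1 \<le> k" "1 < x"
      "x < 2" "\<not> 0 < signed_flow V E s x"
  shows "\<exists>V E s. minimal_bad V E s x k"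
  using assms
proof (induction "card E" arbitrary: V E s rule: less_induct)
  case less
  show ?case
  proof (cases "minimal_bad V E s x k")
    case False
    then obtain V' E' s' where "graph_on V' E' s'" "conn_on V' E' s'" "bridgeless_on E' s'"
        "num_big V' E' s' \<le> k"
      "card E' < card E" "\<not> 0 < signed_flow V' E' s' x"
      using less.prems unfolding minimal_bad_def by blast
    then show ?thesis using less.hyps[of E' V' s'] less.prems by blast
  qed blast
qed

lemma Phi_props:
  assumes "gr V E s \<in> Phi"
  shows "graph_on V E s" "nonsep_on V E s" "bridgeless_on E s" "E \<noteq> {}" "loopless E s" "2 \<le> card V"
proof -
  show w: "graph_on V E s" and c: "2 \<le> card V" using assms by (auto simp: Phi_def wf_graph_iff)
  have fin: "finite V" using w by (simp add: graph_on_def)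
  show n: "nonsep_on V E s" using assms nonsep_iff[OF fin] by (auto simp: Phi_def)
  then show "loopless E s" using c by (auto simp: nonsep_on_def)
  have "nonsep_on V (E - {e}) s" if "e \<in> E" for e
    using assms that nonsep_iff[OF fin] by (auto simp: Phi_def del_edge_gr)
  then show "bridgeless_on E s" using w by (auto simp: bridgeless_on_def nonsep_on_def conn_on_def
      graph_on_def)
  have "\<exists>u v. u \<in> V \<and> v \<in> V \<and> u \<noteq> v"
  proof (rule ccontr)
    assume a: "\<not> ?thesis"
    obtain u where "u \<in> V" using n by (auto simp: nonsep_on_def conn_on_def)
    then have "V = {u}" using a by blast
    then show False using c by simp
  qed
  then obtain u v where uv: "u \<in> V" "v \<in> V" "u \<noteq> v" by blast
  then show "E \<noteq> {}" using conn_edge_at[of V E s u v] n by (auto simp: nonsep_on_def)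
qed

lemma continuous_flow: "isCont (flow E s) x"
proof -
  have "flow E s = (\<lambda>x. \<Sum>A\<in>Pow E. (- 1) ^ card (E - A) * x ^ nullity s A)"
    by (simp add: flow_def fun_eq_iff)
  then show ?thesis by (simp only:) (intro continuous_intros)
qed

lemma root_below:
  assumes G: "gr V E s \<in> Phi" and x: "1 < x" and n: "\<not> 0 < signed_flow V E s x"
  obtains r where "1 < r" "r \<le> x" "flow E s r = 0"
proof -
  note P = Phi_props[OF G]
  let ?c = "(- 1 :: real) ^ (card E + card V)"
  let ?g = "\<lambda>y. ?c * flow E s y"
  have "(?g has_real_derivative ?c * flow_deriv E s) (at 1)"
    by (rule DERIV_cmult[OF DERIV_flow])
  moreover have "0 < ?c * flow_deriv E s" by (rule flow_deriv_sign[OF P(1-4)])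
  ultimately obtain d where d: "0 < d" "\<And>h. 0 < h \<Longrightarrow> h < d \<Longrightarrow> ?g 1 < ?g (1 + h)"
    using DERIV_pos_inc_right[of ?g "?c * flow_deriv E s" 1] by blast
  have g1: "?g 1 = 0" using flow_at_1 P(1,4) by (simp add: graph_on_def)
  \<comment> \<open>Half of each distance keeps \<open>y\<close> below \<open>x\<close> and within
    the range where the derivative guarantees growth.\<close>
  define y where "y = 1 + min (d / 2) ((x - 1) / 2)"
  have y: "1 < y" "y < x" "0 < ?g y"
    using d x g1 d(2)[of "min (d / 2) ((x - 1) / 2)"] by (auto simp: y_def min_def field_simps)
  have "?g x \<le> 0" using n signed_flow_nonsep[OF P(1,2,4)] by simp
  then have "\<exists>r. y \<le> r \<and> r \<le> x \<and> ?g r = 0"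
    using y by (intro IVT2) (auto intro!: continuous_intros continuous_flow)
  then obtain r where "y \<le> r" "r \<le> x" "?g r = 0" by blast
  then show ?thesis using that[of r] y by simp
qed

text \<open>At most \<open>k\<close> vertices, because that is what minimality yields;
  \<open>Min_Phi_roots_attained\<close> passes to exactly \<open>k\<close>. The value 2 is left out
  since a root at 2 and no root at all have the same effect on \<open>eta\<close>.\<close>

definition Phi_roots :: "nat \<Rightarrow> real set" where
  "Phi_roots k = {r. 1 < r \<and> r < 2 \<and> (\<exists>G\<in>Phi. card (verts G) \<le> k \<and> flow_poly G r = 0)}"

lemma Phi_roots_I: "G \<in> Phi \<Longrightarrow> card (verts G) \<le> k \<Longrightarrow> flow_poly G r = 0 \<Longrightarrow> 1 < r \<Longrightarrow> r < 2 \<Longrightarrow> r \<in> Phi_roots k"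
  unfolding Phi_roots_def by blast

lemma graph_cases: obtains V E s where "G = gr V E s"
  by (metis graph.cases)

lemma bad_root:
  assumes "graph_on V E s" "conn_on V E s" "bridgeless_on E s" "num_big V E s \<le> k" "1 < x" "x < 2"
      "\<not> 0 < signed_flow V E s x"
  obtains r where "r \<in> Phi_roots k" "r \<le> x"
proof -
  \<comment> \<open>The locale asks for \<open>1 \<le> k\<close>, hence the maximum. As a graph in
    \<open>Phi\<close> has at least two vertices, a bound by \<open>max k 1\<close> is a bound by
    \<open>k\<close>.\<close>
  obtain V' E' s' where m: "minimal_bad V' E' s' x (max k 1)"
    using ex_minimal_bad[of V E s "max k 1" x] assms le_trans[OF assms(4) max.cobounded1[of k 1]]
      max.cobounded2[of 1 k] by blast
  then interpret m: minimal_bad V' E' s' x "max k 1" .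
  have G: "gr V' E' s' \<in> Phi" and c: "card V' \<le> max k 1" using m.mem_Phi m.card_V by auto
  obtain r where r: "1 < r" "r \<le> x" "flow E' s' r = 0" using root_below[OF G assms(5) m.bad] .
  have "card V' \<le> k" using c m.card_V_ge_2 by auto
  then have "r \<in> Phi_roots k" using r assms(6) G flow_poly_gr[OF m.wf]
      by (auto simp: Phi_roots_def intro!: bexI[of _ "gr V' E' s'"])
  then show ?thesis using that r by blast
qed

lemma Psi_gr: "graph_on V E s \<Longrightarrow> gr V E s \<in> Psi k \<longleftrightarrow> conn_on V E s \<and> bridgeless_on E s \<and> num_big V E s \<le> k"
  by (auto simp: Psi_def wf_graph_iff bridgeless_iff connected_iff card_W)

lemma Psi_root:
  assumes G: "G \<in> Psi k" and r: "1 < r" "r < 2" "flow_poly G r = 0"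
  obtains r' where "r' \<in> Phi_roots k" "r' \<le> r"
proof -
  obtain V E s where [simp]: "G = gr V E s" by (rule graph_cases)
  have w: "graph_on V E s" using G by (auto simp: Psi_def wf_graph_iff)
  show ?thesis
    by (rule bad_root[OF w, of k r]) (use G r Psi_gr[OF w] flow_poly_gr[OF w] that in \<open>auto simp:
        signed_flow_def\<close>)
qed

lemma Phi_Psi:
  assumes G: "G \<in> Phi" and c: "card (verts G) \<le> k"
  shows "G \<in> Psi k"
proof -
  obtain V E s where [simp]: "G = gr V E s" by (rule graph_cases)
  note P = Phi_props[of V E s]
  have "num_big V E s \<le> card V" using P G by (intro num_big_le) (simp add: graph_on_def)
  then show ?thesis using P G c Psi_gr[of V E s k] by (simp add: nonsep_on_def)
qed

text \<open>Three parallel edges as \<open>G1\<close> violate (c'): \<open>b(G1/u1u2) = 3\<close> but \<open>b(G1) - 1 = 0\<close>.\<close>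
lemma Phi_multiplicity:
  assumes G: "gr V E s \<in> Phi" and c: "5 \<le> card E"
  shows "card {e\<in>E. s e = (p, q)} \<le> 2"
proof (rule ccontr)
  assume n: "\<not> ?thesis"
  note P = Phi_props[OF G]
  have fin: "finite E" "finite V" using P by (auto simp: graph_on_def)
  have "3 \<le> card {e\<in>E. s e = (p, q)}" using n by simp
  then obtain T where T: "T \<subseteq> {e\<in>E. s e = (p, q)}" "card T = 3" "finite T"
    by (rule obtain_subset_with_card_n)
  then obtain e where e: "e \<in> T" by fastforce
  then have "e \<in> E" "s e = (p, q)" using T by auto
  then have pq: "p \<in> V" "q \<in> V" "p \<noteq> q" using P(1,5) by (force simp: graph_on_def loopless_def)+
  have lT: "linked s T p q" using linked_edge[OF e, of s] e T by auto
  have wT: "graph_on {p, q} T s" using T by (auto simp: graph_on_def)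
  have "conn_on {p, q} T s" using lT linked_sym[OF lT] by (simp add: conn_on_def)
  moreover have "loopless T s" using T pq by (auto simp: loopless_def)
  moreover have "linked s (avoid T s z) a b" if "z \<in> {p, q}" "a \<in> {p, q} - {z}" "b \<in> {p, q} - {z}"
      for z a b
  proof -
    have "a = b" using that by auto
    then show ?thesis by simp
  qed
  ultimately have "nonsep_on {p, q} T s" by (simp add: nonsep_on_def)
  then have n1: "nblocks_on {p, q} T s = 1" using nblocks_nonsep[OF wT] e by blast
  have n2: "nblocks_on {p} T (ident_ends s p q) = 3"
  proof -
    have "nblocks_on {p} T (ident_ends s p q) = card T"
    proof (rule nblocks_loops[OF T(3)])
      fix d assume "d \<in> T"
      then have "s d = (p, q)" using T(1) by auto
      then show "ident_ends s p q d = (p, p)" by (simp add: ident_ends_def)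
    qed
    then show ?thesis using T(2) by simp
  qed
  have "{p, q} - {q} = {p}" using pq by auto
  then have i: "nblocks (identify (sub (gr V E s) {p, q} T) p q) = 3"
    using n2 pq by (simp add: sub_gr identify_gr)
  have s: "nblocks (sub (gr V E s) {p, q} T) = 1" using n1 by (simp add: sub_gr)
  have "card (E - T) = card E - 3" using T fin by (subst card_Diff_subset) auto
  then have c2: "2 \<le> card (E - T)" using c by simp
  have "is_sub {p, q} T (gr V E s)" "is_sub V (E - T) (gr V E s)"
    using T P pq by (auto simp: is_sub_gr subgraph_on_def graph_on_def)
  moreover have "{p, q} \<inter> V = {p, q}" "{p, q} \<union> V = verts (gr V E s)" "T \<inter> (E - T) = {}"
    "T \<union> (E - T) = edges (gr V E s)" using pq T by auto
  moreover have "2 \<le> card T" using T by simp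
  ultimately have "even (int (nblocks (identify (sub (gr V E s) {p, q} T) p q))) \<longleftrightarrow>
      even (int (nblocks (sub (gr V E s) {p, q} T)) - 1)"
    using G c2 pq unfolding Phi_def mem_Collect_eq by blast
  then show False unfolding i s by simp
qed

text \<open>At most two edges for each ordered pair of ends, two orientations counting separately;
  the summand 4 covers the graphs with fewer than 5 edges, to which \<open>Phi_multiplicity\<close>
  does not apply.\<close>

lemma Phi_card_edges:
  assumes G: "gr V E s \<in> Phi"
  shows "card E \<le> 2 * (card V * card V) + 4"
proof (cases "5 \<le> card E")
  case True
  note P = Phi_props[OF G]
  have fin: "finite E" "finite V" using P by (auto simp: graph_on_def)
  have "s e \<in> V \<times> V" if "e \<in> E" for e using P(1) that by (simp add: graph_on_def mem_Times_iff)
  then have "E = (\<Union>pq\<in>V \<times> V. {e\<in>E. s e = pq})" by auto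
  then have "card E \<le> (\<Sum>pq\<in>V \<times> V. card {e\<in>E. s e = pq})"
    using card_UN_le[of "V \<times> V" "\<lambda>pq. {e\<in>E. s e = pq}"] fin by simp
  also have "\<dots> \<le> (\<Sum>pq\<in>V \<times> V. 2)"
    using Phi_multiplicity[OF G True] by (intro sum_mono) auto
  finally show ?thesis by (simp add: card_cartesian_product)
qed simp

text \<open>With arbitrary natural numbers as names, \<open>Phi\<close> contains infinitely many
  copies of each of its graphs, so finiteness is stated for polynomials. The bound
  \<open>2 ^ M\<close> is the number of edge sets, and extensional coefficient functions make the
  family finite.\<close>

definition bounded_int_polys :: "nat \<Rightarrow> (real \<Rightarrow> real) set" where
  "bounded_int_polys M = (\<lambda>c x. \<Sum>i\<le>M. real_of_int (c i) * x ^ i) ` ({..M} \<rightarrow>\<^sub>E {- (2 ^ M)..2 ^ M})"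

lemma finite_bounded_int_polys: "finite (bounded_int_polys M)"
  unfolding bounded_int_polys_def by (intro finite_imageI finite_PiE) auto

lemma flow_coeffs:
  assumes "finite E" "card E \<le> M"
  shows "flow E s \<in> bounded_int_polys M"
proof -
  \<comment> \<open>Restricted to \<open>{..M}\<close> in order to lie in the extensional function
    space. The coefficient of \<open>x ^ i\<close> is the signed count of edge sets of nullity
    \<open>i\<close>.\<close>
  define c :: "nat \<Rightarrow> int" where
    "c = (\<lambda>i\<in>{..M}. \<Sum>A\<in>{A\<in>Pow E. nullity s A = i}. (- 1) ^ card (E - A))"
  have nullity: "nullity s A \<le> M" if "A \<in> Pow E" for A
    using card_mono[of E A] that assms by (simp add: nullity_def)
  have "\<bar>c i\<bar> \<le> 2 ^ M" if "i \<le> M" for i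
  proof -
    have "c i = (\<Sum>A\<in>{A\<in>Pow E. nullity s A = i}. (- 1) ^ card (E - A))"
      using that by (simp add: c_def)
    then have "\<bar>c i\<bar> \<le> (\<Sum>A\<in>{A\<in>Pow E. nullity s A = i}. \<bar>(- 1) ^ card (E - A)\<bar>)"
      by (simp only: sum_abs)
    also have "\<dots> = int (card {A\<in>Pow E. nullity s A = i})" by (simp add: power_abs)
    also have "\<dots> \<le> int (card (Pow E))" using assms by (intro of_nat_mono card_mono) auto
    also have "\<dots> \<le> 2 ^ M" using assms by (simp add: card_Pow)
    finally show ?thesis .
  qed
  then have "c \<in> {..M} \<rightarrow>\<^sub>E {- (2 ^ M)..2 ^ M}"
    by (auto simp: c_def abs_le_iff minus_le_iff)
  moreover have "flow E s = (\<lambda>x. \<Sum>i\<le>M. real_of_int (c i) * x ^ i)"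
  proof
    fix x
    have "flow E s x = (\<Sum>i\<le>M. \<Sum>A\<in>{A\<in>Pow E. nullity s A = i}. (- 1) ^ card (E - A) * x ^ nullity s A)"
      unfolding flow_def by (rule sum.group[symmetric]) (use assms nullity in auto)
    also have "\<dots> = (\<Sum>i\<le>M. real_of_int (c i) * x ^ i)"
      by (intro sum.cong refl) (simp add: c_def sum_distrib_right)
    finally show "flow E s x = (\<Sum>i\<le>M. real_of_int (c i) * x ^ i)" .
  qed
  ultimately show ?thesis unfolding bounded_int_polys_def by blast
qed

text \<open>The polynomial is not zero because its derivative at 1 is not.\<close>

lemma finite_roots:
  assumes G: "gr V E s \<in> Phi"
  shows "finite {r. flow E s r = 0}"
proof -
  note P = Phi_props[OF G]
  obtain c where c: "flow E s = (\<lambda>x. \<Sum>i\<le>card E. real_of_int (c i) * x ^ i)"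
    using flow_coeffs[of E "card E" s] P by (auto simp: bounded_int_polys_def graph_on_def)
  have "\<exists>i\<le>card E. real_of_int (c i) \<noteq> 0"
  proof (rule ccontr)
    assume "\<not> ?thesis"
    then have "flow E s = (\<lambda>x. 0)" using c by simp
    then have "(flow E s has_real_derivative 0) (at 1)" by simp
    then have "flow_deriv E s = 0" by (rule DERIV_unique[OF DERIV_flow])
    then show False using flow_deriv_sign[OF P(1-4)] by simp
  qed
  then show ?thesis unfolding c using polyfun_finite_roots[of "\<lambda>i. real_of_int (c i)" "card E"] by simp
qed

lemma finite_Phi_roots: "finite (Phi_roots k)"
proof -
  let ?M = "2 * (k * k) + 4"
  have "Phi_roots k \<subseteq> (\<Union>p\<in>{p\<in>bounded_int_polys ?M. finite {r. p r = 0}}. {r. p r = 0})"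
  proof
    fix r assume "r \<in> Phi_roots k"
    then obtain G where G: "G \<in> Phi" "card (verts G) \<le> k" "flow_poly G r = 0"
        by (auto simp: Phi_roots_def)
    obtain V E s where [simp]: "G = gr V E s" by (rule graph_cases)
    have G': "gr V E s \<in> Phi" using G by simp
    have "card V * card V \<le> k * k" using G(2) by (intro mult_le_mono) auto
    then have "card E \<le> ?M" using Phi_card_edges[OF G'] by linarith
    then have "flow E s \<in> bounded_int_polys ?M" using flow_coeffs Phi_props(1)[OF G']
        by (simp add: graph_on_def)
    moreover have "flow E s r = 0" using G flow_poly_gr[OF Phi_props(1)[OF G']] by simp
    ultimately show "r \<in> (\<Union>p\<in>{p\<in>bounded_int_polys ?M. finite {r. p r = 0}}. {r. p r = 0})"
      using finite_roots[OF G'] by blast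
  qed
  then show ?thesis by (rule finite_subset) (use finite_bounded_int_polys in auto)
qed

section \<open>A smaller root at the cost of one vertex\<close>

text \<open>The path through \<open>w\<close> does the work of \<open>e\<close> in every connection,
  except when \<open>w\<close> itself is deleted; what then remains is \<open>G - e\<close>, whose
  connectedness comes from \<open>nse\<close>.\<close>

lemma nonsep_double_subdivision:
  assumes wf: "graph_on V E s" and nonsep_on: "nonsep_on V E s" and loopless: "loopless E s"
      and e: "e \<in> E" "s e = (u, v)"
    and nse: "nonsep_on V (E - {e}) s" and w: "w \<notin> V" and F: "F \<inter> E = {}"
    and cg: "\<And>g. g \<in> E \<Longrightarrow> s' g = s g" and f: "f1 \<in> F" "f3 \<in> F" "s' f1 = (u, w)" "s' f3 = (w, v)"
    and sF: "\<And>g. g \<in> F \<Longrightarrow> s' g = (u, w) \<or> s' g = (w, v)"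
  shows "nonsep_on (insert w V) (E - {e} \<union> F) s'"
proof -
  let ?E = "E - {e} \<union> F"
  have uv: "u \<in> V" "v \<in> V" "u \<noteq> v" using e wf loopless by (auto simp: graph_on_def loopless_def)
  have uw: "linked s' ?E u w" and wv: "linked s' ?E w v"
    using linked_edge[of f1 ?E s'] linked_edge[of f3 ?E s'] f by simp_all
  have "linked s' ?E x y" if "x \<in> V" "y \<in> V" for x y
  proof -
    have "linked s E x y" using nonsep_on that by (simp add: nonsep_on_def conn_on_def)
    then show ?thesis
    proof (rule linked_map[where h = "\<lambda>x. x"])
      fix g assume g: "g \<in> E"
      show "linked s' ?E (fst (s g)) (snd (s g))"
      proof (cases "g = e")
        case True
        then show ?thesis using linked_trans[OF uw wv] e by simp
      next
        case False
        then show ?thesis using linked_edge[of g ?E s'] g cg by simp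
      qed
    qed
  qed
  then have "conn_on (insert w V) ?E s'"
    using uw uv linked_sym linked_trans unfolding conn_on_def
        by (metis insert_iff insert_not_empty linked_refl)
  moreover have "loopless ?E s'"
    using loopless cg sF uv w by (fastforce simp: loopless_def)
  moreover have "linked s' (avoid ?E s' z) x y"
    if z: "z \<in> insert w V" "x \<in> insert w V - {z}" "y \<in> insert w V - {z}" for z x y
  proof (cases "z = w")
    case True
    have "linked s (E - {e}) x y" using nse z True by (auto simp: nonsep_on_def conn_on_def)
    then show ?thesis
    proof (rule linked_map[where h = "\<lambda>x. x"])
      fix g assume g: "g \<in> E - {e}"
      then have "g \<in> avoid ?E s' z" using wf w True cg by (auto simp: avoid_def graph_on_def)
      then show "linked s' (avoid ?E s' z) (fst (s g)) (snd (s g))"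
        using linked_edge[of g "avoid ?E s' z" s'] g cg by simp
    qed
  next
    case False
    let ?A = "avoid ?E s' z"
    have VV: "linked s' ?A a b" if "a \<in> V - {z}" "b \<in> V - {z}" for a b
    proof -
      have "linked s (avoid E s z) a b" using nonsep_on that z False by (auto simp: nonsep_on_def)
      then show ?thesis
      proof (rule linked_map[where h = "\<lambda>x. x"])
        fix g assume g: "g \<in> avoid E s z"
        show "linked s' ?A (fst (s g)) (snd (s g))"
        proof (cases "g = e")
          case True
          then have "f1 \<in> ?A" "f3 \<in> ?A" using g f e False by (auto simp: avoid_def)
          then have "linked s' ?A u w" "linked s' ?A w v"
            using linked_edge[of f1 ?A s'] linked_edge[of f3 ?A s'] f by simp_all
          then have "linked s' ?A u v" by (rule linked_trans)
          then show ?thesis using True e by simp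
        next
          case False
          then have "g \<in> ?A" "g \<in> E" using g cg by (auto simp: avoid_def)
          then show ?thesis using linked_edge[of g ?A s'] cg by simp
        qed
      qed
    qed
    obtain t where t: "t \<in> V - {z}" "linked s' ?A w t"
    proof (cases "z = u")
      case True
      then have "f3 \<in> ?A" using f False uv by (auto simp: avoid_def)
      then show ?thesis using that[of v] linked_edge[of f3 ?A s'] f True uv by simp
    next
      case zu: False
      then have "f1 \<in> ?A" using f False by (auto simp: avoid_def)
      then have "linked s' ?A u w" using linked_edge[of f1 ?A s'] f by simp
      then show ?thesis using that[of u] linked_sym zu uv by simp
    qed
    have wV: "linked s' ?A w b" if "b \<in> V - {z}" for b
      using t(2) VV[OF t(1) that] by (rule linked_trans)
    show ?thesis
      using z VV wV linked_sym by (cases "x = w"; cases "y = w") simp_all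
  qed
  ultimately show ?thesis by (simp add: nonsep_on_def)
qed

lemma ex_four_fresh:
  assumes "finite (E :: nat set)"
  obtains f1 f2 f3 f4 where "distinct [f1, f2, f3, f4]" "{f1, f2, f3, f4} \<inter> E = {}"
proof -
  have "infinite (- E)" using assms by (simp add: Compl_eq_Diff_UNIV)
  then obtain T where T: "T \<subseteq> - E" "finite T" "card T = 4"
    using infinite_arbitrarily_large by blast
  obtain xs where xs: "set xs = T" "distinct xs" using finite_distinct_list[OF T(2)] by blast
  then have "length xs = 4" using T distinct_card by fastforce
  then obtain f1 f2 f3 f4 where "xs = [f1, f2, f3, f4]"
    by (auto simp: numeral_eq_Suc length_Suc_conv)
  then show ?thesis using that[of f1 f2 f3 f4] xs T by auto
qed

text \<open>A pair of parallel edges has flow polynomial \<open>x - 1\<close>, and the two pairs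
  share only \<open>w\<close>.\<close>

lemma flow_double_path:
  assumes d: "distinct [f1, f2, f3, f4]" and uv: "u \<noteq> v" "w \<noteq> u" "w \<noteq> v"
    and s: "s f1 = (u, w)" "s f2 = (u, w)" "s f3 = (w, v)" "s f4 = (w, v)"
  shows "flow {f1, f2, f3, f4} s x = (x - 1)\<^sup>2"
proof -
  have two: "flow {f, g} s x = x - 1" if "f \<noteq> g" "s f = (a, b)" "s g = (a, b)" "a \<noteq> b" for f g a b
  proof -
    have 0: "flow {g} s x = 0" using flow_parallel[of "{g}" g a b s x] that by simp
    have 1: "{f, g} - {f} = {g}" using that by auto
    have "flow {f, g} s x = (x - 1) ^ card ({f, g} - {f}) - flow ({f, g} - {f}) s x"
      by (rule flow_parallel[where a = a and b = b]) (use that in auto)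
    then show ?thesis unfolding 1 0 by simp
  qed
  have 12: "flow {f1, f2} s x = x - 1" by (rule two[of f1 f2 u w]) (use d uv s in simp_all)
  have 34: "flow {f3, f4} s x = x - 1" by (rule two[of f3 f4 w v]) (use d uv s in simp_all)
  have "flow ({f1, f2} \<union> {f3, f4}) s x = flow {f1, f2} s x * flow {f3, f4} s x"
  proof (rule flow_one_sum[where ?V1.0 = "{u, w}" and ?V2.0 = "{w, v}" and w = w])
    show "{f1, f2} \<inter> {f3, f4} = {}" using d by simp
    show "{u, w} \<inter> {w, v} \<subseteq> {w}" using uv by blast
    show "fst (s e) \<in> {u, w} \<and> snd (s e) \<in> {u, w}" if "e \<in> {f1, f2}" for e
      using that s by (metis fst_conv insertCI insertE singletonD snd_conv)
    show "fst (s e) \<in> {w, v} \<and> snd (s e) \<in> {w, v}" if "e \<in> {f3, f4}" for e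
      using that s by (metis fst_conv insertCI insertE singletonD snd_conv)
  qed simp_all
  moreover have "{f1, f2} \<union> {f3, f4} = {f1, f2, f3, f4}" by blast
  ultimately show ?thesis unfolding 12 34 power2_eq_square by metis
qed

text \<open>Replacing an edge of a minimal graph at the least root by the double path makes the
  signed value negative there, and by continuity also slightly below. Minimality, not just vanishing
  at the root, is what makes \<open>Q(G-e)\<close> positive.\<close>

lemma smaller_root:
  assumes ne: "Phi_roots k \<noteq> {}"
  obtains G r where "G \<in> Phi" "card (verts G) = Suc k" "flow_poly G r = 0" "1 < r"
      "r < Min (Phi_roots k)"
proof -
  define r0 where "r0 = Min (Phi_roots k)"
  have r0: "r0 \<in> Phi_roots k" "\<And>r. r \<in> Phi_roots k \<Longrightarrow> r0 \<le> r"
    using finite_Phi_roots ne by (auto simp: r0_def)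
  then obtain G where G: "1 < r0" "r0 < 2" "G \<in> Phi" "card (verts G) \<le> k" "flow_poly G r0 = 0"
    by (auto simp: Phi_roots_def)
  obtain V0 E0 s0 where [simp]: "G = gr V0 E0 s0" by (rule graph_cases)
  have G': "gr V0 E0 s0 \<in> Phi" using G by simp
  note P = Phi_props[OF G']
  have k1: "1 \<le> k" using P(6) G(4) by simp
  have "\<not> 0 < signed_flow V0 E0 s0 r0" using G flow_poly_gr[OF P(1)] by (simp add: signed_flow_def)
  then obtain V E s where "minimal_bad V E s r0 k"
    using ex_minimal_bad[OF P(1) _ P(3) _ k1 G(1,2)] Phi_Psi[OF G(3,4)] Psi_gr[OF P(1)] by auto
  then interpret m: minimal_bad V E s r0 k .
  have mG: "gr V E s \<in> Phi" by (rule m.mem_Phi)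
  obtain r where r: "1 < r" "r \<le> r0" "flow E s r = 0" using root_below[OF mG G(1) m.bad] .
  have "r \<in> Phi_roots k"
    using r G(2) mG m.card_V flow_poly_gr[OF m.wf]
        by (auto simp: Phi_roots_def intro!: bexI[of _ "gr V E s"])
  \<comment> \<open>Minimality only gives a nonpositive value at \<open>r0\<close>; that it is a
    zero follows because no root lies below \<open>r0\<close>.\<close>
  then have "r = r0" using r r0 by fastforce
  then have F0: "flow E s r0 = 0" using r by simp
  obtain e where e: "e \<in> E" using m.E_ne by blast
  obtain u v where uv: "s e = (u, v)" by fastforce
  note uvV = m.edge_ends[OF e uv]
  obtain w where w: "w \<notin> V" using ex_new_if_finite[OF infinite_UNIV_nat m.fin(1)] by blast
  obtain f1 f2 f3 f4 where f: "distinct [f1, f2, f3, f4]" "{f1, f2, f3, f4} \<inter> E = {}"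
    using ex_four_fresh[OF m.fin(2)] .
  let ?F = "{f1, f2, f3, f4}"
  define s' where "s' = s(f1 := (u, w), f2 := (u, w), f3 := (w, v), f4 := (w, v))"
  have sf: "s' f1 = (u, w)" "s' f2 = (u, w)" "s' f3 = (w, v)" "s' f4 = (w, v)"
    using f by (auto simp: s'_def)
  have cg: "s' g = s g" if "g \<in> E" for g using that f by (auto simp: s'_def)
  let ?V = "insert w V" and ?E = "E - {e} \<union> ?F"
  have wuv: "w \<noteq> u" "w \<noteq> v" using w uvV by auto
  have nsH: "nonsep_on ?V ?E s'"
    by (rule nonsep_double_subdivision[OF m.wf m.nonsep m.loopless e uv m.nonsep_del[OF e] w f(2) cg _
        _ sf(1,3)])
      (use sf in auto)
  have wfH: "graph_on ?V ?E s'"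
    using m.wf uvV cg sf by (auto simp: graph_on_def)
  have cF: "card ?F = 4" using f by simp
  have cE: "card ?E = card (E - {e}) + 4"
    using card_Un_disjoint[of "E - {e}" ?F] m.fin f(2) cF by auto
  have cV: "card ?V = card V + 1" using w m.fin by simp
  \<comment> \<open>The 2-sum formula with \<open>e\<close> itself in the role of the added edge:
    restoring \<open>e\<close> on the first side gives the original graph, whose polynomial vanishes
    at \<open>r0\<close>.\<close>
  have "(r0 - 1) * flow ?E s' r0 = (r0 - 1) * flow (E - {e}) s' r0 * flow ?F s' r0 +
      flow (insert e (E - {e})) s' r0 * flow (insert e ?F) s' r0"
    by (rule flow_two_sum[where ?V1.0 = V and ?V2.0 = "{u, v, w}" and u = u and v = v])
      (use m.fin m.wf f(2) cg sf uvV w e uv in \<open>auto simp: graph_on_def\<close>)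
  moreover have "flow (insert e (E - {e})) s' r0 = 0"
    using flow_cong[of E s' s] cg F0 e by (simp add: insert_absorb)
  moreover have "flow (E - {e}) s' r0 = flow (E - {e}) s r0"
    by (rule flow_cong) (use cg in simp)
  moreover have "flow ?F s' r0 = (r0 - 1)\<^sup>2"
    by (rule flow_double_path[OF f(1) uvV(3) wuv sf])
  ultimately have FH: "flow ?E s' r0 = flow (E - {e}) s r0 * (r0 - 1)\<^sup>2" using G(1) by simp
  have ne': "?E \<noteq> {}" by simp
  \<comment> \<open>Four edges and one vertex more than \<open>G - e\<close>, both graphs being
    single blocks: the parity of the exponent changes.\<close>
  have sH: "signed_flow ?V ?E s' y = (- 1) ^ (card (E - {e}) + card V + 1) * flow ?E s' y" for y
    unfolding signed_flow_nonsep[OF wfH nsH ne'] cE cV by (simp add: power_add)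
  have "signed_flow ?V ?E s' r0 = - (signed_flow V (E - {e}) s r0 * (r0 - 1)\<^sup>2)"
    unfolding sH FH unfolding signed_flow_def m.nblocks_del[OF e] by simp
  moreover have "0 < signed_flow V (E - {e}) s r0 * (r0 - 1)\<^sup>2"
    using m.del_pos[OF e] G(1) by simp
  ultimately have neg: "signed_flow ?V ?E s' r0 < 0" by simp
  have "isCont (signed_flow ?V ?E s') r0"
    unfolding sH[abs_def] by (intro continuous_intros continuous_flow)
  then have "signed_flow ?V ?E s' \<midarrow>r0\<rightarrow> signed_flow ?V ?E s' r0" by (simp add: isCont_def)
  then have "eventually (\<lambda>y. signed_flow ?V ?E s' y < 0) (at r0)" using neg by (rule order_tendstoD)
  then have "eventually (\<lambda>y. signed_flow ?V ?E s' y < 0) (at_left r0)" by (simp add: eventually_at_split)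
  then obtain b where b: "b < r0" "\<And>y. b < y \<Longrightarrow> y < r0 \<Longrightarrow> signed_flow ?V ?E s' y < 0"
    by (auto simp: eventually_at_left[OF G(1)])
  \<comment> \<open>A point strictly between \<open>r0\<close> and the larger of \<open>b\<close>
    and 1: a nonpositive value at \<open>r0\<close> itself would not give a root strictly below
    \<open>r0\<close>.\<close>
  define y where "y = (max b 1 + r0) / 2"
  have y: "1 < y" "y < r0" "b < y" using b(1) G(1) by (auto simp: y_def max_def)
  have "num_big ?V ?E s' \<le> Suc k"
    using num_big_le[of ?V ?E s'] m.fin cV m.card_V by simp
  moreover have "bridgeless_on ?E s'" using nonsep_bridgeless[OF wfH nsH] cE by simp
  moreover have "conn_on ?V ?E s'" using nsH by (simp add: nonsep_on_def)
  moreover have "\<not> 0 < signed_flow ?V ?E s' y" using b(2)[OF y(3,2)] by simp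
  moreover have "y < 2" using y G(2) by simp
  ultimately obtain r' where r': "r' \<in> Phi_roots (Suc k)" "r' \<le> y"
    using bad_root[OF wfH _ _ _ y(1)] by blast
  then obtain G' where G'': "1 < r'" "r' < 2" "G' \<in> Phi" "card (verts G') \<le> Suc k" "flow_poly G' r' = 0"
    by (auto simp: Phi_roots_def)
  have lt: "r' < r0" using r' y by simp
  \<comment> \<open>With at most \<open>k\<close> vertices, \<open>G'\<close> would put a root below
    the minimum \<open>r0\<close> into \<open>Phi_roots k\<close>.\<close>
  have "card (verts G') = Suc k"
  proof (rule ccontr)
    assume "card (verts G') \<noteq> Suc k"
    then have "r' \<in> Phi_roots k" using G'' by (intro Phi_roots_I) auto
    then show False using r0(2) lt by fastforce
  qed
  then show ?thesis using that G'' lt by (simp add: r0_def)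
qed

lemma Phi_roots_mono: "Phi_roots k \<subseteq> Phi_roots (Suc k)"
  by (auto simp: Phi_roots_def intro: le_SucI)

text \<open>If a graph with fewer than \<open>k\<close> vertices had the least root,
  \<open>smaller_root\<close> for \<open>k - 1\<close> would produce a graph with \<open>k\<close>
  vertices and a still smaller root.\<close>

lemma Min_Phi_roots_attained:
  assumes ne: "Phi_roots k \<noteq> {}"
  obtains G where "G \<in> Phi_k k" "flow_poly G (Min (Phi_roots k)) = 0"
proof -
  define r0 where "r0 = Min (Phi_roots k)"
  have r0: "r0 \<in> Phi_roots k" "\<And>r. r \<in> Phi_roots k \<Longrightarrow> r0 \<le> r"
    using finite_Phi_roots ne by (auto simp: r0_def)
  then obtain G where G: "1 < r0" "r0 < 2" "G \<in> Phi" "card (verts G) \<le> k" "flow_poly G r0 = 0"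
    by (auto simp: Phi_roots_def)
  have "card (verts G) = k"
  proof (rule ccontr)
    assume "card (verts G) \<noteq> k"
    then obtain j where j: "k = Suc j" "card (verts G) \<le> j" using G(4) by (cases k) auto
    then have rj: "r0 \<in> Phi_roots j" using G by (auto simp: Phi_roots_def)
    then have ne': "Phi_roots j \<noteq> {}" and le: "Min (Phi_roots j) \<le> r0" using finite_Phi_roots by auto
    obtain H r where H: "H \<in> Phi" "card (verts H) = Suc j" "flow_poly H r = 0" "1 < r"
        "r < Min (Phi_roots j)"
      using smaller_root[OF ne'] .
    then have "1 < r" "r < 2" using le G(2) by auto
    then have "r \<in> Phi_roots k" using H j(1) by (intro Phi_roots_I[of H]) auto
    then show False using r0(2) H(5) le by fastforce
  qed
  then show ?thesis using that[of G] G by (simp add: Phi_k_def r0_def)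
qed

section \<open>Comparison of \<open>xi\<close> and \<open>eta\<close>\<close>

text \<open>The common value of both sides. The default 2 agrees with the defaults of
  \<open>eta\<close> and \<open>eta_set\<close> and with the cap 2 in \<open>xi\<close>.\<close>

definition min_root :: "nat \<Rightarrow> real" where
  "min_root k = (if Phi_roots k = {} then 2 else Min (Phi_roots k))"

lemma min_root_le: "r \<in> Phi_roots k \<Longrightarrow> min_root k \<le> r"
  using finite_Phi_roots[of k] by (auto simp: min_root_def)

lemma min_root_bounds: "1 < min_root k" "min_root k \<le> 2"
proof -
  have "1 < r \<and> r < 2" if "r \<in> Phi_roots k" for r using that by (simp add: Phi_roots_def)
  moreover have "Min (Phi_roots k) \<in> Phi_roots k" if "Phi_roots k \<noteq> {}" using that finite_Phi_roots
      by auto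
  ultimately show "1 < min_root k" "min_root k \<le> 2" by (auto simp: min_root_def less_imp_le)
qed

lemma min_root_Suc: "min_root (Suc k) \<le> min_root k"
proof (cases "Phi_roots k = {}")
  case True
  then show ?thesis using min_root_bounds(2)[of "Suc k"] by (simp add: min_root_def)
next
  case False
  then have "Min (Phi_roots k) \<in> Phi_roots (Suc k)"
      using finite_Phi_roots[of k] Phi_roots_mono[of k] Min_in by blast
  then show ?thesis using False min_root_le by (simp add: min_root_def)
qed

text \<open>\<open>eta\<close> is built with \<open>Min\<close>, which says something only about
  finite sets; \<open>finite_roots\<close> provides this for graphs in \<open>Phi\<close>.\<close>

lemma eta_Phi:
  assumes G: "G \<in> Phi"
  shows "eta G \<le> 2" and "eta G < 2 \<Longrightarrow> 1 < eta G \<and> flow_poly G (eta G) = 0"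
    and "1 < r \<Longrightarrow> r \<le> 2 \<Longrightarrow> flow_poly G r = 0 \<Longrightarrow> eta G \<le> r"
proof -
  obtain V E s where [simp]: "G = gr V E s" by (rule graph_cases)
  let ?S = "{r. 1 < r \<and> r \<le> 2 \<and> flow_poly G r = 0}"
  have "gr V E s \<in> Phi" using G by simp
  then have "finite ?S"
    using finite_subset[OF _ finite_roots[of V E s], of ?S] flow_poly_gr[OF Phi_props(1)] by auto
  then have M: "Min ?S \<in> ?S" "r \<in> ?S \<Longrightarrow> Min ?S \<le> r" if "?S \<noteq> {}" for r
    using that Min_in Min_le by blast+
  have e: "eta G = (if ?S \<noteq> {} then Min ?S else 2)" unfolding eta_def by (rule if_cong) auto
  show "eta G \<le> 2" "eta G < 2 \<Longrightarrow> 1 < eta G \<and> flow_poly G (eta G) = 0"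
    using M(1) unfolding e by (auto split: if_splits)
  show "eta G \<le> r" if "1 < r" "r \<le> 2" "flow_poly G r = 0"
  proof -
    have "r \<in> ?S" using that by simp
    then show ?thesis using M(2)[of r] unfolding e by auto
  qed
qed

text \<open>Every \<open>eta G\<close> is 2 or a member of \<open>Phi_roots k\<close>, which gives
  the lower bound. Equality needs a graph with exactly \<open>k\<close> vertices at the least root,
  or the default 2 if there is no root.\<close>

lemma eta_set_Phi: "eta_set (Phi_k k) = min_root k"
proof -
  have lower: "min_root k \<le> eta G" if "G \<in> Phi_k k" for G
  proof (cases "eta G < 2")
    case True
    then have "eta G \<in> Phi_roots k" using that eta_Phi(2)[of G] by (auto simp: Phi_roots_def Phi_k_def)
    then show ?thesis by (rule min_root_le)
  next
    case False
    then show ?thesis using min_root_bounds(2)[of k] by simp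
  qed
  show ?thesis
  proof (cases "Phi_roots k = {}")
    case True
    then have m: "min_root k = 2" by (simp add: min_root_def)
    have eq: "eta G = 2" if "G \<in> Phi_k k" for G
      using lower[OF that] eta_Phi(1)[of G] that m by (simp add: Phi_k_def)
    show ?thesis
    proof (cases "Phi_k k = {}")
      case False
      then have "eta ` Phi_k k = {2}" using eq by auto
      then show ?thesis using False m by (simp add: eta_set_def)
    qed (simp add: eta_set_def m)
  next
    case False
    then obtain G where G: "G \<in> Phi_k k" "flow_poly G (Min (Phi_roots k)) = 0"
        by (rule Min_Phi_roots_attained)
    have m: "min_root k = Min (Phi_roots k)" using False by (simp add: min_root_def)
    have "eta G \<le> min_root k"
      using eta_Phi(3)[of G "min_root k"] G min_root_bounds[of k] m by (simp add: Phi_k_def)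
    then have "eta G = min_root k" using lower[OF G(1)] by simp
    then have "Inf (eta ` Phi_k k) = min_root k"
      using G(1) lower by (intro cInf_eq_minimum) force+
    then show ?thesis using G by (auto simp: eta_set_def)
  qed
qed

text \<open>The admissible bounds form a half-open interval: \<open>min_root k\<close> itself
  belongs to it because roots are forbidden only strictly below the bound. It is nonempty as
  \<open>min_root k\<close> exceeds 1, so its supremum is its right end.\<close>

lemma xi_eq: "xi k = min_root k"
proof -
  have "{\<beta>. 1 < \<beta> \<and> \<beta> \<le> 2 \<and> (\<forall>G\<in>Psi k. \<forall>r. 1 < r \<and> r < \<beta> \<longrightarrow> flow_poly G r \<noteq> 0)} = {1<..min_root k}"
  proof (intro equalityI subsetI)
    fix \<beta> assume b: "\<beta> \<in> {\<beta>. 1 < \<beta> \<and> \<beta> \<le> 2 \<and> (\<forall>G\<in>Psi k. \<forall>r. 1 < r \<and> r < \<beta> \<longrightarrow> flow_poly G r \<noteq> 0)}"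
    have "\<beta> \<le> min_root k"
    proof (cases "Phi_roots k = {}")
      case True
      then show ?thesis using b by (simp add: min_root_def)
    next
      case False
      then have "Min (Phi_roots k) \<in> Phi_roots k" using finite_Phi_roots by auto
      then obtain G where "G \<in> Psi k" "flow_poly G (Min (Phi_roots k)) = 0" "1 < Min (Phi_roots k)"
        using Phi_Psi by (auto simp: Phi_roots_def)
      then show ?thesis using b False by (auto simp: min_root_def not_less[symmetric])
    qed
    then show "\<beta> \<in> {1<..min_root k}" using b by simp
  next
    fix \<beta> assume b: "\<beta> \<in> {1<..min_root k}"
    then have b2: "\<beta> \<le> 2" using min_root_bounds(2)[of k] by simp
    have "flow_poly G r \<noteq> 0" if Gr: "G \<in> Psi k" "1 < r" "r < \<beta>" for G r
    proof
      assume "flow_poly G r = 0"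
      moreover have "r < 2" using Gr b2 by simp
      ultimately obtain r' where "r' \<in> Phi_roots k" "r' \<le> r" using Psi_root[OF Gr(1,2)] by blast
      then show False using min_root_le[of r' k] Gr b by simp
    qed
    then show "\<beta> \<in> {\<beta>. 1 < \<beta> \<and> \<beta> \<le> 2 \<and> (\<forall>G\<in>Psi k. \<forall>r. 1 < r \<and> r < \<beta> \<longrightarrow> flow_poly G r \<noteq> 0)}"
      using b b2 by simp
  qed
  then show ?thesis using min_root_bounds(1)[of k] by (simp add: xi_def cSup_greaterThanAtMost)
qed

theorem theorem4p7:
  shows "(\<forall>k. eta_set (Phi_k (Suc k)) \<le> eta_set (Phi_k k)) \<and> (\<forall>k. xi k = eta_set (Phi_k k))"
  by (simp add: eta_set_Phi xi_eq min_root_Suc)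

end
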